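(* For each $n$ let $G=(\mathcal V,\mathcal E)$ be a simple undirected graph with $n$ vertices and $m_n$ edges, whose vertices are colored independently and uniformly with $c_n\ge2$ colors, and let $W$ be the number of monochromatic edges. Let $d_{(n)}=\max_{1\le i\le n}d_i$ be the maximal vertex degree, and assume $d_{(n)}^2\ll c_n\ll m_n$. Then, with $Y^d=Y^d({\rm E}W,\operatorname{Var}W)$, $$d_{\mathrm{TV}}(W,Y^d)\le C\bigg(\sqrt{\frac{c_n}{m_n}}+\frac{d_{(n)}^4}{c_n^3}\bigg),$$ $$d_{\rm loc}(W,Y^d)\le C\bigg(\sqrt{\frac{c_n}{m_n}}+\frac{d_{(n)}^4}{c_n^3}\bigg)^{1/2}\sqrt{\frac{c_n}{m_n}+\frac{d_{(n)}}{\sqrt{c_n}}},$$ where $C$ is a numerical constant.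
   Context: An edge is monochromatic if its two end vertices have the same color. $d_i$ is the degree of the $i$-th vertex. $a_n\ll b_n$ means $a_n/b_n\to0$ as $n\to\infty$. $Y^d(\mu,\sigma^2)$ is the discretized normal random variable: ${\rm P}(Y^d=k)=\int_{k-0.5}^{k+0.5}\frac1{\sqrt{2\pi\sigma^2}}\exp\big[-\frac{(x-\mu)^2}{2\sigma^2}\big]dx$, $k\in\mathbb Z$. $d_{\mathrm{TV}}(U,V)=\sup_{A\subseteq\mathbb Z}|{\rm P}(U\in A)-{\rm P}(V\in A)|$ and $d_{\rm loc}(U,V)=\sup_{a\in\mathbb Z}|{\rm P}(U=a)-{\rm P}(V=a)|$. *)

theory Defs
  imports "HOL-Probability.Probability"
begin

text \<open>A simple undirected graph is a vertex set \<open>V\<close> together with a set \<open>E\<close> of two-element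
  subsets of \<open>V\<close>.\<close>

definition simple_graph :: "'a set \<Rightarrow> 'a set set \<Rightarrow> bool" where
  "simple_graph V E \<longleftrightarrow> finite V \<and> (\<forall>e\<in>E. e \<subseteq> V \<and> card e = 2)"

definition degree :: "'a set set \<Rightarrow> 'a \<Rightarrow> nat" where
  "degree E v = card {e \<in> E. v \<in> e}"

definition max_degree :: "'a set \<Rightarrow> 'a set set \<Rightarrow> nat" where
  "max_degree V E = Max (degree E ` V)"

text \<open>Independent uniform colors from \<open>{1..k}\<close> on the vertices in \<open>V\<close>; the value \<open>0\<close> outside
  \<open>V\<close> is a dummy.\<close>

definition uniform_coloring :: "'a set \<Rightarrow> nat \<Rightarrow> ('a \<Rightarrow> nat) pmf" where
  "uniform_coloring V k = Pi_pmf V 0 (\<lambda>_. pmf_of_set {1..k})"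

definition monochromatic :: "('a \<Rightarrow> nat) \<Rightarrow> 'a set \<Rightarrow> bool" where
  "monochromatic f e \<longleftrightarrow> (\<forall>u\<in>e. \<forall>v\<in>e. f u = f v)"

definition monochromatic_edges_pmf :: "'a set \<Rightarrow> 'a set set \<Rightarrow> nat \<Rightarrow> int pmf" where
  "monochromatic_edges_pmf V E k =
     map_pmf (\<lambda>f. int (card {e \<in> E. monochromatic f e})) (uniform_coloring V k)"

text \<open>The discretized normal distribution. The second parameter \<open>v\<close> is the variance, whereas
  \<^const>\<open>normal_density\<close> takes the standard deviation. The value is meaningful for \<open>v > 0\<close> only;
  see \<open>pmf_discretized_normal\<close> below.\<close>

definition discretized_normal :: "real \<Rightarrow> real \<Rightarrow> int pmf" where
  "discretized_normal \<mu> v = embed_pmf (\<lambda>k.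
     LBINT x:{real_of_int k - 1/2..real_of_int k + 1/2}. normal_density \<mu> (sqrt v) x)"

definition d_TV :: "int pmf \<Rightarrow> int pmf \<Rightarrow> real" where
  "d_TV P Q = (SUP A. \<bar>measure_pmf.prob P A - measure_pmf.prob Q A\<bar>)"

definition d_loc :: "int pmf \<Rightarrow> int pmf \<Rightarrow> real" where
  "d_loc P Q = (SUP a. \<bar>pmf P a - pmf Q a\<bar>)"

text \<open>Since \<open>x / 0 = 0\<close> in HOL, the convergence of the quotient alone would accept a
  sequence \<open>b\<close> that vanishes; \<open>a \<lless> b\<close> presupposes that the quotient makes sense.\<close>

definition much_less :: "(nat \<Rightarrow> real) \<Rightarrow> (nat \<Rightarrow> real) \<Rightarrow> bool" (infix "\<lless>" 50) where
  "a \<lless> b \<longleftrightarrow> (\<forall>\<^sub>F n in sequentially. b n \<noteq> 0) \<and> (\<lambda>n. a n / b n) \<longlonglongrightarrow> 0"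

lemma pmf_discretized_normal:
  assumes "v > 0"
  shows "pmf (discretized_normal \<mu> v) k =
    (LBINT x:{real_of_int k - 1/2..real_of_int k + 1/2}.
       1 / sqrt (2 * pi * v) * exp (- (x - \<mu>)\<^sup>2 / (2 * v)))"
proof -
  define \<sigma> where "\<sigma> = sqrt v"
  have \<sigma>: "\<sigma> > 0" "\<sigma>\<^sup>2 = v" using assms by (auto simp: \<sigma>_def)
  define D where "D = density lborel (\<lambda>x. ennreal (normal_density \<mu> \<sigma> x))"
  interpret D: prob_space D unfolding D_def by (rule prob_space_normal_density[OF \<sigma>(1)])
  define g where "g = (\<lambda>k::int. LBINT x:{real_of_int k - 1/2..real_of_int k + 1/2}. normal_density \<mu> \<sigma> x)"
  have g_nonneg: "g k \<ge> 0" for k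
    unfolding g_def set_lebesgue_integral_def by (intro integral_nonneg_AE) auto
  define I where "I = (\<lambda>k::int. {real_of_int k - 1/2..<real_of_int k + 1/2})"
  have emeasure_I: "emeasure D (I k) = ennreal (g k)" for k
  proof -
    have int: "set_integrable lborel (I k) (normal_density \<mu> \<sigma>)"
      unfolding set_integrable_def using integrable_normal_density[OF \<sigma>(1)]
      by (intro integrable_mult_indicator) (auto simp: I_def)
    have "emeasure D (I k) = (\<integral>\<^sup>+x. ennreal (normal_density \<mu> \<sigma> x) * indicator (I k) x \<partial>lborel)"
      unfolding D_def by (intro emeasure_density) (auto simp: I_def)
    also have "\<dots> = (\<integral>\<^sup>+x. ennreal (indicator (I k) x *\<^sub>R normal_density \<mu> \<sigma> x) \<partial>lborel)"
      by (intro nn_integral_cong) (auto simp: indicator_def)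
    also have "\<dots> = ennreal (LINT x|lborel. indicator (I k) x *\<^sub>R normal_density \<mu> \<sigma> x)"
      using int unfolding set_integrable_def by (intro nn_integral_eq_integral) auto
    also have "(LINT x|lborel. indicator (I k) x *\<^sub>R normal_density \<mu> \<sigma> x) = g k"
      unfolding g_def set_lebesgue_integral_def
    proof (intro integral_cong_AE)
      show "AE x in lborel. indicat_real (I k) x *\<^sub>R normal_density \<mu> \<sigma> x =
        indicat_real {real_of_int k - 1/2..real_of_int k + 1/2} x *\<^sub>R normal_density \<mu> \<sigma> x"
        using AE_lborel_singleton[of "real_of_int k + 1/2"]
        by eventually_elim (auto simp: I_def indicator_def)
    qed (auto simp: I_def)
    finally show ?thesis .
  qed
  have union: "(\<Union>k. I k) = UNIV"
  proof -
    have "x \<in> I \<lfloor>x + 1/2\<rfloor>" for x unfolding I_def by (auto; linarith)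
    thus ?thesis by blast
  qed
  have disj: "disjoint_family I"
    unfolding disjoint_family_on_def I_def by (auto; linarith)
  have "(\<integral>\<^sup>+k. ennreal (g k) \<partial>count_space UNIV) = (\<integral>\<^sup>+k. emeasure D (I k) \<partial>count_space UNIV)"
    by (simp add: emeasure_I)
  also have "\<dots> = emeasure D (\<Union>k. I k)"
    using disj by (intro emeasure_UN_countable[symmetric]) (auto simp: I_def D_def)
  also have "\<dots> = 1"
    using D.emeasure_space_1 by (simp add: union D_def)
  finally have "pmf (embed_pmf g) k = g k"
    by (intro pmf_embed_pmf g_nonneg)
  thus ?thesis
    unfolding discretized_normal_def g_def \<sigma>_def[symmetric] normal_density_def \<sigma>(2) by simp
qed

end

theory Submission
  imports Defs
begin

text \<open>The number \<open>W\<close> of monochromatic edges is a sum of \<open>m\<close> indicators with mean \<open>1/c\<close>. They are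
pairwise independent, so \<open>W\<close> has mean \<open>\<mu> = m/c\<close> and variance \<open>\<sigma>\<^sup>2 = (m/c)(1 - 1/c)\<close>. The proof is
Stein's method carried out on the characteristic function \<open>\<phi>(t) = E exp(it(W - \<mu>))\<close>. It shows
that \<open>\<phi>\<close> almost solves the differential equation of a Gaussian,
\<open>|\<phi>'(t) + t \<sigma>\<^sup>2 \<phi>(t)| \<le> 4 \<sigma>\<^sup>2 t\<^sup>2 exp(-\<sigma>\<^sup>2 t\<^sup>2 / 24)\<close> for \<open>|t| \<le> \<pi>\<close> (\<open>monochromatic_edges_stein\<close>).

Two facts give this equation. First, \<open>\<phi>'(t)\<close> compares, edge by edge, the mean of \<open>w ^ W\<close>, where
\<open>w = exp(it)\<close>, with its mean when the two ends of the edge are forced to have the same color. Forcing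
this correlates only the contributions of the other edges at the two ends, and their covariance is
\<open>O(t\<^sup>2 d\<^sup>2 / c)\<close>, uniformly in the colors of all other vertices (\<open>edge_covariance\<close>). Secondly, all
error terms carry an exponentially small factor, because the characteristic function itself, even
after the colors of some vertices are frozen in the worst possible way, is at most
\<open>exp(-(1 - cos t) e / (2c))\<close>, with \<open>e\<close> the number of edges between vertices that are still free
(\<open>monochromatic_edges_decay\<close>). This is proved by removing the vertices one at a time. Averaging over
the color of a vertex multiplies \<open>w ^ W\<close> by a random factor. The factor is close to a constant of
modulus at most \<open>1 - (7/8) s\<close>, where \<open>s\<close> is at least \<open>(1 - cos t) / c\<close> times the number of its free
neighbours, and deviates from that constant by at most \<open>s / 8\<close> in mean. The deviation depends on
the colors of at most \<open>d\<close> vertices. Freezing them as well spoils at most \<open>d\<^sup>2\<close> edges, which costs no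
more than a constant factor because \<open>d\<^sup>2\<close> is small compared with \<open>c\<close>.

Integrating the differential equation bounds \<open>\<phi>(t) - exp(-\<sigma>\<^sup>2 t\<^sup>2 / 2)\<close> and its derivative
(\<open>gaussian_ode_stability\<close>). Fourier inversion on \<open>[-\<pi>, \<pi>]\<close> turns the first bound into
\<open>d_loc = O(1/\<sigma>\<^sup>2)\<close>. Bessel's inequality for the difference and for its derivative bounds a weighted
\<open>l\<^sup>2\<close> norm of the difference of the mass functions, and with the weight \<open>1 + ((k - \<mu>)/\<sigma>)\<^sup>2\<close> this
controls the \<open>l\<^sup>1\<close> norm, so that \<open>d_TV = O(1/\<sigma>)\<close> (\<open>normal_approximation_of_stein_bound\<close>).
Since \<open>\<sigma>\<^sup>2 \<ge> m/(2c)\<close>, the distances are \<open>O(sqrt(c/m))\<close> and \<open>O(c/m)\<close>, and the two claimed bounds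
dominate these because \<open>c/m \<le> 1\<close> for large \<open>n\<close>.\<close>

section \<open>Averages over independent uniform colors\<close>

text \<open>Expectations over the coloring are iterated averages over one vertex at a time. As an operator on
functions of the whole coloring, the average over \<open>U\<close> leaves the colors outside \<open>U\<close> as parameters;
conditioning on some colors thus means averaging over the other vertices only.\<close>

definition resample :: "nat \<Rightarrow> 'a \<Rightarrow> (('a \<Rightarrow> nat) \<Rightarrow> 'b::real_normed_vector) \<Rightarrow> ('a \<Rightarrow> nat) \<Rightarrow> 'b" where
  "resample c v F f = (\<Sum>j=1..c. F (f(v := j))) /\<^sub>R real c"

definition average :: "nat \<Rightarrow> 'a set \<Rightarrow> (('a \<Rightarrow> nat) \<Rightarrow> 'b::real_normed_vector) \<Rightarrow> ('a \<Rightarrow> nat) \<Rightarrow> 'b" where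
  "average c U F = Finite_Set.fold (resample c) F U"

lemma resample_commute: "resample c u (resample c v F) = resample c v (resample c u F)"
proof (cases "u = v")
  case False
  show ?thesis
  proof
    fix f
    have "(\<Sum>j=1..c. \<Sum>l=1..c. F (f(u := j, v := l))) = (\<Sum>l=1..c. \<Sum>j=1..c. F (f(v := l, u := j)))"
      by (subst sum.swap) (simp add: fun_upd_twist[OF False])
    then show "resample c u (resample c v F) f = resample c v (resample c u F) f"
      by (simp add: resample_def flip: scaleR_right.sum)
  qed
qed simp

interpretation resample: comp_fun_commute "resample c"
  by unfold_locales (auto simp: resample_commute fun_eq_iff)

lemma average_empty [simp]: "average c {} F = F"
  by (simp add: average_def)

lemma average_insert:
  assumes "finite U" "v \<notin> U"
  shows "average c (insert v U) F = resample c v (average c U F)"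
  using assms by (simp add: average_def)

lemma average_insert_inner:
  assumes "finite U" "v \<notin> U"
  shows "average c (insert v U) F = average c U (resample c v F)"
  using assms unfolding average_def by (rule resample.fold_insert2)

lemma average_Un:
  assumes "finite A" "finite B" "A \<inter> B = {}"
  shows "average c (A \<union> B) F = average c A (average c B F)"
  using assms by (induction A) (auto simp: average_insert)

lemma average_add: "average c U (\<lambda>f. F f + G f) = (\<lambda>f. average c U F f + average c U G f)"
proof (induction U rule: infinite_finite_induct)
  case (insert v U)
  then show ?case
    by (simp add: average_insert) (simp add: resample_def sum.distrib scaleR_right_distrib fun_eq_iff)
qed (simp_all add: average_def)

lemma average_linear:
  assumes "bounded_linear L"
  shows "average c U (\<lambda>f. L (F f)) = (\<lambda>f. L (average c U F f))"
proof -
  interpret bounded_linear L by fact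
  show ?thesis
  proof (induction U rule: infinite_finite_induct)
    case (insert v U)
    then show ?case
      by (simp add: average_insert) (simp add: resample_def fun_eq_iff sum scale)
  qed (simp_all add: average_def)
qed

lemma average_zero: "average c U (\<lambda>f. 0) = (\<lambda>f. 0)"
  by (rule average_linear) (rule bounded_linear_zero)

lemma average_sum: "average c U (\<lambda>f. \<Sum>i\<in>I. F i f) = (\<lambda>f. \<Sum>i\<in>I. average c U (F i) f)"
  by (induction I rule: infinite_finite_induct) (simp_all add: average_zero average_add)

lemma average_cmult: "average c U (\<lambda>f. a * F f) = (\<lambda>f. a * average c U F f)"
  for a :: "'b::real_normed_algebra"
  by (rule average_linear) (rule bounded_linear_mult_right)

lemma average_diff: "average c U (\<lambda>f. F f - G f) = (\<lambda>f. average c U F f - average c U G f)"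
  using average_add[of c U F "\<lambda>f. - G f"]
  by (simp add: average_linear[OF bounded_linear_minus[OF bounded_linear_ident]])

lemma average_factor:
  fixes H :: "('a \<Rightarrow> nat) \<Rightarrow> 'b::real_normed_algebra"
  assumes "finite U" "\<And>f v j. v \<in> U \<Longrightarrow> H (f(v := j)) = H f"
  shows "average c U (\<lambda>f. H f * F f) g = H g * average c U F g"
  using assms
proof (induction U arbitrary: g)
  case (insert v U)
  then have "average c U (\<lambda>f. H f * F f) = (\<lambda>f. H f * average c U F f)"
    by blast
  moreover have "H (g(v := j)) = H g" for j
    by (rule insert.prems) simp
  ultimately show ?case
    using insert.hyps by (simp add: average_insert) (simp add: resample_def sum_distrib_left)
qed simp

lemma average_const: "average c U (\<lambda>f. a) = (\<lambda>f. a)" if "c > 0"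
proof (induction U rule: infinite_finite_induct)
  case (insert v U)
  then show ?case
    using that by (simp add: average_insert) (simp add: resample_def fun_eq_iff sum_constant_scaleR)
qed (simp_all add: average_def)

lemma average_mono:
  fixes F G :: "('a \<Rightarrow> nat) \<Rightarrow> real"
  assumes "\<And>f. (\<forall>x\<in>U. f x \<in> {1..c}) \<Longrightarrow> F f \<le> G f" and "finite U"
  shows "average c U F g \<le> average c U G g"
proof -
  have "average c U F g \<le> average c U G g"
    if "\<And>f. (\<forall>x\<in>U. f x \<in> {1..c}) \<Longrightarrow> (\<forall>x. x \<notin> U \<longrightarrow> f x = g x) \<Longrightarrow> F f \<le> G f" for g
    using assms(2) that
  proof (induction U arbitrary: g)
    case (insert v U)
    have "average c U F (g(v := j)) \<le> average c U G (g(v := j))" if "j \<in> {1..c}" for j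
    proof (rule insert.IH)
      fix f assume f: "\<forall>x\<in>U. f x \<in> {1..c}" "\<forall>x. x \<notin> U \<longrightarrow> f x = (g(v := j)) x"
      with insert.hyps(2) that have "f v \<in> {1..c}" by simp
      with f show "F f \<le> G f" by (intro insert.prems) auto
    qed
    then show ?case
      using insert.hyps by (simp add: average_insert) (simp add: resample_def, intro mult_left_mono sum_mono, auto)
  qed auto
  with assms(1) show ?thesis by blast
qed

lemma norm_average_le: "norm (average c U F g) \<le> average c U (\<lambda>f. norm (F f)) g"
proof (induction U arbitrary: g rule: infinite_finite_induct)
  case (insert v U)
  have "norm (\<Sum>j=1..c. average c U F (g(v := j))) \<le> (\<Sum>j=1..c. average c U (\<lambda>f. norm (F f)) (g(v := j)))"
    by (rule order_trans[OF norm_sum]) (intro sum_mono insert.IH)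
  with insert.hyps show ?case
    by (simp add: average_insert) (simp add: resample_def mult_left_mono)
qed (simp_all add: average_def)

lemma average_cong:
  assumes "\<And>f. (\<forall>x\<in>U. f x \<in> {1..c}) \<Longrightarrow> (\<forall>x. x \<notin> U \<longrightarrow> f x = g x) \<Longrightarrow> F f = G f"
    and "finite U"
  shows "average c U F g = average c U G g"
  using assms(2,1)
proof (induction U arbitrary: g)
  case (insert v U)
  have "average c U F (g(v := j)) = average c U G (g(v := j))" if "j \<in> {1..c}" for j
  proof (rule insert.IH)
    fix f assume f: "\<forall>x\<in>U. f x \<in> {1..c}" "\<forall>x. x \<notin> U \<longrightarrow> f x = (g(v := j)) x"
    with insert.hyps(2) that have "f v \<in> {1..c}" by simp
    with f show "F f = G f" by (intro insert.prems) auto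
  qed
  then show ?case
    using insert.hyps by (simp add: average_insert) (simp add: resample_def)
qed auto

lemma average_color:
  fixes H :: "('a \<Rightarrow> nat) \<Rightarrow> real"
  assumes "finite U" "u \<in> U" "j \<in> {1..c}" "\<And>f l. H (f(u := l)) = H f"
  shows "average c U (\<lambda>f. of_bool (f u = j) * H f) g = average c U H g / c"
proof -
  define U' where "U' = U - {u}"
  have U: "U = insert u U'" "u \<notin> U'" "finite U'" using assms by (auto simp: U'_def)
  have "resample c u (\<lambda>f. of_bool (f u = j) * H f) = (\<lambda>f. inverse (real c) * H f)"
    using assms(3) by (simp add: resample_def assms(4) fun_eq_iff of_bool_def if_distrib[of "\<lambda>x. x * _"] sum.delta cong: if_cong)
  moreover have "resample c u H = H"
    using assms(3) by (simp add: resample_def assms(4) fun_eq_iff)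
  ultimately show ?thesis
    using U by (simp add: average_insert_inner average_cmult divide_inverse)
qed

text \<open>Given all other colors, \<open>u\<close> agrees with \<open>v\<close> with probability \<open>1/c\<close>, whatever the color of \<open>v\<close> is;
so the event is independent of any \<open>H\<close> that does not see \<open>u\<close>, even if \<open>H\<close> sees \<open>v\<close>. This is the
source of the pairwise independence of the edges.\<close>

lemma average_edge:
  fixes H :: "('a \<Rightarrow> nat) \<Rightarrow> real"
  assumes "finite U" "u \<in> U" "v \<in> U" "u \<noteq> v" "c > 0" "\<And>f l. H (f(u := l)) = H f"
  shows "average c U (\<lambda>f. of_bool (f u = f v) * H f) g = average c U H g / c"
proof -
  define U' where "U' = U - {u}"
  have U: "U = insert u U'" "u \<notin> U'" "finite U'" "v \<in> U'" using assms by (auto simp: U'_def)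
  have "resample c u (\<lambda>f. of_bool (f u = f v) * H f) f = inverse (real c) * H f" if "f v \<in> {1..c}" for f
    using assms(4) that by (simp add: resample_def assms(6) fun_eq_iff of_bool_def if_distrib[of "\<lambda>x. x * _"] sum.delta cong: if_cong)
  then have "average c U' (resample c u (\<lambda>f. of_bool (f u = f v) * H f)) g = average c U' (\<lambda>f. inverse (real c) * H f) g"
    using U by (intro average_cong) auto
  moreover have "resample c u H = H"
    using assms(5) by (simp add: resample_def assms(6) fun_eq_iff)
  ultimately show ?thesis
    using U by (simp add: average_insert_inner average_cmult divide_inverse)
qed

lemma expectation_uniform_coloring:
  fixes F :: "('a \<Rightarrow> nat) \<Rightarrow> 'b::{banach, second_countable_topology}"
  assumes "finite V" "c > 0"
  shows "measure_pmf.expectation (uniform_coloring V c) F = average c V F (\<lambda>_. 0)"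
  using assms(1)
proof (induction V arbitrary: F)
  case empty
  then show ?case by (simp add: uniform_coloring_def)
next
  case (insert v V)
  have fin: "finite (set_pmf (uniform_coloring V c))"
    unfolding uniform_coloring_def using assms(2) insert.hyps(1)
    by (subst set_Pi_pmf) (auto intro!: finite_PiE_dflt simp: set_pmf_of_set)
  have bind: "uniform_coloring (insert v V) c =
      bind_pmf (uniform_coloring V c) (\<lambda>f. map_pmf (\<lambda>j. f(v := j)) (pmf_of_set {1..c}))"
    unfolding uniform_coloring_def using insert.hyps
    by (simp add: Pi_pmf_insert' map_pmf_def) (rule bind_commute_pmf)
  have inner: "measure_pmf.expectation (pmf_of_set {1..c}) (\<lambda>j. F (f(v := j))) = resample c v F f" for f
    using assms(2) by (subst integral_measure_pmf[of "{1..c}"])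
      (auto simp: resample_def set_pmf_of_set scaleR_sum_right divide_inverse intro!: sum.cong)
  have "measure_pmf.expectation (uniform_coloring (insert v V) c) F =
      measure_pmf.expectation (uniform_coloring V c) (resample c v F)"
    unfolding bind using assms(2)
    by (subst pmf_expectation_bind[OF fin]) (auto simp: inner[simplified] integral_measure_pmf[OF fin] set_pmf_of_set)
  with insert show ?case by (simp add: average_insert_inner)
qed

section \<open>Edges at a vertex\<close>

definition neighbours :: "'a set set \<Rightarrow> 'a \<Rightarrow> 'a set" where
  "neighbours E v = {u. {u, v} \<in> E}"

definition induced :: "'a set set \<Rightarrow> 'a set \<Rightarrow> 'a set set" where
  "induced E X = {e \<in> E. e \<subseteq> X}"

definition mono_count :: "'a set set \<Rightarrow> ('a \<Rightarrow> nat) \<Rightarrow> nat" where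
  "mono_count E f = card {e \<in> E. monochromatic f e}"

lemma monochromatic_pair [simp]: "monochromatic f {u, v} \<longleftrightarrow> f u = f v"
  by (auto simp: monochromatic_def)

lemma inj_doubleton: "inj (\<lambda>u. {u, v})"
  by (auto simp: inj_on_def doubleton_eq_iff)

lemma image_neighbours:
  assumes "\<forall>e\<in>E. card e = 2"
  shows "(\<lambda>u. {u, v}) ` neighbours E v = {e \<in> E. v \<in> e}"
proof -
  have "e \<in> (\<lambda>u. {u, v}) ` neighbours E v" if e: "e \<in> E" "v \<in> e" for e
  proof -
    from e assms obtain x y where "e = {x, y}" "x \<noteq> y" by (auto simp: card_2_iff)
    with e consider "e = {y, v}" | "e = {x, v}" by auto
    with e show ?thesis by cases (auto simp: neighbours_def)
  qed
  then show ?thesis by (auto simp: neighbours_def)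
qed

lemma not_neighbour_self:
  assumes "\<forall>e\<in>E. card e = 2" shows "v \<notin> neighbours E v"
  using assms by (force simp: neighbours_def)

lemma card_neighbours:
  assumes "\<forall>e\<in>E. card e = 2"
  shows "card (neighbours E v) = degree E v"
  unfolding degree_def image_neighbours[OF assms, symmetric]
  by (rule card_image[symmetric]) (rule inj_on_subset[OF inj_doubleton], simp)

lemma finite_neighbours:
  assumes "\<forall>e\<in>E. card e = 2" "finite E"
  shows "finite (neighbours E v)"
proof -
  have "finite ((\<lambda>u. {u, v}) ` neighbours E v)"
    using assms by (simp add: image_neighbours)
  then show ?thesis
    by (rule finite_imageD) (rule inj_on_subset[OF inj_doubleton], simp)
qed

lemma induced_insert:
  assumes "\<forall>e\<in>E. card e = 2"
  shows "induced E (insert v X) = induced E X \<union> (\<lambda>u. {u, v}) ` (neighbours E v \<inter> X)"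
proof -
  have "e \<in> (\<lambda>u. {u, v}) ` (neighbours E v \<inter> X)"
    if e: "e \<in> E" "e \<subseteq> insert v X" "v \<in> e" for e
  proof -
    have "e \<in> (\<lambda>u. {u, v}) ` neighbours E v"
      using e image_neighbours[OF assms, of v] by blast
    then obtain u where u: "e = {u, v}" "u \<in> neighbours E v" by blast
    with not_neighbour_self[OF assms, of v] e have "u \<in> X" by auto
    with u show ?thesis by blast
  qed
  then show ?thesis
    by (auto simp: induced_def neighbours_def)
qed

lemma finite_induced: "finite E \<Longrightarrow> finite (induced E X)"
  by (simp add: induced_def)

lemma card_induced_insert:
  assumes "\<forall>e\<in>E. card e = 2" "finite E" "v \<notin> X"
  shows "card (induced E (insert v X)) = card (induced E X) + card (neighbours E v \<inter> X)"
proof -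
  have "card ((\<lambda>u. {u, v}) ` (neighbours E v \<inter> X)) = card (neighbours E v \<inter> X)"
    by (rule card_image) (rule inj_on_subset[OF inj_doubleton], simp)
  moreover have "induced E X \<inter> (\<lambda>u. {u, v}) ` (neighbours E v \<inter> X) = {}"
    using assms(3) by (auto simp: induced_def)
  ultimately show ?thesis
    using assms by (subst induced_insert) (auto simp: card_Un_disjoint finite_induced finite_neighbours)
qed

text \<open>Giving color \<open>j\<close> to a new vertex makes exactly its edges to neighbours of color \<open>j\<close> monochromatic, so
the color of \<open>v\<close> enters the count through the color counts of its neighbourhood only.\<close>

lemma mono_count_insert:
  assumes "\<forall>e\<in>E. card e = 2" "finite E" "v \<notin> X"
  shows "mono_count (induced E (insert v X)) (f(v := j)) =
    mono_count (induced E X) f + card {u \<in> neighbours E v \<inter> X. f u = j}"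
proof -
  let ?g = "\<lambda>u. {u, v}"
  have "monochromatic (f(v := j)) e = monochromatic f e" if "e \<in> induced E X" for e
    using that assms(3) by (auto simp: induced_def monochromatic_def)
  moreover have "monochromatic (f(v := j)) (?g u) \<longleftrightarrow> f u = j" if "u \<in> X" for u
    using that assms(3) by (auto)
  ultimately have "{e \<in> induced E (insert v X). monochromatic (f(v := j)) e} =
      {e \<in> induced E X. monochromatic f e} \<union> ?g ` {u \<in> neighbours E v \<inter> X. f u = j}"
    unfolding induced_insert[OF assms(1)] by auto
  moreover have "card (?g ` {u \<in> neighbours E v \<inter> X. f u = j}) = card {u \<in> neighbours E v \<inter> X. f u = j}"
    by (rule card_image) (rule inj_on_subset[OF inj_doubleton], simp)
  moreover have "{e \<in> induced E X. monochromatic f e} \<inter> ?g ` {u \<in> neighbours E v \<inter> X. f u = j} = {}"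
    using assms(3) by (auto simp: induced_def)
  ultimately show ?thesis
    unfolding mono_count_def using assms
    by (simp add: card_Un_disjoint finite_induced finite_neighbours)
qed

lemma card_induced_le:
  assumes "finite E" "finite N" "\<forall>v\<in>N. degree E v \<le> d"
  shows "card (induced E X) \<le> card (induced E (X - N)) + card N * d"
proof -
  have "induced E X \<subseteq> induced E (X - N) \<union> (\<Union>v\<in>N. {e \<in> E. v \<in> e})"
    by (auto simp: induced_def)
  then have "card (induced E X) \<le> card (induced E (X - N) \<union> (\<Union>v\<in>N. {e \<in> E. v \<in> e}))"
    using assms by (intro card_mono) (auto simp: finite_induced)
  also have "\<dots> \<le> card (induced E (X - N)) + card (\<Union>v\<in>N. {e \<in> E. v \<in> e})"
    by (rule card_Un_le)
  also have "card (\<Union>v\<in>N. {e \<in> E. v \<in> e}) \<le> (\<Sum>v\<in>N. degree E v)"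
    unfolding degree_def using assms by (intro card_UN_le)
  also have "\<dots> \<le> card N * d"
    using sum_bounded_above[of N "degree E" d] assms by auto
  finally show ?thesis by simp
qed

section \<open>The factor contributed by one vertex\<close>

lemma norm_power_minus_one:
  fixes w :: complex
  assumes "norm w = 1"
  shows "norm (w ^ n - 1) \<le> n * norm (w - 1)"
proof (induction n)
  case (Suc n)
  have "w ^ Suc n - 1 = w * (w ^ n - 1) + (w - 1)" by (simp add: algebra_simps)
  then have "norm (w ^ Suc n - 1) \<le> norm (w ^ n - 1) + norm (w - 1)"
    using norm_triangle_ineq[of "w * (w ^ n - 1)" "w - 1"] assms by (simp only: norm_mult mult_1)
  with Suc show ?case by (simp add: algebra_simps)
qed simp

lemma norm_power_minus_linear:
  fixes w :: complex
  assumes "norm w = 1"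
  shows "norm (w ^ n - 1 - n * (w - 1)) \<le> real n * (real n - 1) / 2 * (norm (w - 1))\<^sup>2"
proof (induction n)
  case (Suc n)
  have "w ^ Suc n - 1 - Suc n * (w - 1) = (w ^ n - 1 - n * (w - 1)) + (w ^ n - 1) * (w - 1)"
    by (simp add: algebra_simps)
  from this have "norm (w ^ Suc n - 1 - Suc n * (w - 1)) \<le>
      norm (w ^ n - 1 - n * (w - 1)) + norm (w ^ n - 1) * norm (w - 1)"
    using norm_triangle_ineq[of "w ^ n - 1 - n * (w - 1)" "(w ^ n - 1) * (w - 1)"] by (simp only: norm_mult)
  also have "norm (w ^ n - 1) * norm (w - 1) \<le> n * norm (w - 1) * norm (w - 1)"
    by (intro mult_right_mono norm_power_minus_one assms) auto
  finally show ?case using Suc by (simp add: algebra_simps power2_eq_square add_divide_distrib diff_divide_distrib)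
qed simp

lemma norm_diff_one_sq:
  fixes w :: complex
  assumes "norm w = 1"
  shows "(norm (w - 1))\<^sup>2 = 2 * (1 - Re w)"
proof -
  have "(Re w)\<^sup>2 + (Im w)\<^sup>2 = 1" using assms cmod_power2[of w] by simp
  then show ?thesis unfolding cmod_power2 by (simp add: power2_eq_square algebra_simps)
qed

text \<open>The modulus is \<open>|a|\<^sup>2 = 1 - 2(1 - Re a) + |a - 1|\<^sup>2\<close>, so that a number whose distance to \<open>1\<close> is small
compared with the square root of \<open>1 - Re a\<close> cannot make up in its imaginary part for what its real
part loses.\<close>

lemma norm_le_of_near_one:
  fixes a :: complex
  assumes "(norm (a - 1))\<^sup>2 \<le> (1 - Re a) / 4"
  shows "norm a \<le> 1 - 7/8 * (1 - Re a)"
proof -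
  define s where "s = 1 - Re a"
  have "(norm a)\<^sup>2 = 1 - 2 * s + (norm (a - 1))\<^sup>2"
    unfolding cmod_power2 s_def by (simp add: power2_eq_square algebra_simps)
  with assms have "(norm a)\<^sup>2 \<le> 1 - 7/4 * s" unfolding s_def by linarith
  moreover have "1 - 7/4 * s \<le> (1 - 7/8 * s)\<^sup>2"
    by (simp add: power2_eq_square algebra_simps)
  moreover have "0 \<le> (norm a)\<^sup>2" by simp
  ultimately have "(norm a)\<^sup>2 \<le> (1 - 7/8 * s)\<^sup>2" "0 \<le> 1 - 7/8 * s" by linarith+
  then show ?thesis unfolding s_def[symmetric] by (rule power2_le_imp_le)
qed

text \<open>Let a vertex have \<open>k\<close> free neighbours, and let \<open>h j\<close> be the factor that its neighbours with frozen
colors contribute if it gets color \<open>j\<close>. To first order in \<open>w - 1\<close>, the mean of its factor is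
the number bounded here. Each of the few colors with \<open>h j \<noteq> 1\<close> and each free neighbour moves it
away from \<open>1\<close>; by Cauchy-Schwarz the squared distance is small against the loss \<open>s\<close> in the real part,
as only a small proportion of the \<open>c\<close> colors is involved.\<close>

lemma phase_mean_norm:
  fixes h :: "nat \<Rightarrow> complex" and w :: complex
  assumes h: "\<And>j. norm (h j) = 1" and w: "norm w = 1"
    and few: "8 * (card {j \<in> {1..c}. h j \<noteq> 1} + k) \<le> c"
  defines "s \<equiv> (\<Sum>j=1..c. 1 - Re (h j)) / c + k * (1 - Re w) / c"
  assumes c: "c > 0"
  shows "norm ((\<Sum>j=1..c. h j) / c + k / c * (w - 1)) \<le> 1 - 7/8 * s"
proof -
  define a where "a = (\<Sum>j=1..c. h j) / c + k / c * (w - 1)"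
  define D where "D = {j \<in> {1..c}. h j \<noteq> 1}"
  have D: "finite D" "D \<subseteq> {1..c}" by (auto simp: D_def)
  have "a = (\<Sum>j=1..c. h j) / of_nat c + of_real (k / c) * (w - 1)" by (simp add: a_def)
  then have "Re a = (\<Sum>j=1..c. Re (h j)) / c + k / c * (Re w - 1)"
    by (simp only: plus_complex.sel Re_divide_of_nat Re_sum Re_complex_of_real Im_complex_of_real times_complex.sel minus_complex.sel) simp
  then have Re: "1 - Re a = s"
    using c by (simp add: s_def sum_subtractf field_simps)
  have "a - 1 = ((\<Sum>j=1..c. h j - 1) + k * (w - 1)) / c"
    using c by (simp add: a_def sum_subtractf field_simps)
  also have "(\<Sum>j=1..c. h j - 1) = (\<Sum>j\<in>D. h j - 1)"
    using D by (intro sum.mono_neutral_right) (auto simp: D_def)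
  finally have "norm (a - 1) \<le> ((\<Sum>j\<in>D. norm (h j - 1)) + k * norm (w - 1)) / c"
    using c by (auto simp: norm_divide norm_mult intro!: divide_right_mono order_trans[OF norm_triangle_ineq] add_mono norm_sum)
  then have "(norm (a - 1))\<^sup>2 \<le> (((\<Sum>j\<in>D. norm (h j - 1)) + k * norm (w - 1)) / c)\<^sup>2"
    by (intro power_mono) auto
  \<comment> \<open>The disjoint sum lists all sources of deviation, so that Cauchy-Schwarz applies to them at once.\<close>
  also have "\<dots> = ((\<Sum>j\<in>D <+> {..<k}. case j of Inl j \<Rightarrow> norm (h j - 1) | Inr _ \<Rightarrow> norm (w - 1)))\<^sup>2 / c\<^sup>2"
    using D by (simp add: power_divide sum.Plus)
  also have "\<dots> \<le> (card (D <+> {..<k}) * (\<Sum>j\<in>D <+> {..<k}. (case j of Inl j \<Rightarrow> norm (h j - 1) | Inr _ \<Rightarrow> norm (w - 1))\<^sup>2)) / c\<^sup>2"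
    using D by (intro divide_right_mono) (auto simp: sum_squared_le_sum_of_squares mult.commute[of "real (card _)"])
  also have "\<dots> = (card D + k) * (2 * ((\<Sum>j\<in>D. 1 - Re (h j)) + k * (1 - Re w))) / c\<^sup>2"
    using D by (simp add: card_Plus sum.Plus norm_diff_one_sq h w sum_distrib_left)
  also have "(\<Sum>j\<in>D. 1 - Re (h j)) = (\<Sum>j=1..c. 1 - Re (h j))"
    using D by (intro sum.mono_neutral_left) (auto simp: D_def)
  also have "(card D + k) * (2 * ((\<Sum>j=1..c. 1 - Re (h j)) + k * (1 - Re w))) / c\<^sup>2 = 2 * (card D + k) / c * s"
    using c by (simp add: s_def field_simps power2_eq_square)
  also have "\<dots> \<le> 1 / 4 * s"
  proof (rule mult_right_mono)
    have "real (8 * (card D + k)) \<le> real c" using few unfolding D_def of_nat_le_iff .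
    then show "real (2 * (card D + k)) / real c \<le> 1 / 4" using c by (simp add: field_simps)
    have "Re (h j) \<le> 1" for j using complex_Re_le_cmod[of "h j"] h by simp
    moreover have "Re w \<le> 1" using complex_Re_le_cmod[of w] w by simp
    ultimately show "s \<ge> 0" by (auto simp: s_def intro!: add_nonneg_nonneg divide_nonneg_nonneg sum_nonneg mult_nonneg_nonneg)
  qed
  finally have "norm a \<le> 1 - 7/8 * (1 - Re a)"
    unfolding Re[symmetric] by (intro norm_le_of_near_one) simp
  then show ?thesis unfolding Re by (simp add: a_def)
qed

text \<open>The second-order part of the factor of a vertex: a color \<open>j\<close> contributes to it only if it is taken by
a free neighbour and already carries a factor \<open>h j \<noteq> 1\<close>, or if two free neighbours share it.\<close>

lemma phase_deviation:
  fixes h :: "nat \<Rightarrow> complex" and w :: complex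
  assumes w: "norm w = 1"
  shows "norm ((\<Sum>j=1..c. h j * w ^ n j) / c - ((\<Sum>j=1..c. h j) / c + (\<Sum>j=1..c. n j) / c * (w - 1))) \<le>
    (\<Sum>j=1..c. norm (h j - 1) * norm (w - 1) * n j + (norm (w - 1))\<^sup>2 / 2 * (real (n j) * (real (n j) - 1))) / c"
proof (cases "c = 0")
  case False
  have "(\<Sum>j=1..c. h j * w ^ n j) / c - ((\<Sum>j=1..c. h j) / c + (\<Sum>j=1..c. n j) / c * (w - 1)) =
      (\<Sum>j=1..c. (h j - 1) * (w ^ n j - 1) + (w ^ n j - 1 - n j * (w - 1))) / c"
    by (simp add: algebra_simps sum.distrib sum_subtractf add_divide_distrib diff_divide_distrib sum_distrib_left sum_distrib_right)
  moreover have "norm ((h j - 1) * (w ^ n j - 1) + (w ^ n j - 1 - n j * (w - 1))) \<le>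
      norm (h j - 1) * norm (w - 1) * n j + (norm (w - 1))\<^sup>2 / 2 * (real (n j) * (real (n j) - 1))" for j
  proof -
    have "norm (h j - 1) * norm (w ^ n j - 1) \<le> norm (h j - 1) * (n j * norm (w - 1))"
      by (intro mult_left_mono norm_power_minus_one w) auto
    moreover have "norm (w ^ n j - 1 - n j * (w - 1)) \<le> (norm (w - 1))\<^sup>2 / 2 * (real (n j) * (real (n j) - 1))"
      using norm_power_minus_linear[OF w, of "n j"] by (simp add: mult_ac)
    ultimately show ?thesis
      by (intro order_trans[OF norm_triangle_ineq] add_mono) (simp_all only: norm_mult mult_ac)
  qed
  ultimately show ?thesis
    by (simp add: norm_divide) (intro divide_right_mono sum_norm_le, auto)
qed simp

lemma average_color_indicator:
  assumes "finite N" "j \<in> {1..c}" "u \<in> N"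
  shows "average c N (\<lambda>f. of_bool (f u = j)) g = 1 / real c"
proof -
  have "c > 0" using assms by simp
  then show ?thesis
    using average_color[OF assms(1) assms(3) assms(2), where H = "\<lambda>_. 1" and g = g] by (simp add: average_const)
qed

lemma color_count_eq_sum:
  assumes "finite N"
  shows "real (card {u \<in> N. f u = j}) = (\<Sum>u\<in>N. of_bool (f u = j))"
proof -
  have "{u \<in> N. f u = j} = N \<inter> {u. f u = j}" by auto
  then show ?thesis using assms by (simp only: sum_of_bool_eq)
qed

lemma average_color_count:
  assumes "finite N" "j \<in> {1..c}"
  shows "average c N (\<lambda>f. real (card {u \<in> N. f u = j})) g = card N / c"
proof -
  have "average c N (\<lambda>f. real (card {u \<in> N. f u = j})) g = (\<Sum>u\<in>N. 1 / real c)"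
    unfolding color_count_eq_sum[OF assms(1)] average_sum
    by (intro sum.cong refl average_color_indicator assms)
  then show ?thesis by simp
qed

lemma average_color_pairs:
  assumes "finite N" "j \<in> {1..c}"
  shows "average c N (\<lambda>f. real (card {u \<in> N. f u = j}) * (real (card {u \<in> N. f u = j}) - 1)) g =
    card N * (real (card N) - 1) / (real c)\<^sup>2"
proof -
  let ?n = "\<lambda>f. real (card {u \<in> N. f u = j})"
  have eq: "?n f * (?n f - 1) = (\<Sum>u\<in>N. \<Sum>v\<in>N - {u}. of_bool (f u = j) * of_bool (f v = j))" for f
  proof -
    have "?n f * (?n f - 1) = (\<Sum>u\<in>N. of_bool (f u = j) * (?n f - 1))"
      unfolding color_count_eq_sum[OF assms(1)] by (simp only: sum_distrib_right)
    also have "\<dots> = (\<Sum>u\<in>N. of_bool (f u = j) * (\<Sum>v\<in>N - {u}. of_bool (f v = j)))"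
    proof (rule sum.cong[OF refl])
      fix u assume "u \<in> N"
      then have "?n f = of_bool (f u = j) + (\<Sum>v\<in>N - {u}. of_bool (f v = j))"
        unfolding color_count_eq_sum[OF assms(1)] using assms(1) by (rule sum.remove[rotated])
      moreover have "of_bool b * (n - 1) = of_bool b * x" if "n = of_bool b + x" for b and n x :: real
        using that by (cases b) auto
      ultimately show "of_bool (f u = j) * (?n f - 1) = of_bool (f u = j) * (\<Sum>v\<in>N - {u}. of_bool (f v = j))"
        by blast
    qed
    finally show ?thesis by (simp only: sum_distrib_left)
  qed
  have pair: "average c N (\<lambda>f. of_bool (f u = j) * of_bool (f v = j)) g = 1 / (real c)\<^sup>2"
    if "u \<in> N" "v \<in> N - {u}" for u v
  proof -
    have "average c N (\<lambda>f. of_bool (f u = j) * of_bool (f v = j)) g = average c N (\<lambda>f. of_bool (f v = j)) g / c"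
      using that by (intro average_color assms) auto
    also have "\<dots> = 1 / real c / c"
      using that by (subst average_color_indicator[OF assms]) auto
    finally show ?thesis by (simp add: power2_eq_square)
  qed
  have "average c N (\<lambda>f. ?n f * (?n f - 1)) g = (\<Sum>u\<in>N. \<Sum>v\<in>N - {u}. 1 / (real c)\<^sup>2)"
    unfolding eq average_sum by (intro sum.cong refl pair)
  also have "\<dots> = (\<Sum>u\<in>N. (real (card N) - 1) * (1 / (real c)\<^sup>2))"
  proof (rule sum.cong[OF refl])
    fix u assume "u \<in> N"
    then have "card N = Suc (card (N - {u}))" using assms(1) by (rule card.remove[rotated])
    then have "real (card (N - {u})) = real (card N) - 1" by linarith
    then show "(\<Sum>v\<in>N - {u}. 1 / (real c)\<^sup>2) = (real (card N) - 1) * (1 / (real c)\<^sup>2)"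
      by (simp only: sum_constant)
  qed
  finally show ?thesis by simp
qed

text \<open>A fixed color is taken by a given neighbour with probability \<open>1/c\<close>, and two neighbours share it with
probability \<open>1/c\<^sup>2\<close>. The mixed terms \<open>|h j - 1| |w - 1|\<close> are split by the inequality between geometric
and arithmetic mean; one half belongs to the loss caused by \<open>h\<close>, the other one to the loss caused by
\<open>w\<close>. So the mean of the deviation is a small multiple of the same \<open>s\<close> that measures the loss of
modulus in \<open>phase_mean_norm\<close>. A pointwise bound would not do, since \<open>k\<close> neighbours of the same color
give a deviation of order \<open>k\<^sup>2\<close>.\<close>

lemma average_phase_deviation:
  fixes h :: "nat \<Rightarrow> complex" and w :: complex
  assumes h: "\<And>j. norm (h j) = 1" and w: "norm w = 1"
    and N: "finite N" and few: "8 * (card {j \<in> {1..c}. h j \<noteq> 1} + card N) \<le> c" and c: "c > 0"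
  defines "n \<equiv> \<lambda>f j. card {u \<in> N. f u = j}"
    and "s \<equiv> (\<Sum>j=1..c. 1 - Re (h j)) / c + card N * (1 - Re w) / c"
  shows "average c N (\<lambda>f. (\<Sum>j=1..c. norm (h j - 1) * norm (w - 1) * n f j +
      (norm (w - 1))\<^sup>2 / 2 * (real (n f j) * (real (n f j) - 1))) / c) g \<le> s / 8"
proof -
  define D where "D = {j \<in> {1..c}. h j \<noteq> 1}"
  define k where "k = real (card N)"
  define \<theta> where "\<theta> = 1 - Re w"
  define \<eta> where "\<eta> = (\<Sum>j=1..c. 1 - Re (h j))"
  have D: "finite D" "D \<subseteq> {1..c}" by (auto simp: D_def)
  have \<theta>: "\<theta> \<ge> 0" using complex_Re_le_cmod[of w] w by (simp add: \<theta>_def)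
  have w2: "(norm (w - 1))\<^sup>2 / 2 = \<theta>" by (simp add: norm_diff_one_sq w \<theta>_def)
  have "Re (h j) \<le> 1" for j using complex_Re_le_cmod[of "h j"] h by simp
  then have \<eta>: "\<eta> \<ge> 0" unfolding \<eta>_def by (intro sum_nonneg) simp
  have "(\<Sum>j=1..c. norm (h j - 1) * norm (w - 1)) = (\<Sum>j\<in>D. norm (h j - 1) * norm (w - 1))"
    using D by (intro sum.mono_neutral_right) (auto simp: D_def)
  also have "\<dots> \<le> (\<Sum>j\<in>D. \<theta> + (1 - Re (h j)))"
  proof (rule sum_mono)
    fix j assume "j \<in> D"
    have "2 * (norm (h j - 1) * norm (w - 1)) \<le> (norm (h j - 1))\<^sup>2 + (norm (w - 1))\<^sup>2"
      using sum_squares_bound[of "norm (h j - 1)" "norm (w - 1)"] by (simp add: mult_ac)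
    then show "norm (h j - 1) * norm (w - 1) \<le> \<theta> + (1 - Re (h j))"
      by (simp add: norm_diff_one_sq h w \<theta>_def)
  qed
  also have "\<dots> = card D * \<theta> + \<eta>"
    unfolding \<eta>_def using D by (simp add: sum.distrib) (intro sum.mono_neutral_left, auto simp: D_def)
  finally have offset: "(\<Sum>j=1..c. norm (h j - 1) * norm (w - 1)) \<le> card D * \<theta> + \<eta>" .
  have "average c N (\<lambda>f. (\<Sum>j=1..c. norm (h j - 1) * norm (w - 1) * n f j +
      (norm (w - 1))\<^sup>2 / 2 * (real (n f j) * (real (n f j) - 1))) / c) g =
      average c N (\<lambda>f. inverse (real c) * (\<Sum>j=1..c. norm (h j - 1) * norm (w - 1) * n f j +
      \<theta> * (real (n f j) * (real (n f j) - 1)))) g"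
    by (simp only: w2 divide_inverse_commute[of _ "real c"])
  also have "\<dots> = inverse (real c) * (\<Sum>j=1..c. norm (h j - 1) * norm (w - 1) * average c N (\<lambda>f. real (n f j)) g +
      \<theta> * average c N (\<lambda>f. real (n f j) * (real (n f j) - 1)) g)"
    by (simp only: average_cmult average_sum average_add)
  also have "\<dots> = inverse (real c) * (\<Sum>j=1..c. norm (h j - 1) * norm (w - 1) * (k / c) + \<theta> * (k * (k - 1) / (real c)\<^sup>2))"
    unfolding n_def k_def using average_color_count[OF N, of _ c g] average_color_pairs[OF N, of _ c g]
    by (intro arg_cong[where f = "\<lambda>x. inverse (real c) * x"] sum.cong refl) simp
  also have "\<dots> = inverse (real c) * ((\<Sum>j=1..c. norm (h j - 1) * norm (w - 1)) * (k / c) + c * (\<theta> * (k * (k - 1) / (real c)\<^sup>2)))"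
    by (simp only: sum.distrib sum_distrib_right[symmetric]) simp
  also have "\<dots> = k / (real c)\<^sup>2 * (\<Sum>j=1..c. norm (h j - 1) * norm (w - 1)) + \<theta> * k * (k - 1) / (real c)\<^sup>2"
  proof -
    have "inverse (real c) * (x * (k / c) + c * y) = k / (real c)\<^sup>2 * x + y" for x y :: real
      using c by (simp add: field_simps power2_eq_square)
    from this[of _ "\<theta> * (k * (k - 1) / (real c)\<^sup>2)"] show ?thesis by (simp only: mult.assoc times_divide_eq_right)
  qed
  also have "\<dots> \<le> k / (real c)\<^sup>2 * (\<Sum>j=1..c. norm (h j - 1) * norm (w - 1)) + \<theta> * k * k / (real c)\<^sup>2"
    using \<theta> by (intro add_left_mono divide_right_mono mult_left_mono) (auto simp: k_def)
  also have "k / (real c)\<^sup>2 * (\<Sum>j=1..c. norm (h j - 1) * norm (w - 1)) + \<theta> * k * k / (real c)\<^sup>2 \<le>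
      k / (real c)\<^sup>2 * (card D * \<theta> + \<eta>) + \<theta> * k * k / (real c)\<^sup>2"
    using offset by (intro add_right_mono mult_left_mono) (auto simp: k_def)
  also have "\<dots> = (card D + k) / c * (k * \<theta> / c) + k / c * (\<eta> / c)"
    using c by (simp add: field_simps power2_eq_square)
  also have "\<dots> \<le> 1/8 * (k * \<theta> / c) + 1/8 * (\<eta> / c)"
  proof (intro add_mono mult_right_mono)
    have "real (8 * (card D + card N)) \<le> real c" using few unfolding D_def of_nat_le_iff .
    then show "(card D + k) / c \<le> 1/8" "k / c \<le> 1/8" using c by (simp_all add: k_def field_simps)
  qed (use \<theta> \<eta> in \<open>auto simp: k_def\<close>)
  also have "\<dots> = s / 8" by (simp add: s_def k_def \<theta>_def \<eta>_def)
  finally show ?thesis .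
qed

section \<open>Decay of the characteristic function\<close>

lemma resample_mono_count:
  fixes w :: complex
  assumes "\<forall>e\<in>E. card e = 2" "finite E" "v \<notin> X"
  shows "resample c v (\<lambda>f. w ^ mono_count (induced E (insert v X)) f) f =
    (\<Sum>j=1..c. w ^ card {u \<in> neighbours E v \<inter> X. f u = j}) / c * w ^ mono_count (induced E X) f"
  unfolding resample_def mono_count_insert[OF assms] power_add sum_distrib_left[symmetric]
  by (simp add: scaleR_conv_of_real divide_inverse mult_ac)

text \<open>The vertices in \<open>S\<close> are frozen with arbitrary colors given by \<open>g\<close>. The induction removes a free vertex
\<open>v\<close>, whose factor \<open>\<Phi>\<close> depends on the colors of its neighbours. Its constant approximation \<open>a\<close> can be
pulled out, and the induction hypothesis for \<open>U - {v}\<close> applies. For \<open>\<Phi> - a\<close> the free neighbours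
\<open>N\<close> of \<open>v\<close> are frozen too; the induction hypothesis for the remaining vertices is uniform in their colors
and only the mean of \<open>|\<Phi> - a|\<close> matters. It is essential that the claim covers all choices of \<open>S\<close> and
\<open>g\<close>, since the frozen set grows along the way.\<close>

lemma monochromatic_edges_decay:
  fixes w :: complex
  assumes E: "\<forall>e\<in>E. card e = 2" "finite E" and deg: "\<And>v. degree E v \<le> d" and d: "8 * d\<^sup>2 \<le> c" and c: "c > 0"
    and w: "norm w = 1" and U: "finite U" "U \<inter> S = {}"
  shows "norm (average c U (\<lambda>f. w ^ mono_count (induced E (U \<union> S)) f) g) \<le>
    exp (- (1 - Re w) * card (induced E U) / (2 * c))"
  using U
proof (induction U arbitrary: S g rule: finite_psubset_induct)
  case (psubset U)
  define \<theta> where "\<theta> = 1 - Re w"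
  have \<theta>: "0 \<le> \<theta>" "\<theta> \<le> 2"
    using complex_Re_le_cmod[of w] abs_Re_le_cmod[of w] w by (auto simp: \<theta>_def)
  show ?case
  proof (cases "U = {}")
    case True
    moreover from E have "induced E {} = {}" by (auto simp: induced_def)
    ultimately show ?thesis by (simp add: norm_power w)
  next
    case False
    then obtain v where v: "v \<in> U" by blast
    define U' where "U' = U - {v}"
    define N where "N = neighbours E v \<inter> U'"
    define R where "R = U' - N"
    define h where "h = (\<lambda>j. w ^ card {u \<in> neighbours E v \<inter> S. g u = j})"
    define n :: "('a \<Rightarrow> nat) \<Rightarrow> nat \<Rightarrow> nat" where "n = (\<lambda>f j. card {u \<in> N. f u = j})"
    define W where "W = (\<lambda>f. w ^ mono_count (induced E (U' \<union> S)) f)"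
    define \<Phi> where "\<Phi> = (\<lambda>f. (\<Sum>j=1..c. h j * w ^ n f j) / c)"
    define k where "k = card N"
    define a where "a = (\<Sum>j=1..c. h j) / c + k / c * (w - 1)"
    define s where "s = (\<Sum>j=1..c. 1 - Re (h j)) / c + k * \<theta> / c"
    define err where "err = (\<lambda>f. (\<Sum>j=1..c. norm (h j - 1) * norm (w - 1) * n f j +
      (norm (w - 1))\<^sup>2 / 2 * (real (n f j) * (real (n f j) - 1))) / c)"
    define b where "b = exp (- \<theta> * card (induced E U') / (2 * c))"
    have fin: "finite U'" "finite N" "finite R" "N \<inter> R = {}" "v \<notin> U'" "v \<notin> S" "U' \<inter> S = {}"
      using psubset.hyps psubset.prems v by (auto simp: U'_def N_def R_def)
    have U'_eq: "U' = N \<union> R" by (auto simp: N_def R_def)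
    have nb: "finite (neighbours E v)" "card (neighbours E v) \<le> d"
      using E deg by (auto simp: finite_neighbours card_neighbours)
    have h1: "norm (h j) = 1" for j by (simp add: h_def norm_power w)
    have s0: "s \<ge> k * \<theta> / c"
    proof -
      have "Re (h j) \<le> 1" for j using complex_Re_le_cmod[of "h j"] h1 by simp
      then have "(\<Sum>j=1..c. 1 - Re (h j)) \<ge> 0" by (intro sum_nonneg) simp
      then show ?thesis by (simp add: s_def)
    qed
    \<comment> \<open>A color with \<open>h j \<noteq> 1\<close> is taken by a frozen neighbour; frozen and free neighbours together are at most \<open>d\<close>.\<close>
    have card_h: "card {j \<in> {1..c}. h j \<noteq> 1} + card N \<le> d"
    proof -
      have "{j \<in> {1..c}. h j \<noteq> 1} \<subseteq> g ` (neighbours E v \<inter> S)"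
      proof
        fix j assume "j \<in> {j \<in> {1..c}. h j \<noteq> 1}"
        then have "h j \<noteq> 1" by simp
        then have "{u \<in> neighbours E v \<inter> S. g u = j} \<noteq> {}"
          by (metis (no_types, lifting) h_def card.empty power_0)
        then show "j \<in> g ` (neighbours E v \<inter> S)" by blast
      qed
      then have "card {j \<in> {1..c}. h j \<noteq> 1} \<le> card (g ` (neighbours E v \<inter> S))"
        using nb by (intro card_mono) auto
      also have "\<dots> \<le> card (neighbours E v \<inter> S)" using nb by (intro card_image_le) auto
      finally have "card {j \<in> {1..c}. h j \<noteq> 1} + card N \<le> card (neighbours E v \<inter> S) + card N" by simp
      also have "\<dots> = card ((neighbours E v \<inter> S) \<union> N)"
        using nb fin by (intro card_Un_disjoint[symmetric]) (auto simp: N_def)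
      also have "\<dots> \<le> card (neighbours E v)" using nb by (intro card_mono) (auto simp: N_def)
      finally show ?thesis using nb by simp
    qed
    have few: "8 * (card {j \<in> {1..c}. h j \<noteq> 1} + card N) \<le> c"
    proof -
      have "8 * (card {j \<in> {1..c}. h j \<noteq> 1} + card N) \<le> 8 * d" by (intro mult_left_mono card_h) simp
      also have "8 * d \<le> 8 * d\<^sup>2" by (simp add: power2_eq_square)
      also note d
      finally show ?thesis .
    qed
    have kd: "k \<le> d" using card_h by (simp add: k_def)

    have U_eq: "insert v U' = U" "insert v (U' \<union> S) = U \<union> S" using v by (auto simp: U'_def)
    have "average c U (\<lambda>f. w ^ mono_count (induced E (U \<union> S)) f) g =
        average c U' (resample c v (\<lambda>f. w ^ mono_count (induced E (insert v (U' \<union> S))) f)) g"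
      unfolding U_eq(2) average_insert_inner[OF fin(1) fin(5), symmetric] U_eq(1) ..
    also have "\<dots> = average c U' (\<lambda>f. \<Phi> f * W f) g"
    proof (rule average_cong)
      fix f assume f: "\<forall>x. x \<notin> U' \<longrightarrow> f x = g x"
      have "card {u \<in> neighbours E v \<inter> (U' \<union> S). f u = j} =
          card {u \<in> neighbours E v \<inter> S. g u = j} + n f j" for j
      proof -
        have "{u \<in> neighbours E v \<inter> (U' \<union> S). f u = j} =
            {u \<in> neighbours E v \<inter> S. g u = j} \<union> {u \<in> N. f u = j}"
          using f fin by (auto simp: N_def)
        then show ?thesis
          unfolding n_def using nb fin by (subst card_Un_disjoint[symmetric]) (auto simp: N_def)
      qed
      then show "resample c v (\<lambda>f. w ^ mono_count (induced E (insert v (U' \<union> S))) f) f = \<Phi> f * W f"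
        using fin by (subst resample_mono_count[OF E]) (auto simp: \<Phi>_def W_def h_def power_add)
    qed (use fin in auto)
    also have "\<dots> = average c U' (\<lambda>f. a * W f + (\<Phi> f - a) * W f) g"
      by (simp only: distrib_right[symmetric] add_diff_cancel_left' add_diff_eq)
    also have "\<dots> = a * average c U' W g + average c U' (\<lambda>f. (\<Phi> f - a) * W f) g"
      by (simp only: average_add average_cmult)
    also have "average c U' (\<lambda>f. (\<Phi> f - a) * W f) g = average c N (\<lambda>f. (\<Phi> f - a) * average c R W f) g"
    proof -
      have "average c R (\<lambda>f. (\<Phi> f - a) * W f) = (\<lambda>f. (\<Phi> f - a) * average c R W f)"
      proof (rule ext, rule average_factor[OF fin(3)])
        fix f x j assume "x \<in> R"
        then have "n (f(x := j)) i = n f i" for i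
          using fin unfolding n_def by (intro arg_cong[where f = card]) auto
        then show "\<Phi> (f(x := j)) - a = \<Phi> f - a" by (simp add: \<Phi>_def)
      qed
      then show ?thesis unfolding U'_eq by (simp only: average_Un[OF fin(2,3,4)])
    qed
    finally have split: "norm (average c U (\<lambda>f. w ^ mono_count (induced E (U \<union> S)) f) g) \<le>
        norm a * norm (average c U' W g) + norm (average c N (\<lambda>f. (\<Phi> f - a) * average c R W f) g)"
      by (simp only: norm_mult[symmetric]) (rule norm_triangle_ineq)

    have IH1: "norm (average c U' W g) \<le> b"
      unfolding W_def b_def \<theta>_def using v fin by (intro psubset.IH) (auto simp: U'_def)
    \<comment> \<open>Freezing \<open>N\<close> loses at most \<open>d\<^sup>2 \<le> c/8\<close> edges, hence a factor of at most \<open>exp (1/8) \<le> 9/7\<close>.\<close>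
    have IH2: "norm (average c R W f) \<le> b * (9/7)" for f
    proof -
      have "norm (average c R W f) \<le> exp (- \<theta> * card (induced E R) / (2 * c))"
      proof -
        have US: "U' \<union> S = R \<union> (N \<union> S)" using U'_eq by auto
        have "R \<subset> U" "R \<inter> (N \<union> S) = {}"
          using v psubset.prems by (auto simp: R_def U'_def)
        then show ?thesis
          unfolding W_def \<theta>_def US by (intro psubset.IH)
      qed
      also have "\<dots> \<le> b * exp (1/8)"
      proof -
        have "card (induced E U') \<le> card (induced E R) + k * d"
          unfolding R_def k_def using E fin deg by (intro card_induced_le) auto
        also have "k * d \<le> d\<^sup>2" using kd by (simp add: power2_eq_square)
        finally have "real (8 * card (induced E U')) \<le> real (8 * card (induced E R) + c)"
          unfolding of_nat_le_iff using d by linarith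
        then have "\<theta> * (8 * card (induced E U')) \<le> \<theta> * (8 * card (induced E R) + c)"
          using \<theta> by (intro mult_left_mono) auto
        also have "\<theta> * (8 * card (induced E R) + c) \<le> \<theta> * (8 * card (induced E R)) + 2 * c"
          using \<theta> by (simp add: distrib_left mult_right_mono)
        finally have "\<theta> * (8 * card (induced E U')) \<le> \<theta> * (8 * card (induced E R)) + 2 * c" .
        then have "- \<theta> * card (induced E R) / (2 * c) \<le> - \<theta> * card (induced E U') / (2 * c) + 1/8"
          using c by (simp add: field_simps)
        then show ?thesis
          unfolding b_def exp_add[symmetric] exp_le_cancel_iff .
      qed
      also have "exp (1/8::real) \<le> 9/7"
      proof -
        have "1 - 1/8 \<le> exp (-(1/8)::real)" using exp_ge_add_one_self[of "-(1/8)"] by simp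
        then show ?thesis by (simp add: exp_minus field_simps)
      qed
      finally show ?thesis by (simp add: b_def)
    qed
    have b0: "b > 0" by (simp add: b_def)

    have dev: "norm (\<Phi> f - a) \<le> err f" if f: "\<forall>x\<in>N. f x \<in> {1..c}" for f
    proof -
      have "(\<Sum>j=1..c. n f j) = card (\<Union>j\<in>{1..c}. {u \<in> N. f u = j})"
        unfolding n_def using fin by (intro card_UN_disjoint[symmetric]) auto
      also have "(\<Union>j\<in>{1..c}. {u \<in> N. f u = j}) = N" using f by auto
      finally have "(\<Sum>j=1..c. n f j) = k" unfolding k_def .
      then have "(\<Sum>j=1..c. complex_of_nat (n f j)) = of_nat k"
        by (simp only: of_nat_sum[symmetric])
      with phase_deviation[OF w, where c = c and h = h and n = "n f"] show ?thesis
        by (simp only: \<Phi>_def a_def err_def of_real_divide of_real_of_nat_eq)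
    qed
    have "norm (average c N (\<lambda>f. (\<Phi> f - a) * average c R W f) g) \<le>
        average c N (\<lambda>f. norm ((\<Phi> f - a) * average c R W f)) g"
      by (rule norm_average_le)
    also have "\<dots> \<le> average c N (\<lambda>f. (b * (9/7)) * err f) g"
    proof (rule average_mono[OF _ fin(2)])
      fix f :: "'a \<Rightarrow> nat" assume "\<forall>x\<in>N. f x \<in> {1..c}"
      from mult_mono'[OF IH2[of f] dev[OF this] norm_ge_zero norm_ge_zero]
      show "norm ((\<Phi> f - a) * average c R W f) \<le> (b * (9/7)) * err f"
        unfolding norm_mult mult.commute[of "norm (\<Phi> f - a)"] .
    qed
    also have "\<dots> \<le> (b * (9/7)) * (s / 8)"
    proof -
      have "average c N err g \<le> s / 8"
        using average_phase_deviation[OF h1 w fin(2) few c, of g]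
        by (simp only: err_def n_def s_def k_def \<theta>_def)
      then show ?thesis
        unfolding average_cmult by (rule mult_left_mono) (use b0 in simp)
    qed
    finally have B2: "norm (average c N (\<lambda>f. (\<Phi> f - a) * average c R W f) g) \<le> b * (9/7) * (s / 8)" .

    have "norm a \<le> 1 - 7/8 * s"
      using phase_mean_norm[OF h1 w few c]
      by (simp only: a_def s_def \<theta>_def k_def of_real_divide of_real_of_nat_eq)
    then have "norm a * norm (average c U' W g) \<le> (1 - 7/8 * s) * b"
      by (rule mult_mono'[OF _ IH1 norm_ge_zero norm_ge_zero])
    with split B2 have "norm (average c U (\<lambda>f. w ^ mono_count (induced E (U \<union> S)) f) g) \<le>
        (1 - 7/8 * s) * b + b * (9/7) * (s / 8)" by linarith
    also have "\<dots> = b * (1 - 5/7 * s)" by (simp add: algebra_simps)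
    also have "\<dots> \<le> b * (1 + - (k * \<theta> / (2 * c)))"
    proof -
      have "k * \<theta> / c \<ge> 0" using \<theta> by simp
      moreover have "1 - 5/7 * s \<le> 1 + - (x / 2)" if "0 \<le> x" "x \<le> s" for x
        using that by linarith
      ultimately have "1 - 5/7 * s \<le> 1 + - (k * \<theta> / c / 2)" using s0 by blast
      then have "b * (1 - 5/7 * s) \<le> b * (1 + - (k * \<theta> / c / 2))"
        by (rule mult_left_mono) (use b0 in simp)
      then show ?thesis by (simp only: divide_divide_eq_left mult.commute[of "real c"] of_nat_mult of_nat_numeral)
    qed
    also have "\<dots> \<le> b * exp (- (k * \<theta> / (2 * c)))"
      using b0 by (intro mult_left_mono exp_ge_add_one_self) auto
    also have "\<dots> = exp (- \<theta> * card (induced E U) / (2 * c))"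
    proof -
      have "card (induced E U) = card (induced E U') + k"
        using card_induced_insert[OF E fin(5)] unfolding U_eq(1) N_def[symmetric] k_def[symmetric] .
      then have "- \<theta> * card (induced E U') / (2 * c) + - (k * \<theta> / (2 * c)) = - \<theta> * card (induced E U) / (2 * c)"
        using c by (simp add: field_simps)
      then show ?thesis unfolding b_def exp_add[symmetric] by (rule arg_cong)
    qed
    finally show ?thesis unfolding \<theta>_def .
  qed
qed

section \<open>Forcing one edge to be monochromatic\<close>

lemma covariance_shift:
  fixes x y :: "nat \<Rightarrow> complex"
  assumes c: "c > 0"
  shows "(\<Sum>j=1..c. x j * y j) / c - (\<Sum>j=1..c. x j) * (\<Sum>j=1..c. y j) / (of_nat c)\<^sup>2 =
    (\<Sum>j=1..c. (x j - 1) * (y j - 1)) / c - (\<Sum>j=1..c. x j - 1) * (\<Sum>j=1..c. y j - 1) / (of_nat c)\<^sup>2"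
proof -
  have "(\<Sum>j=1..c. (x j - 1) * (y j - 1)) = (\<Sum>j=1..c. x j * y j - x j - y j + 1)"
    by (intro sum.cong refl) (simp add: algebra_simps)
  also have "\<dots> = (\<Sum>j=1..c. x j * y j) - (\<Sum>j=1..c. x j) - (\<Sum>j=1..c. y j) + of_nat c"
    by (simp only: sum.distrib sum_subtractf) simp
  finally have 1: "(\<Sum>j=1..c. (x j - 1) * (y j - 1)) = (\<Sum>j=1..c. x j * y j) - (\<Sum>j=1..c. x j) - (\<Sum>j=1..c. y j) + of_nat c" .
  have 2: "(\<Sum>j=1..c. z j - 1) = (\<Sum>j=1..c. z j) - of_nat c" for z :: "nat \<Rightarrow> complex"
    by (simp only: sum_subtractf) simp
  have 3: "p / C - a * b / C\<^sup>2 = (p - a - b + C) / C - (a - C) * (b - C) / C\<^sup>2" if "C \<noteq> 0" for p a b C :: complex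
  proof -
    have "(a - C) * (b - C) / C\<^sup>2 = a * b / C\<^sup>2 - a / C - b / C + 1"
      using that by (simp add: left_diff_distrib right_diff_distrib diff_divide_distrib power2_eq_square)
    moreover have "(p - a - b + C) / C = p / C - a / C - b / C + 1"
      using that by (simp add: add_divide_distrib diff_divide_distrib)
    ultimately show ?thesis by simp
  qed
  have "(of_nat c :: complex) \<noteq> 0" using c by simp
  from 3[OF this] show ?thesis unfolding 1 2 .
qed

text \<open>For a uniform color \<open>j\<close>, this is the covariance of \<open>w ^ n j\<close> and \<open>w ^ n' j\<close>. Both are unchanged if \<open>1\<close>
is subtracted, which makes each of them of size \<open>|w - 1|\<close>, and they differ from \<open>0\<close> for few colors
only.\<close>

lemma covariance_powers_le:
  fixes w :: complex
  assumes w: "norm w = 1" and c: "c > 0"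
    and n: "(\<Sum>j=1..c. n j) \<le> d" "(\<Sum>j=1..c. n' j) \<le> d" and d: "8 * d\<^sup>2 \<le> c"
  shows "norm ((\<Sum>j=1..c. w ^ n j * w ^ n' j) / c - (\<Sum>j=1..c. w ^ n j) * (\<Sum>j=1..c. w ^ n' j) / (of_nat c)\<^sup>2)
    \<le> (norm (w - 1))\<^sup>2 / 4"
proof -
  define q where "q = norm (w - 1)"
  have p: "norm (w ^ i - 1) \<le> i * q" for i unfolding q_def by (rule norm_power_minus_one[OF w])
  have d2: "real d * real d / c \<le> 1/8"
  proof -
    have "real (8 * d\<^sup>2) \<le> real c" using d unfolding of_nat_le_iff .
    then show ?thesis using c by (simp add: field_simps power2_eq_square)
  qed
  have S: "norm (\<Sum>j=1..c. w ^ l j - 1) \<le> d * q" if "(\<Sum>j=1..c. l j) \<le> d" for l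
  proof -
    have "norm (\<Sum>j=1..c. w ^ l j - 1) \<le> (\<Sum>j=1..c. l j * q)" by (intro sum_norm_le p)
    also have "\<dots> = real (\<Sum>j=1..c. l j) * q" by (simp only: sum_distrib_right of_nat_sum)
    also have "\<dots> \<le> d * q"
      using that by (intro mult_right_mono) (simp_all only: of_nat_le_iff q_def norm_ge_zero)
    finally show ?thesis .
  qed
  have S3: "norm (\<Sum>j=1..c. (w ^ n j - 1) * (w ^ n' j - 1)) \<le> real d * real d * q\<^sup>2"
  proof -
    have "norm ((w ^ n j - 1) * (w ^ n' j - 1)) \<le> (n j * q) * (n' j * q)" for j
      unfolding norm_mult by (intro mult_mono' p norm_ge_zero)
    then have "norm (\<Sum>j=1..c. (w ^ n j - 1) * (w ^ n' j - 1)) \<le> (\<Sum>j=1..c. (n j * q) * (n' j * q))"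
      by (intro sum_norm_le)
    also have "\<dots> = (\<Sum>j=1..c. real (n j) * real (n' j)) * q\<^sup>2"
      unfolding sum_distrib_right by (intro sum.cong refl) (simp add: power2_eq_square)
    also have "\<dots> \<le> (real d * real d) * q\<^sup>2"
    proof (rule mult_right_mono)
      have "(\<Sum>j=1..c. n j * n' j) \<le> (\<Sum>j=1..c. n j * (\<Sum>i=1..c. n' i))"
        by (intro sum_mono mult_left_mono member_le_sum) auto
      also have "\<dots> = (\<Sum>j=1..c. n j) * (\<Sum>i=1..c. n' i)" by (simp only: sum_distrib_right)
      also have "\<dots> \<le> d * d" using n by (intro mult_mono) auto
      finally have "real (\<Sum>j=1..c. n j * n' j) \<le> real (d * d)" by (rule of_nat_mono)
      then show "(\<Sum>j=1..c. real (n j) * real (n' j)) \<le> real d * real d"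
        by (simp only: of_nat_mult of_nat_sum)
    qed simp
    finally show ?thesis .
  qed
  have "norm ((\<Sum>j=1..c. (w ^ n j - 1) * (w ^ n' j - 1)) / c - (\<Sum>j=1..c. w ^ n j - 1) * (\<Sum>j=1..c. w ^ n' j - 1) / (of_nat c)\<^sup>2)
      \<le> norm (\<Sum>j=1..c. (w ^ n j - 1) * (w ^ n' j - 1)) / c + norm (\<Sum>j=1..c. w ^ n j - 1) * norm (\<Sum>j=1..c. w ^ n' j - 1) / (real c)\<^sup>2"
    by (rule order_trans[OF norm_triangle_ineq4]) (simp add: norm_divide norm_mult norm_power)
  also have "\<dots> \<le> real d * real d * q\<^sup>2 / c + (d * q) * (d * q) / (real c)\<^sup>2"
    by (rule add_mono[OF divide_right_mono[OF S3] divide_right_mono[OF mult_mono'[OF S[OF n(1)] S[OF n(2)] norm_ge_zero norm_ge_zero]]]) auto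
  also have "\<dots> = (real d * real d / c) * q\<^sup>2 * (1 + 1 / c)"
    using c by (simp add: field_simps power2_eq_square)
  also have "\<dots> \<le> 1/8 * q\<^sup>2 * 2"
    using d2 c by (intro mult_mono[OF mult_right_mono]) auto
  finally show ?thesis
    by (subst covariance_shift[OF c]) (simp add: q_def)
qed

lemma sum_color_count_le:
  fixes f :: "'a \<Rightarrow> nat"
  assumes "finite N" shows "(\<Sum>j=1..c. card {u \<in> N. f u = j}) \<le> card N"
proof -
  have "(\<Sum>j=1..c. card {u \<in> N. f u = j}) = card (\<Union>j\<in>{1..c}. {u \<in> N. f u = j})"
    using assms by (intro card_UN_disjoint[symmetric]) auto
  also have "\<dots> \<le> card N" using assms by (intro card_mono) auto
  finally show ?thesis .
qed

text \<open>The factor \<open>c * of_bool (f u = f v)\<close> is the density that forces the edge \<open>{u, v}\<close> to be monochromatic.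
Once all other colors are fixed, the averages over the colors of \<open>u\<close> and \<open>v\<close> leave the
covariance of the factors of the two ends, which is \<open>O(|w - 1|\<^sup>2)\<close> whatever the colors of their
neighbours are. These at most \<open>2d\<close> neighbours are then frozen, and the decay of the average over the
remaining vertices supplies the exponential factor.\<close>

lemma edge_covariance:
  fixes w :: complex
  assumes E: "\<forall>e\<in>E. card e = 2" "finite E" and deg: "\<And>v. degree E v \<le> d" and d: "8 * d\<^sup>2 \<le> c" and c: "c > 0"
    and w: "norm w = 1" and V: "finite V" "\<And>e. e \<in> E \<Longrightarrow> e \<subseteq> V" and uv: "{u, v} \<in> E"
  shows "norm (average c V (\<lambda>f. (of_nat c * of_bool (f u = f v) - 1) * w ^ mono_count (E - {{u, v}}) f) g) \<le>
    (norm (w - 1))\<^sup>2 / 2 * exp (- (1 - Re w) * card E / (2 * c))"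
proof -
  define \<theta> where "\<theta> = 1 - Re w"
  have \<theta>: "0 \<le> \<theta>" "\<theta> \<le> 2"
    using complex_Re_le_cmod[of w] abs_Re_le_cmod[of w] w by (auto simp: \<theta>_def)
  define E' where "E' = E - {{u, v}}"
  define X where "X = V - {u, v}"
  define Nu where "Nu = neighbours E u \<inter> X"
  define Nv where "Nv = neighbours E v \<inter> X"
  define R where "R = X - (Nu \<union> Nv)"
  define W where "W = (\<lambda>f. w ^ mono_count (induced E X) f)"
  define H where "H = (\<lambda>f. (\<Sum>j=1..c. w ^ card {x \<in> Nu. f x = j} * w ^ card {x \<in> Nv. f x = j}) / of_nat c -
    (\<Sum>j=1..c. w ^ card {x \<in> Nu. f x = j}) * (\<Sum>j=1..c. w ^ card {x \<in> Nv. f x = j}) / (of_nat c)\<^sup>2)"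
  have "u \<noteq> v" using uv E by force
  have V_eq: "V = insert u (insert v X)" using V(2)[OF uv] by (auto simp: X_def)
  have nX: "u \<notin> insert v X" "v \<notin> X" "finite X" using \<open>u \<noteq> v\<close> V by (auto simp: X_def)
  have E': "\<forall>e\<in>E'. card e = 2" "finite E'" using E by (auto simp: E'_def)
  have nb: "finite (neighbours E x)" "card (neighbours E x) \<le> d" for x
    using E deg by (auto simp: finite_neighbours card_neighbours)
  have fin: "finite Nu" "finite Nv" "finite R" using nb nX by (auto simp: Nu_def Nv_def R_def)
  have XE: "X = (Nu \<union> Nv) \<union> R" "(Nu \<union> Nv) \<inter> R = {}" by (auto simp: R_def Nu_def Nv_def)
  have indV: "induced E' (insert u (insert v X)) = E'" using V(2) V_eq by (auto simp: induced_def E'_def)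
  have indX: "induced E' X = induced E X" by (auto simp: induced_def E'_def X_def)
  have Nu_eq: "neighbours E' u \<inter> insert v X = Nu"
    using nX by (auto simp: neighbours_def E'_def Nu_def doubleton_eq_iff insert_commute)
  have Nv_eq: "neighbours E' v \<inter> X = Nv"
    using nX by (auto simp: neighbours_def E'_def Nv_def doubleton_eq_iff)
  have count: "mono_count E' (f(v := l, u := i)) =
      mono_count (induced E X) f + card {x \<in> Nv. f x = l} + card {x \<in> Nu. f x = i}" for f l i
  proof -
    have "mono_count E' (f(v := l, u := i)) = mono_count (induced E' (insert v X)) (f(v := l)) + card {x \<in> Nu. (f(v := l)) x = i}"
      using mono_count_insert[OF E' nX(1), of "f(v := l)" i] unfolding indV Nu_eq .
    also have "{x \<in> Nu. (f(v := l)) x = i} = {x \<in> Nu. f x = i}" using nX by (auto simp: Nu_def)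
    also have "mono_count (induced E' (insert v X)) (f(v := l)) = mono_count (induced E X) f + card {x \<in> Nv. f x = l}"
      using mono_count_insert[OF E' nX(2), of f l] unfolding Nv_eq indX .
    finally show ?thesis .
  qed
  have inner: "resample c v (resample c u (\<lambda>f. (of_nat c * of_bool (f u = f v) - 1) * w ^ mono_count E' f)) f = H f * W f" for f
  proof -
    let ?x = "\<lambda>j. w ^ card {x \<in> Nu. f x = j}" and ?y = "\<lambda>j. w ^ card {x \<in> Nv. f x = j}"
    have "resample c v (resample c u (\<lambda>f. (of_nat c * of_bool (f u = f v) - 1) * w ^ mono_count E' f)) f =
        (\<Sum>l=1..c. \<Sum>i=1..c. (of_nat c * of_bool (i = l) - 1) * (W f * ?y l * ?x i)) / (of_nat c)\<^sup>2"
      using \<open>u \<noteq> v\<close> by (simp add: resample_def count W_def power_add scaleR_conv_of_real sum_distrib_left divide_inverse power2_eq_square mult_ac)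
    also have "(\<Sum>l=1..c. \<Sum>i=1..c. (of_nat c * of_bool (i = l) - 1) * (W f * ?y l * ?x i)) =
        (\<Sum>l=1..c. of_nat c * (W f * ?y l * ?x l)) - (\<Sum>l=1..c. \<Sum>i=1..c. W f * ?y l * ?x i)"
      by (simp add: left_diff_distrib sum_subtractf of_bool_def if_distrib[of "\<lambda>x. x * _"] if_distrib[of "\<lambda>x. _ * x"] sum.delta cong: if_cong)
    also have "(\<Sum>l=1..c. of_nat c * (W f * ?y l * ?x l)) = of_nat c * W f * (\<Sum>j=1..c. ?x j * ?y j)"
      unfolding sum_distrib_left by (intro sum.cong refl) (simp only: mult_ac)
    also have "(\<Sum>l=1..c. \<Sum>i=1..c. W f * ?y l * ?x i) = W f * ((\<Sum>j=1..c. ?y j) * (\<Sum>j=1..c. ?x j))"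
      by (simp only: mult.assoc flip: sum_distrib_left sum_distrib_right)
    also have "(of_nat c * W f * (\<Sum>j=1..c. ?x j * ?y j) - W f * ((\<Sum>j=1..c. ?y j) * (\<Sum>j=1..c. ?x j))) / (of_nat c)\<^sup>2 = H f * W f"
    proof -
      have "(of_nat c * r * p - r * (b * a)) / (of_nat c)\<^sup>2 = (p / of_nat c - a * b / (of_nat c)\<^sup>2) * r" for r p a b :: complex
        using c by (simp add: field_simps power2_eq_square)
      then show ?thesis unfolding H_def .
    qed
    finally show ?thesis .
  qed
  have "average c V G g = average c X (resample c v (resample c u G)) g" for G :: "('a \<Rightarrow> nat) \<Rightarrow> complex"
  proof -
    have "finite (insert v X)" using nX by simp
    then show ?thesis
      unfolding V_eq by (simp only: average_insert_inner nX not_False_eq_True)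
  qed
  from this[of "\<lambda>f. (of_nat c * of_bool (f u = f v) - 1) * w ^ mono_count E' f"]
  have "average c V (\<lambda>f. (of_nat c * of_bool (f u = f v) - 1) * w ^ mono_count E' f) g = average c X (\<lambda>f. H f * W f) g"
    unfolding inner[abs_def] .
  also have "\<dots> = average c (Nu \<union> Nv) (\<lambda>f. H f * average c R W f) g"
  proof -
    have "average c R (\<lambda>f. H f * W f) = (\<lambda>f. H f * average c R W f)"
    proof (rule ext, rule average_factor[OF fin(3)])
      fix f :: "'a \<Rightarrow> nat" and x j assume "x \<in> R"
      then have "{y \<in> Nu. (f(x := j)) y = i} = {y \<in> Nu. f y = i}"
        "{y \<in> Nv. (f(x := j)) y = i} = {y \<in> Nv. f y = i}" for i
        by (auto simp: R_def)
      then show "H (f(x := j)) = H f" by (simp only: H_def)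
    qed
    moreover have "finite (Nu \<union> Nv)" using fin by simp
    ultimately show ?thesis
      unfolding XE(1)[THEN arg_cong[where f = "\<lambda>X. average c X _ _"]]
      by (subst average_Un[OF _ fin(3) XE(2)]) simp_all
  qed
  finally have eq: "average c V (\<lambda>f. (of_nat c * of_bool (f u = f v) - 1) * w ^ mono_count E' f) g =
    average c (Nu \<union> Nv) (\<lambda>f. H f * average c R W f) g" .
  have H: "norm (H f) \<le> (norm (w - 1))\<^sup>2 / 4" for f
  proof -
    have "card Nu \<le> d" "card Nv \<le> d"
      using nb by (auto simp: Nu_def Nv_def intro: order_trans[OF card_mono])
    with sum_color_count_le[OF fin(1), where c = c and f = f] sum_color_count_le[OF fin(2), where c = c and f = f] show ?thesis
      unfolding H_def by (intro covariance_powers_le[OF w c _ _ d]) auto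
  qed
  have RW: "norm (average c R W f) \<le> 2 * exp (- \<theta> * card E / (2 * c))" for f
  proof -
    have "norm (average c R (\<lambda>f. w ^ mono_count (induced E (R \<union> (Nu \<union> Nv))) f) f) \<le>
        exp (- (1 - Re w) * card (induced E R) / (2 * c))"
      using XE fin by (intro monochromatic_edges_decay[OF E deg d c w]) auto
    then have "norm (average c R W f) \<le> exp (- \<theta> * card (induced E R) / (2 * c))"
      using XE by (simp add: W_def Un_commute \<theta>_def)
    also have "\<dots> \<le> exp (- \<theta> * card E / (2 * c)) * exp (1/2)"
    proof -
      have "E = induced E V" using V by (auto simp: induced_def)
      then have "card E \<le> card (induced E (V - (neighbours E u \<union> neighbours E v))) + card (neighbours E u \<union> neighbours E v) * d"
        using card_induced_le[of E "neighbours E u \<union> neighbours E v" d V] E nb deg by auto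
      also have "V - (neighbours E u \<union> neighbours E v) = R"
      proof -
        have "v \<in> neighbours E u" "u \<in> neighbours E v" using uv by (auto simp: neighbours_def insert_commute)
        then show ?thesis by (auto simp: R_def X_def Nu_def Nv_def)
      qed
      also have "card (neighbours E u \<union> neighbours E v) \<le> 2 * d"
        using card_Un_le[of "neighbours E u" "neighbours E v"] nb(2)[of u] nb(2)[of v] by linarith
      finally have "card E \<le> card (induced E R) + 2 * d\<^sup>2" by (simp add: power2_eq_square mult_ac)
      with d have "real (4 * card E) \<le> real (4 * card (induced E R) + c)"
        unfolding of_nat_le_iff by linarith
      then have "\<theta> * (4 * card E) \<le> \<theta> * (4 * card (induced E R) + c)"
        using \<theta> by (intro mult_left_mono) auto
      also have "\<theta> * (4 * card (induced E R) + c) \<le> \<theta> * (4 * card (induced E R)) + 2 * c"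
        using \<theta> by (simp add: distrib_left mult_right_mono)
      finally show ?thesis
        unfolding exp_add[symmetric] exp_le_cancel_iff using c by (simp add: field_simps)
    qed
    also have "exp (1/2::real) \<le> 2"
    proof -
      have "1 - 1/2 \<le> exp (-(1/2)::real)" using exp_ge_add_one_self[of "-(1/2)"] by simp
      then show ?thesis by (simp add: exp_minus field_simps)
    qed
    finally show ?thesis by simp
  qed
  have "norm (average c (Nu \<union> Nv) (\<lambda>f. H f * average c R W f) g) \<le>
      average c (Nu \<union> Nv) (\<lambda>f. norm (H f * average c R W f)) g"
    by (rule norm_average_le)
  also have "\<dots> \<le> average c (Nu \<union> Nv) (\<lambda>f. (norm (w - 1))\<^sup>2 / 4 * (2 * exp (- \<theta> * card E / (2 * c)))) g"
    unfolding norm_mult using fin by (intro average_mono mult_mono H RW) auto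
  finally show ?thesis
    unfolding eq[unfolded E'_def] by (simp add: average_const[OF c] \<theta>_def)
qed

section \<open>The Stein equation for the characteristic function\<close>

lemma of_nat_mono_count:
  assumes "finite E" shows "of_nat (mono_count E f) = (\<Sum>e\<in>E. of_bool (monochromatic f e))"
  using assms by (simp add: mono_count_def Int_def)

lemma norm_cis_minus_one_le: "norm (cis t - 1) \<le> \<bar>t\<bar>"
  using iexp_approx1[of t 0] by (simp add: cis_conv_exp)

lemma norm_cis_minus_linear_le: "norm (cis t - 1 - \<i> * t) \<le> t\<^sup>2 / 2"
  using iexp_approx1[of t 1] by (simp add: cis_conv_exp algebra_simps power2_eq_square)

text \<open>The Taylor polynomial \<open>1 - t\<^sup>2/2 + t\<^sup>4/24\<close> bounds the cosine from above, and \<open>t\<^sup>2 \<le> 10\<close> on the interval.\<close>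

lemma one_minus_cos_ge:
  assumes "\<bar>t\<bar> \<le> pi" shows "1 - cos t \<ge> t\<^sup>2 / 12"
proof -
  obtain s where "cos t = (\<Sum>m<4. cos_coeff m * t ^ m) + (cos (s + 1/2 * real 4 * pi) / fact 4) * t ^ 4"
    using Maclaurin_cos_expansion[of t 4] by blast
  then have "cos t = 1 - t\<^sup>2 / 2 + cos s / 24 * t ^ 4"
    by (simp add: eval_nat_numeral sin_coeff_0 cos_coeff_0 sin_coeff_Suc cos_coeff_Suc)
  also have "cos s / 24 * t ^ 4 \<le> 1 / 24 * t ^ 4" by (intro mult_right_mono) auto
  also have "t ^ 4 = t\<^sup>2 * t\<^sup>2" by (simp add: power2_eq_square power4_eq_xxxx)
  also have "t\<^sup>2 * t\<^sup>2 \<le> 10 * t\<^sup>2"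
  proof (rule mult_right_mono)
    have "t\<^sup>2 \<le> pi\<^sup>2" using assms by (metis abs_le_square_iff abs_of_pos pi_gt_zero)
    also have "pi\<^sup>2 \<le> 3.15\<^sup>2" using pi_approx by (intro power_mono) auto
    finally show "t\<^sup>2 \<le> 10" by (simp add: power2_eq_square)
  qed simp
  finally show ?thesis by simp
qed

text \<open>Here \<open>\<phi>\<close> is the mean of \<open>w ^ W\<close> with \<open>w = cis t\<close>, \<open>A\<close> is the mean of \<open>w\<close> to the number of the other
monochromatic edges, and \<open>B\<close> is the part of \<open>A\<close> from the event that the given edge is monochromatic.
If \<open>c * B\<close> were equal to \<open>A\<close>, the edge would be independent of the other ones, and the left side would
be of second order in \<open>t\<close>.\<close>

lemma edge_error_bound:
  fixes A B \<phi> :: complex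
  assumes c: "8 \<le> c" and \<phi>: "\<phi> = A + (cis t - 1) * B"
    and cov: "norm (of_nat c * B - A) \<le> (norm (cis t - 1))\<^sup>2 / 2 * D" and D: "norm \<phi> \<le> D"
  shows "norm (of_nat c * (cis t * B) - \<phi> - \<i> * t * (1 - 1 / of_nat c) * \<phi>) \<le> 2 * t\<^sup>2 * D"
proof -
  define x where "x = norm (cis t - 1)"
  define \<delta> where "\<delta> = of_nat c * B - A"
  define C where "C = (of_nat c :: complex)"
  have C0: "C \<noteq> 0" "norm C = c" "1 - 1 / C = of_real (1 - 1 / c)" using c by (auto simp: C_def)
  have D0: "0 \<le> D" using D norm_ge_zero order_trans by blast
  have x: "0 \<le> x" "x \<le> \<bar>t\<bar>" "x \<le> 2"
    using norm_cis_minus_one_le[of t] norm_triangle_ineq4[of "cis t" 1] by (auto simp: x_def)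
  have x2: "x\<^sup>2 \<le> t\<^sup>2" "x\<^sup>2 \<le> 4"
    using x power_mono[of x "\<bar>t\<bar>" 2] power_mono[of x 2 2] by auto
  have \<delta>: "norm \<delta> \<le> x\<^sup>2 / 2 * D" using cov by (simp add: \<delta>_def x_def)
  have B: "norm B \<le> D / 2"
  proof -
    have "C * B = \<phi> - (cis t - 1) * B + \<delta>" by (simp add: \<phi> \<delta>_def C_def)
    then have "norm (C * B) \<le> norm (\<phi> - (cis t - 1) * B) + norm \<delta>" by (metis norm_triangle_ineq)
    also have "norm (\<phi> - (cis t - 1) * B) \<le> norm \<phi> + x * norm B"
      by (metis norm_triangle_ineq4 norm_mult x_def)
    finally have "c * norm B \<le> norm \<phi> + x * norm B + norm \<delta>" by (simp add: norm_mult C0)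
    also have "\<dots> \<le> D + 2 * norm B + 2 * D"
    proof (intro add_mono D)
      show "x * norm B \<le> 2 * norm B" using x by (intro mult_right_mono) auto
      have "x\<^sup>2 / 2 * D \<le> 2 * D" using x2 D0 by (intro mult_right_mono) auto
      with \<delta> show "norm \<delta> \<le> 2 * D" by linarith
    qed
    finally have "c * norm B \<le> D + 2 * norm B + 2 * D" .
    moreover have "8 * norm B \<le> c * norm B" using c by (intro mult_right_mono) auto
    ultimately show ?thesis by linarith
  qed
  \<comment> \<open>The covariance \<open>\<delta>\<close>, the second-order part of \<open>cis t\<close> and the square of \<open>cis t - 1\<close> are all that remains.\<close>
  have "C * (cis t * B) - \<phi> - \<i> * t * (1 - 1 / C) * \<phi> =
      (cis t - 1 - \<i> * t) * (1 - 1 / C) * \<phi> - (cis t - 1)\<^sup>2 * (1 - 1 / C) * B + (cis t * \<delta> - (cis t - 1) * \<delta> / C)"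
    using C0(1) unfolding \<phi> \<delta>_def C_def[symmetric] by (simp add: field_simps power2_eq_square)
  also have "norm \<dots> \<le> norm ((cis t - 1 - \<i> * t) * (1 - 1 / C) * \<phi>) + norm ((cis t - 1)\<^sup>2 * (1 - 1 / C) * B)
      + (norm (cis t * \<delta>) + norm ((cis t - 1) * \<delta> / C))"
    by (intro order_trans[OF norm_triangle_ineq] add_mono norm_triangle_ineq4)
  also have "\<dots> \<le> t\<^sup>2 / 2 * 1 * D + t\<^sup>2 * 1 * (D / 2) + (t\<^sup>2 / 2 * D + t\<^sup>2 / 2 * D)"
  proof (intro add_mono)
    have C1: "norm (1 - 1 / C) \<le> 1" using c unfolding C0(3) by (simp del: of_real_diff of_real_divide)
    show "norm ((cis t - 1 - \<i> * t) * (1 - 1 / C) * \<phi>) \<le> t\<^sup>2 / 2 * 1 * D"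
      unfolding norm_mult using norm_cis_minus_linear_le[of t] C1 D D0 by (intro mult_mono) auto
    show "norm ((cis t - 1)\<^sup>2 * (1 - 1 / C) * B) \<le> t\<^sup>2 * 1 * (D / 2)"
      unfolding norm_mult norm_power x_def[symmetric] using x2 C1 B D0 by (intro mult_mono) auto
    have "x\<^sup>2 / 2 * D \<le> t\<^sup>2 / 2 * D" using x2 D0 by (intro mult_right_mono) auto
    with \<delta> have \<delta>': "norm \<delta> \<le> t\<^sup>2 / 2 * D" by linarith
    then show "norm (cis t * \<delta>) \<le> t\<^sup>2 / 2 * D" by (simp add: norm_mult)
    have "x * norm \<delta> / c \<le> 2 * norm \<delta> / 8" using x c by (intro frac_le mult_right_mono) auto
    moreover have "0 \<le> norm \<delta>" by simp
    ultimately have "x * norm \<delta> / c \<le> norm \<delta>" by linarith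
    with \<delta>' have "x * norm \<delta> / c \<le> t\<^sup>2 / 2 * D" by linarith
    then show "norm ((cis t - 1) * \<delta> / C) \<le> t\<^sup>2 / 2 * D"
      by (simp only: norm_divide norm_mult C0(2) x_def[symmetric])
  qed
  also have "\<dots> = 2 * t\<^sup>2 * D" by simp
  finally show ?thesis unfolding C_def .
qed

lemma mono_count_remove:
  assumes "finite E" "e \<in> E"
  shows "mono_count E f = mono_count (E - {e}) f + of_bool (monochromatic f e)"
proof -
  have "{e' \<in> E. monochromatic f e'} = {e' \<in> E - {e}. monochromatic f e'} \<union> (if monochromatic f e then {e} else {})"
    using assms(2) by auto
  then show ?thesis
    unfolding mono_count_def using assms(1) by (auto simp: card_Un_disjoint)
qed

text \<open>The first average is the derivative of the second one with respect to \<open>t\<close>. Writing \<open>W\<close> as the sum of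
the indicators of the edges splits the left side into one term for each edge, which
\<open>edge_error_bound\<close> estimates by \<open>2 t\<^sup>2 exp(-(1 - cos t) m / (2c))\<close>; there are \<open>m\<close> terms, each with a
factor \<open>1/c\<close>.\<close>

lemma monochromatic_edges_stein:
  assumes E: "\<forall>e\<in>E. card e = 2" "finite E" and deg: "\<And>v. degree E v \<le> d" and d: "8 * d\<^sup>2 \<le> c" and c: "8 \<le> c"
    and V: "finite V" "\<And>e. e \<in> E \<Longrightarrow> e \<subseteq> V" and t: "\<bar>t\<bar> \<le> pi"
  defines "\<mu> \<equiv> card E / c" and "\<sigma>2 \<equiv> card E / c * (1 - 1 / c)"
  shows "norm (average c V (\<lambda>f. \<i> * of_real (real (mono_count E f) - \<mu>) * cis (t * (real (mono_count E f) - \<mu>))) g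
      + t * \<sigma>2 * average c V (\<lambda>f. cis (t * (real (mono_count E f) - \<mu>))) g)
    \<le> 4 * \<sigma>2 * t\<^sup>2 * exp (- \<sigma>2 * t\<^sup>2 / 24)"
proof -
  define w where "w = cis t"
  define r where "r = cis (- t * \<mu>)"
  define \<psi> where "\<psi> = average c V (\<lambda>f. w ^ mono_count E f) g"
  define A where "A = (\<lambda>e. average c V (\<lambda>f. w ^ mono_count (E - {e}) f) g)"
  define B where "B = (\<lambda>e. average c V (\<lambda>f. of_bool (monochromatic f e) * w ^ mono_count (E - {e}) f) g)"
  define D where "D = exp (- (1 - Re w) * card E / (2 * c))"
  have c0: "c > 0" using c by simp
  have nw: "norm w = 1" by (simp add: w_def)
  have cis: "cis (t * (real (mono_count E f) - \<mu>)) = r * w ^ mono_count E f" for f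
    unfolding r_def w_def Complex.DeMoivre cis_mult by (rule arg_cong[where f = cis]) (simp add: algebra_simps)
  have remove: "w ^ mono_count E f = w ^ mono_count (E - {e}) f + (w - 1) * (of_bool (monochromatic f e) * w ^ mono_count (E - {e}) f)"
    and bool: "of_bool (monochromatic f e) * w ^ mono_count E f = w * (of_bool (monochromatic f e) * w ^ mono_count (E - {e}) f)"
    if "e \<in> E" for e f
    unfolding mono_count_remove[OF E(2) that] by (auto simp: algebra_simps)
  have \<psi>_AB: "\<psi> = A e + (w - 1) * B e" if "e \<in> E" for e
    unfolding \<psi>_def A_def B_def by (simp only: remove[OF that] average_add average_cmult)
  have AB: "norm (of_nat c * B e - A e) \<le> (norm (w - 1))\<^sup>2 / 2 * D" if e: "e \<in> E" for e
  proof -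
    obtain u v where uv: "e = {u, v}" using E e by (auto simp: card_2_iff)
    have "of_nat c * B e - A e = average c V (\<lambda>f. (of_nat c * of_bool (f u = f v) - 1) * w ^ mono_count (E - {{u, v}}) f) g"
      unfolding A_def B_def uv monochromatic_pair
      by (simp only: left_diff_distrib mult.assoc mult_1_left average_diff average_cmult)
    then show ?thesis
      using edge_covariance[OF E deg d c0 nw V] e unfolding uv D_def by simp
  qed
  have \<psi>D: "norm \<psi> \<le> D"
  proof -
    have "induced E V = E" using V by (auto simp: induced_def)
    then show ?thesis
      using monochromatic_edges_decay[OF E deg d c0 nw V(1), where S = "{}" and g = g] by (simp add: \<psi>_def D_def)
  qed
  have \<mu>: "of_real \<mu> = (of_nat (card E) / of_nat c :: complex)" by (simp add: \<mu>_def)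
  have "average c V (\<lambda>f. \<i> * of_real (real (mono_count E f) - \<mu>) * cis (t * (real (mono_count E f) - \<mu>))) g =
      average c V (\<lambda>f. (\<i> * r) * ((\<Sum>e\<in>E. w * (of_bool (monochromatic f e) * w ^ mono_count (E - {e}) f)) - of_real \<mu> * w ^ mono_count E f)) g"
  proof (rule arg_cong[where f = "\<lambda>F. average c V F g"], rule ext)
    fix f
    have "(\<Sum>e\<in>E. w * (of_bool (monochromatic f e) * w ^ mono_count (E - {e}) f)) = (\<Sum>e\<in>E. of_bool (monochromatic f e) * w ^ mono_count E f)"
      by (intro sum.cong refl) (simp only: bool)
    also have "\<dots> = of_nat (mono_count E f) * w ^ mono_count E f"
      unfolding of_nat_mono_count[OF E(2)] sum_distrib_right[symmetric] ..
    finally have S: "(\<Sum>e\<in>E. w * (of_bool (monochromatic f e) * w ^ mono_count (E - {e}) f)) = of_nat (mono_count E f) * w ^ mono_count E f" .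
    show "\<i> * of_real (real (mono_count E f) - \<mu>) * cis (t * (real (mono_count E f) - \<mu>)) =
        (\<i> * r) * ((\<Sum>e\<in>E. w * (of_bool (monochromatic f e) * w ^ mono_count (E - {e}) f)) - of_real \<mu> * w ^ mono_count E f)"
      unfolding S cis by (simp add: algebra_simps)
  qed
  also have "\<dots> = (\<i> * r) * ((\<Sum>e\<in>E. w * B e) - of_real \<mu> * \<psi>)"
    unfolding B_def \<psi>_def by (simp only: average_cmult average_diff average_sum)
  finally have "average c V (\<lambda>f. \<i> * of_real (real (mono_count E f) - \<mu>) * cis (t * (real (mono_count E f) - \<mu>))) g
      + t * \<sigma>2 * average c V (\<lambda>f. cis (t * (real (mono_count E f) - \<mu>))) g =
      (\<i> * r) * ((\<Sum>e\<in>E. w * B e) - of_real \<mu> * \<psi>) + t * \<sigma>2 * (r * \<psi>)"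
    unfolding cis average_cmult \<psi>_def[symmetric] by simp
  also have "\<dots> = (\<i> * r) * ((\<Sum>e\<in>E. w * B e) - of_real \<mu> * \<psi> - \<i> * t * \<sigma>2 * \<psi>)"
    by (simp add: algebra_simps)
  also have "(\<Sum>e\<in>E. w * B e) - of_real \<mu> * \<psi> - \<i> * t * \<sigma>2 * \<psi> =
      (\<Sum>e\<in>E. of_nat c * (w * B e) - \<psi> - \<i> * t * (1 - 1 / of_nat c) * \<psi>) / of_nat c"
  proof -
    have "(\<Sum>e\<in>E. of_nat c * (w * B e) - \<psi> - \<i> * t * (1 - 1 / of_nat c) * \<psi>) =
        of_nat c * (\<Sum>e\<in>E. w * B e) - of_nat (card E) * \<psi> - of_nat (card E) * (\<i> * t * (1 - 1 / of_nat c) * \<psi>)"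
      by (simp only: sum_subtractf sum_constant sum_distrib_left)
    moreover have "\<sigma>2 = card E / c * (1 - 1 / c)" "complex_of_real (1 - 1 / c) = 1 - 1 / of_nat c"
      by (simp_all add: \<sigma>2_def)
    ultimately show ?thesis
      using c0 unfolding \<mu> by (simp add: diff_divide_distrib)
  qed
  finally have "norm (average c V (\<lambda>f. \<i> * of_real (real (mono_count E f) - \<mu>) * cis (t * (real (mono_count E f) - \<mu>))) g
      + t * \<sigma>2 * average c V (\<lambda>f. cis (t * (real (mono_count E f) - \<mu>))) g) =
      norm (\<Sum>e\<in>E. of_nat c * (w * B e) - \<psi> - \<i> * t * (1 - 1 / of_nat c) * \<psi>) / c"
    by (simp add: norm_mult norm_divide r_def)
  also have "\<dots> \<le> (\<Sum>e\<in>E. 2 * t\<^sup>2 * D) / c"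
  proof (rule divide_right_mono, rule sum_norm_le)
    fix e assume e: "e \<in> E"
    have "norm (of_nat c * (w * B e) - \<psi> - \<i> * t * (1 - 1 / of_nat c) * \<psi>) \<le> 2 * t\<^sup>2 * D"
      using edge_error_bound[OF c \<psi>_AB[OF e, unfolded w_def] AB[OF e, unfolded w_def] \<psi>D] unfolding w_def .
    then show "norm (of_nat c * (w * B e) - \<psi> - \<i> * t * (1 - 1 / of_nat c) * \<psi>) \<le> 2 * t\<^sup>2 * D" .
  qed simp
  also have "\<dots> = (card E / c) * (2 * t\<^sup>2 * D)" by simp
  also have "\<dots> \<le> (2 * \<sigma>2) * (2 * t\<^sup>2 * exp (- \<sigma>2 * t\<^sup>2 / 24))"
  proof (intro mult_mono mult_left_mono)
    have "1 / 2 \<le> 1 - 1 / real c" using c by (simp add: field_simps)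
    then have "card E / c * (1 / 2) \<le> \<sigma>2" unfolding \<sigma>2_def by (intro mult_left_mono) auto
    then show "card E / c \<le> 2 * \<sigma>2" by simp
    then show "0 \<le> 2 * \<sigma>2" by (rule order_trans[rotated]) simp
    have "\<sigma>2 * (t\<^sup>2 / 12) \<le> card E / c * (1 - cos t)"
    proof (rule mult_mono)
      show "\<sigma>2 \<le> card E / c" unfolding \<sigma>2_def using c by (intro mult_left_le) auto
    qed (use one_minus_cos_ge[OF t] in auto)
    then have le: "- (card E / c * (1 - cos t)) / 2 \<le> - (\<sigma>2 * (t\<^sup>2 / 12)) / 2"
      by (intro divide_right_mono le_imp_neg_le) auto
    have e1: "- (1 - Re w) * card E / (2 * c) = - (card E / c * (1 - cos t)) / 2" using c0 by (simp add: w_def field_simps)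
    have e2: "- \<sigma>2 * t\<^sup>2 / 24 = - (\<sigma>2 * (t\<^sup>2 / 12)) / 2" by simp
    show "D \<le> exp (- \<sigma>2 * t\<^sup>2 / 24)"
      unfolding D_def exp_le_cancel_iff e1 e2 by (rule le)
  qed (auto simp: D_def)
  also have "\<dots> = 4 * \<sigma>2 * t\<^sup>2 * exp (- \<sigma>2 * t\<^sup>2 / 24)" by simp
  finally show ?thesis by (simp only: of_real_mult)
qed

section \<open>Mean and variance\<close>

lemma average_monochromatic:
  assumes "card e = 2" "finite V" "e \<subseteq> V" "c > 0"
  shows "average c V (\<lambda>f. of_bool (monochromatic f e)) g = 1 / real c"
proof -
  obtain u v where "e = {u, v}" "u \<noteq> v" using assms by (auto simp: card_2_iff)
  then show ?thesis
    using average_edge[of V u v c "\<lambda>_. 1" g] assms by (simp add: average_const)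
qed

text \<open>Different edges are independent: some end \<open>u\<close> of \<open>e\<close> does not lie on \<open>e'\<close>, and its color alone decides,
given all others, whether \<open>e\<close> is monochromatic.\<close>

lemma average_monochromatic_pair:
  assumes "card e = 2" "card e' = 2" "e \<noteq> e'" "finite V" "e \<subseteq> V" "e' \<subseteq> V" "c > 0"
  shows "average c V (\<lambda>f. of_bool (monochromatic f e) * of_bool (monochromatic f e')) g = 1 / (real c)\<^sup>2"
proof -
  obtain u v where uv: "e = {u, v}" "u \<noteq> v" "u \<notin> e'"
  proof -
    obtain x y where "e = {x, y}" "x \<noteq> y" using assms by (auto simp: card_2_iff)
    moreover have "\<not> e \<subseteq> e'" using assms by (metis card_subset_eq card.infinite zero_neq_numeral)
    ultimately show ?thesis using that[of x y] that[of y x] by auto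
  qed
  have "average c V (\<lambda>f. of_bool (f u = f v) * of_bool (monochromatic f e')) g =
      average c V (\<lambda>f. of_bool (monochromatic f e')) g / c"
  proof (rule average_edge)
    fix f :: "'a \<Rightarrow> nat" and l
    have "monochromatic (f(u := l)) e' = monochromatic f e'"
      using uv(3) by (auto simp: monochromatic_def)
    then show "of_bool (monochromatic (f(u := l)) e') = (of_bool (monochromatic f e') :: real)" by simp
  qed (use uv assms in auto)
  then show ?thesis
    using assms by (simp add: uv(1) average_monochromatic power2_eq_square)
qed

lemma average_mono_count:
  assumes "\<forall>e\<in>E. card e = 2" "finite E" "finite V" "\<And>e. e \<in> E \<Longrightarrow> e \<subseteq> V" "c > 0"
  shows "average c V (\<lambda>f. real (mono_count E f)) g = card E / c"
proof -
  have "average c V (\<lambda>f. real (mono_count E f)) g = (\<Sum>e\<in>E. 1 / real c)"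
    unfolding of_nat_mono_count[OF assms(2)] average_sum
    using assms by (intro sum.cong refl average_monochromatic) auto
  then show ?thesis by simp
qed

lemma average_mono_count_variance:
  assumes "\<forall>e\<in>E. card e = 2" "finite E" "finite V" "\<And>e. e \<in> E \<Longrightarrow> e \<subseteq> V" "c > 0"
  shows "average c V (\<lambda>f. (real (mono_count E f) - card E / c)\<^sup>2) g = card E / c * (1 - 1 / c)"
proof -
  define m where "m = real (card E)"
  have sq: "(real (mono_count E f))\<^sup>2 = (\<Sum>e\<in>E. \<Sum>e'\<in>E. of_bool (monochromatic f e) * of_bool (monochromatic f e'))" for f
    unfolding of_nat_mono_count[OF assms(2)] power2_eq_square sum_product ..
  have "average c V (\<lambda>f. (real (mono_count E f))\<^sup>2) g =
      (\<Sum>e\<in>E. \<Sum>e'\<in>E. if e = e' then 1 / real c else 1 / (real c)\<^sup>2)"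
    unfolding sq average_sum
  proof (intro sum.cong refl)
    fix e e' assume "e \<in> E" "e' \<in> E"
    then show "average c V (\<lambda>f. of_bool (monochromatic f e) * of_bool (monochromatic f e')) g =
        (if e = e' then 1 / real c else 1 / (real c)\<^sup>2)"
      using average_monochromatic_pair[of e e' V c g] average_monochromatic[of e V c g] assms
      by (cases "e = e'") (simp_all flip: of_bool_conj)
  qed
  also have "\<dots> = (\<Sum>e\<in>E. 1 / real c + (m - 1) / (real c)\<^sup>2)"
  proof (rule sum.cong[OF refl])
    fix e assume e: "e \<in> E"
    have "(\<Sum>e'\<in>E. if e = e' then 1 / real c else 1 / (real c)\<^sup>2) =
        1 / real c + (\<Sum>e'\<in>E - {e}. if e = e' then 1 / real c else 1 / (real c)\<^sup>2)"
      using e assms(2) by (subst sum.remove[of _ e]) auto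
    also have "(\<Sum>e'\<in>E - {e}. if e = e' then 1 / real c else 1 / (real c)\<^sup>2) = (\<Sum>e'\<in>E - {e}. 1 / (real c)\<^sup>2)"
      by (intro sum.cong) auto
    also have "\<dots> = (m - 1) / (real c)\<^sup>2"
    proof -
      have "card E = Suc (card (E - {e}))" using e assms(2) by (intro card.remove) auto
      then have "real (card (E - {e})) = m - 1" unfolding m_def by linarith
      then show ?thesis by (simp only: sum_constant times_divide_eq_right mult_1_right)
    qed
    finally show "(\<Sum>e'\<in>E. if e = e' then 1 / real c else 1 / (real c)\<^sup>2) = 1 / real c + (m - 1) / (real c)\<^sup>2" .
  qed
  also have "\<dots> = m / c + m * (m - 1) / (real c)\<^sup>2" by (simp add: m_def distrib_left)
  finally have second: "average c V (\<lambda>f. (real (mono_count E f))\<^sup>2) g = m / c + m * (m - 1) / (real c)\<^sup>2" .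
  have "(real (mono_count E f) - m / c)\<^sup>2 =
      (real (mono_count E f))\<^sup>2 - (2 * (m / c)) * real (mono_count E f) + (m / c)\<^sup>2" for f
    by (simp add: power2_eq_square algebra_simps)
  then have "average c V (\<lambda>f. (real (mono_count E f) - m / c)\<^sup>2) g =
      m / c + m * (m - 1) / (real c)\<^sup>2 - (2 * (m / c)) * (m / c) + (m / c)\<^sup>2"
    using average_mono_count[OF assms, where g = g] second
    by (simp only: average_add average_diff average_cmult average_const[OF assms(5)] m_def)
  also have "\<dots> = m / c * (1 - 1 / c)"
    using assms(5) by (simp add: field_simps power2_eq_square)
  finally show ?thesis by (simp add: m_def)
qed

section \<open>Gaussian bounds and lattice sums\<close>

text \<open>An upper bound for \<open>(1 + x\<^sup>2) |x| ^ n exp(-x\<^sup>2/24)\<close>, obtained from the bounds \<open>24 ^ i * fact i\<close> for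
\<open>y ^ i exp(-y/24)\<close> with \<open>y = x\<^sup>2\<close> and the exponents \<open>0\<close>, \<open>1\<close>, \<open>n\<close> and \<open>n + 1\<close>. All error functions below are
compared with the kernel \<open>1 / (1 + x\<^sup>2)\<close>, whose integrals and lattice sums are explicit.\<close>

definition gauss_const :: "nat \<Rightarrow> real" where
  "gauss_const n = 1 + 24 + 24 ^ n * fact n + 24 ^ (n + 1) * fact (n + 1)"

lemma gauss_const_nonneg: "gauss_const n \<ge> 0"
  by (simp add: gauss_const_def)

lemma power_exp_bound:
  fixes y :: real assumes "0 \<le> y"
  shows "y ^ n * exp (- y / 24) \<le> 24 ^ n * fact n"
proof -
  have "(\<Sum>i\<in>{n}. (y / 24) ^ i /\<^sub>R fact i) \<le> (\<Sum>i. (y / 24) ^ i /\<^sub>R fact i)"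
    using assms by (intro sum_le_suminf summable_exp_generic) auto
  moreover have "(\<Sum>i\<in>{n}. (y / 24) ^ i /\<^sub>R fact i) = (y / 24) ^ n / fact n"
    by (simp only: sum.insert sum.empty finite.emptyI empty_iff not_False_eq_True add_0_right real_scaleR_def divide_inverse_commute[of _ "fact n"])
  ultimately have "(y / 24) ^ n / fact n \<le> exp (y / 24)"
    by (simp only: exp_def)
  then have "(y / 24) ^ n \<le> fact n * exp (y / 24)"
    by (simp only: pos_divide_le_eq[OF fact_gt_zero] mult.commute[of "fact n"])
  then have "24 ^ n * (y / 24) ^ n \<le> 24 ^ n * (fact n * exp (y / 24))" by (rule mult_left_mono) simp
  then have "y ^ n \<le> 24 ^ n * fact n * exp (y / 24)"
    by (simp add: power_divide mult.assoc)
  then have "y ^ n * exp (- (y / 24)) \<le> 24 ^ n * fact n * exp (y / 24) * exp (- (y / 24))"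
    by (rule mult_right_mono) simp
  also have "\<dots> = 24 ^ n * fact n" by (simp add: exp_minus)
  finally show ?thesis by simp
qed

lemma power_gauss_bound:
  fixes x :: real
  shows "\<bar>x\<bar> ^ n * exp (- x\<^sup>2 / 24) \<le> gauss_const n / (1 + x\<^sup>2)"
proof -
  define y where "y = x\<^sup>2"
  have y: "0 \<le> y" by (simp add: y_def)
  have "\<bar>x\<bar> ^ n \<le> 1 + y ^ n"
  proof (cases "\<bar>x\<bar> \<le> 1")
    case True
    then have "\<bar>x\<bar> ^ n \<le> 1" by (intro power_le_one) auto
    then show ?thesis using y by (simp add: add_increasing2)
  next
    case False
    then have "\<bar>x\<bar> ^ n \<le> \<bar>x\<bar> ^ (2 * n)" by (intro power_increasing) auto
    then show ?thesis by (simp add: y_def power_mult)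
  qed
  then have "(1 + y) * \<bar>x\<bar> ^ n * exp (- y / 24) \<le> (1 + y) * (1 + y ^ n) * exp (- y / 24)"
    using y by (intro mult_right_mono mult_left_mono) auto
  also have "\<dots> = y ^ 0 * exp (- y / 24) + y ^ 1 * exp (- y / 24) + y ^ n * exp (- y / 24) + y ^ (n + 1) * exp (- y / 24)"
    by (simp add: algebra_simps)
  also have "\<dots> \<le> 24 ^ 0 * fact 0 + 24 ^ 1 * fact 1 + 24 ^ n * fact n + 24 ^ (n + 1) * fact (n + 1)"
    by (intro add_mono power_exp_bound y)
  also have "\<dots> = gauss_const n" by (simp add: gauss_const_def)
  finally have "(1 + y) * (\<bar>x\<bar> ^ n * exp (- y / 24)) \<le> gauss_const n" by (simp only: mult.assoc)
  then show ?thesis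
    using y by (simp add: y_def[symmetric] pos_le_divide_eq mult.commute)
qed

lemma arctan_scaled_deriv:
  fixes a \<sigma> :: real
  assumes "\<sigma> > 0"
  shows "((\<lambda>x. arctan ((x - a) / \<sigma>)) has_real_derivative (1 / \<sigma>) / (1 + ((x - a) / \<sigma>)\<^sup>2)) (at x within S)"
  using assms by (auto intro!: derivative_eq_intros simp: divide_simps)

lemma integral_le_of_cauchy_bound:
  fixes f :: "real \<Rightarrow> real"
  assumes f: "f integrable_on {-b..b}" and b: "0 \<le> b" and \<sigma>: "\<sigma> > 0" and A: "0 \<le> A"
    and le: "\<And>t. t \<in> {-b..b} \<Longrightarrow> f t \<le> A / (1 + (\<sigma> * t)\<^sup>2)"
  shows "integral {-b..b} f \<le> A * pi / \<sigma>"
proof -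
  have "((\<lambda>t. A / \<sigma> * arctan (\<sigma> * t)) has_vector_derivative A / (1 + (\<sigma> * t)\<^sup>2)) (at t within {-b..b})" for t
  proof -
    have "((\<lambda>t. A / \<sigma> * arctan (\<sigma> * t)) has_real_derivative A / \<sigma> * (\<sigma> / (1 + (\<sigma> * t)\<^sup>2))) (at t within {-b..b})"
      by (auto intro!: derivative_eq_intros simp: divide_inverse)
    moreover have "A / \<sigma> * (\<sigma> / (1 + (\<sigma> * t)\<^sup>2)) = A / (1 + (\<sigma> * t)\<^sup>2)" using \<sigma> by simp
    ultimately show ?thesis by (simp only: has_real_derivative_iff_has_vector_derivative)
  qed
  then have "((\<lambda>t. A / (1 + (\<sigma> * t)\<^sup>2)) has_integral A / \<sigma> * arctan (\<sigma> * b) - A / \<sigma> * arctan (\<sigma> * (-b))) {-b..b}"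
    using b by (intro fundamental_theorem_of_calculus) auto
  then have "integral {-b..b} f \<le> A / \<sigma> * arctan (\<sigma> * b) - A / \<sigma> * arctan (\<sigma> * (-b))"
    by (rule has_integral_le[OF integrable_integral[OF f] _ le])
  also have "\<dots> = A / \<sigma> * (2 * arctan (\<sigma> * b))" by (simp add: arctan_minus)
  also have "\<dots> \<le> A / \<sigma> * pi"
    using A \<sigma> arctan_ubound[of "\<sigma> * b"] by (intro mult_left_mono) auto
  finally show ?thesis by simp
qed

text \<open>On the scale \<open>\<sigma> \<ge> 1\<close> the kernel \<open>1 / (1 + (x/\<sigma>)\<^sup>2)\<close> changes at most by a factor \<open>2\<close> within a unit cell
around a lattice point.\<close>

lemma near_square_bound:
  fixes x y \<sigma> :: real
  assumes "\<bar>x - y\<bar> \<le> 1/2" "\<sigma> \<ge> 1"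
  shows "1 + (x / \<sigma>)\<^sup>2 \<le> 2 * (1 + (y / \<sigma>)\<^sup>2)"
proof -
  have "x\<^sup>2 \<le> 2 * y\<^sup>2 + 2 * (x - y)\<^sup>2"
    using zero_le_power2[of "x - 2 * y"] by (simp add: power2_eq_square algebra_simps)
  also have "(x - y)\<^sup>2 \<le> (1/2)\<^sup>2" using assms(1) by (metis abs_le_square_iff abs_of_nonneg zero_le_divide_1_iff zero_le_numeral)
  finally have "x\<^sup>2 \<le> 2 * y\<^sup>2 + 1/2" by (simp add: power2_eq_square)
  then have "x\<^sup>2 / \<sigma>\<^sup>2 \<le> (2 * y\<^sup>2 + 1/2) / \<sigma>\<^sup>2" by (intro divide_right_mono) auto
  also have "\<dots> = 2 * (y\<^sup>2 / \<sigma>\<^sup>2) + 1/2 / \<sigma>\<^sup>2" by (simp add: add_divide_distrib)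
  also have "1/2 / \<sigma>\<^sup>2 \<le> 1/2 / 1" using assms(2) by (intro divide_left_mono) (auto simp: one_le_power)
  finally show ?thesis by (simp add: power_divide)
qed

text \<open>Each term is at most twice the integral of the kernel over the unit cell around \<open>k\<close>, which is an increment
of the arctangent; the increments telescope.\<close>

lemma lattice_cauchy_sum:
  fixes \<mu> \<sigma> :: real
  assumes \<sigma>: "\<sigma> \<ge> 1" and F: "finite F"
  shows "(\<Sum>k\<in>F. 1 / (1 + ((real_of_int k - \<mu>) / \<sigma>)\<^sup>2)) \<le> 2 * pi * \<sigma>"
proof -
  define T where "T = (\<lambda>k::int. arctan ((real_of_int k - 1/2 - \<mu>) / \<sigma>))"
  have step: "1 / (1 + ((real_of_int k - \<mu>) / \<sigma>)\<^sup>2) \<le> 2 * \<sigma> * (T (k + 1) - T k)" for k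
  proof -
    have "\<exists>z. real_of_int k - 1/2 < z \<and> z < real_of_int k + 1/2 \<and>
        arctan ((real_of_int k + 1/2 - \<mu>) / \<sigma>) - arctan ((real_of_int k - 1/2 - \<mu>) / \<sigma>) =
        (real_of_int k + 1/2 - (real_of_int k - 1/2)) * ((1 / \<sigma>) / (1 + ((z - \<mu>) / \<sigma>)\<^sup>2))"
      using \<sigma> by (intro MVT2[where f = "\<lambda>x. arctan ((x - \<mu>) / \<sigma>)"] arctan_scaled_deriv) auto
    then obtain z where z: "real_of_int k - 1/2 < z" "z < real_of_int k + 1/2"
      and eq: "T (k + 1) - T k = (1 / \<sigma>) / (1 + ((z - \<mu>) / \<sigma>)\<^sup>2)"
      by (auto simp: T_def algebra_simps)
    have "\<bar>(z - \<mu>) - (real_of_int k - \<mu>)\<bar> \<le> 1/2" using z by linarith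
    from near_square_bound[OF this \<sigma>]
    have "1 + ((z - \<mu>) / \<sigma>)\<^sup>2 \<le> 2 * (1 + ((real_of_int k - \<mu>) / \<sigma>)\<^sup>2)" .
    moreover have "1 / a \<le> 2 / b" if "b \<le> 2 * a" "0 < a" "0 < b" for a b :: real
      using that by (simp add: field_simps)
    ultimately have "1 / (1 + ((real_of_int k - \<mu>) / \<sigma>)\<^sup>2) \<le> 2 / (1 + ((z - \<mu>) / \<sigma>)\<^sup>2)"
      by (simp add: add_pos_nonneg)
    also have "\<dots> = 2 * \<sigma> * (T (k + 1) - T k)" using \<sigma> unfolding eq by simp
    finally show ?thesis .
  qed
  have tele: "(\<Sum>k\<in>{- int N..int N}. T (k + 1) - T k) = T (int N + 1) - T (- int N)" for N
  proof (induction N)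
    case (Suc N)
    have "{- int (Suc N)..int (Suc N)} = insert (- 1 - int N) (insert (1 + int N) {- int N..int N})" by auto
    with Suc show ?case by (simp add: algebra_simps)
  qed simp
  obtain N where N: "F \<subseteq> {- int N..int N}"
  proof -
    have "F \<subseteq> {- int (nat (Max (abs ` insert 0 F)))..int (nat (Max (abs ` insert 0 F)))}"
    proof
      fix k assume "k \<in> F"
      then have "\<bar>k\<bar> \<le> Max (abs ` insert 0 F)" using F by (intro Max_ge) auto
      then show "k \<in> {- int (nat (Max (abs ` insert 0 F)))..int (nat (Max (abs ` insert 0 F)))}"
        by (auto simp: abs_le_iff)
    qed
    then show ?thesis by (rule that)
  qed
  have "(\<Sum>k\<in>F. 1 / (1 + ((real_of_int k - \<mu>) / \<sigma>)\<^sup>2)) \<le> (\<Sum>k\<in>{- int N..int N}. 1 / (1 + ((real_of_int k - \<mu>) / \<sigma>)\<^sup>2))"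
    by (intro sum_mono2 N) auto
  also have "\<dots> \<le> (\<Sum>k\<in>{- int N..int N}. 2 * \<sigma> * (T (k + 1) - T k))"
    by (intro sum_mono step)
  also have "\<dots> = 2 * \<sigma> * (T (int N + 1) - T (- int N))"
    by (simp only: sum_distrib_left[symmetric] tele)
  also have "\<dots> \<le> 2 * \<sigma> * pi"
  proof (rule mult_left_mono)
    show "T (int N + 1) - T (- int N) \<le> pi"
      using arctan_ubound[of "(real_of_int (int N + 1) - 1/2 - \<mu>) / \<sigma>"] arctan_lbound[of "(real_of_int (- int N) - 1/2 - \<mu>) / \<sigma>"]
      unfolding T_def by linarith
  qed (use \<sigma> in simp)
  finally show ?thesis by (simp add: mult_ac)
qed

section \<open>Fourier coefficients\<close>

text \<open>The shift by \<open>\<mu>\<close> makes the coefficients of a centered characteristic function equal to the probabilities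
of the integers \<open>k\<close> although \<open>\<mu>\<close> need not be an integer.\<close>

definition fourier_coeff :: "real \<Rightarrow> (real \<Rightarrow> complex) \<Rightarrow> int \<Rightarrow> complex" where
  "fourier_coeff \<mu> u k = integral {-pi..pi} (\<lambda>t. u t * cis (- t * (real_of_int k - \<mu>))) / (2 * pi)"

lemma continuous_on_cis_linear: "continuous_on S (\<lambda>t. cis (t * a))" "continuous_on S (\<lambda>t. cis (- t * a))"
  by (auto simp: cis_conv_exp intro!: continuous_intros)

lemma integral_cis_int:
  "integral {-pi..pi} (\<lambda>t. cis (t * real_of_int n)) = (if n = 0 then 2 * pi else 0)"
proof (cases "n = 0")
  case False
  have "((\<lambda>t. cis (t * real_of_int n)) has_integral
      (cis (pi * real_of_int n) / (\<i> * n) - cis (- pi * real_of_int n) / (\<i> * n))) {-pi..pi}"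
  proof (rule fundamental_theorem_of_calculus)
    fix t :: real
    have "((\<lambda>t. exp (\<i> * n * of_real t) / (\<i> * n)) has_vector_derivative exp (\<i> * n * of_real t)) (at t within {-pi..pi})"
      using False by (auto intro!: derivative_eq_intros has_vector_derivative_real_field)
    then show "((\<lambda>t. cis (t * real_of_int n) / (\<i> * n)) has_vector_derivative cis (t * real_of_int n)) (at t within {-pi..pi})"
      by (simp add: cis_conv_exp mult_ac)
  qed simp
  moreover have "cis (pi * real_of_int n) = cis (- pi * real_of_int n)"
    by (simp add: cis.ctr mult.commute sin_npi_int)
  ultimately show ?thesis using False by (simp add: integral_unique)
qed (simp add: scaleR_conv_of_real)

lemma fourier_coeff_le:
  assumes "continuous_on {-pi..pi} u"
  shows "norm (fourier_coeff \<mu> u k) \<le> integral {-pi..pi} (\<lambda>t. norm (u t)) / (2 * pi)"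
proof -
  have "norm (integral {-pi..pi} (\<lambda>t. u t * cis (- t * (real_of_int k - \<mu>)))) \<le> integral {-pi..pi} (\<lambda>t. norm (u t))"
    using assms
    by (intro integral_norm_bound_integral integrable_continuous_real continuous_intros continuous_on_cis_linear)
      (auto simp: norm_mult)
  then show ?thesis by (simp add: fourier_coeff_def norm_divide divide_right_mono)
qed

text \<open>The function \<open>s\<close> is the orthogonal projection of \<open>u\<close> to the span of the exponentials with \<open>k\<close> in \<open>F\<close>,
and the claim says that the squared norm of \<open>u - s\<close> is not negative.\<close>

lemma bessel_inequality:
  assumes u: "continuous_on {-pi..pi} u" and F: "finite F"
  shows "(\<Sum>k\<in>F. (norm (fourier_coeff \<mu> u k))\<^sup>2) \<le> integral {-pi..pi} (\<lambda>t. (norm (u t))\<^sup>2) / (2 * pi)"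
proof -
  define a where "a = fourier_coeff \<mu> u"
  define e where "e = (\<lambda>k t. cis (t * (real_of_int k - \<mu>)))"
  define s where "s = (\<lambda>t. \<Sum>k\<in>F. a k * e k t)"
  define Q where "Q = (\<Sum>k\<in>F. (norm (a k))\<^sup>2)"
  have ce: "continuous_on {-pi..pi} (e k)" for k
    unfolding e_def by (rule continuous_on_cis_linear)
  have cs: "continuous_on {-pi..pi} s" unfolding s_def by (intro continuous_intros ce)
  have cnj_e: "cnj (e k t) = cis (- t * (real_of_int k - \<mu>))" for k t
    by (simp add: e_def cis_cnj)
  have nsq: "(complex_of_real (cmod z))\<^sup>2 = z * cnj z" for z
    by (metis complex_norm_square of_real_power)
  have us: "integral {-pi..pi} (\<lambda>t. u t * cnj (s t)) = 2 * pi * Q"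
  proof -
    have "integral {-pi..pi} (\<lambda>t. u t * cnj (s t)) = integral {-pi..pi} (\<lambda>t. \<Sum>k\<in>F. cnj (a k) * (u t * cnj (e k t)))"
      by (rule integral_cong) (simp add: s_def sum_distrib_left mult_ac)
    also have "\<dots> = (\<Sum>k\<in>F. integral {-pi..pi} (\<lambda>t. cnj (a k) * (u t * cnj (e k t))))"
      using F by (intro integral_sum integrable_continuous_real continuous_intros u ce)
    also have "\<dots> = (\<Sum>k\<in>F. cnj (a k) * (2 * pi * a k))"
      by (simp add: cnj_e a_def fourier_coeff_def)
    also have "\<dots> = 2 * pi * Q"
      by (simp add: Q_def sum_distrib_left nsq mult_ac)
    finally show ?thesis .
  qed
  have ss: "integral {-pi..pi} (\<lambda>t. s t * cnj (s t)) = 2 * pi * Q"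
  proof -
    have "integral {-pi..pi} (\<lambda>t. s t * cnj (s t)) =
        integral {-pi..pi} (\<lambda>t. \<Sum>k\<in>F. \<Sum>j\<in>F. a k * cnj (a j) * cis (t * real_of_int (k - j)))"
    proof (rule integral_cong)
      fix t
      have "e k t * cnj (e j t) = cis (t * real_of_int (k - j))" for k j
        unfolding cnj_e by (simp add: e_def cis_mult algebra_simps)
      then have "a k * e k t * cnj (a j * e j t) = a k * cnj (a j) * cis (t * real_of_int (k - j))" for k j
        by (metis (no_types, opaque_lifting) complex_cnj_mult mult.assoc mult.left_commute)
      then show "s t * cnj (s t) = (\<Sum>k\<in>F. \<Sum>j\<in>F. a k * cnj (a j) * cis (t * real_of_int (k - j)))"
        by (simp only: s_def cnj_sum sum_product)
    qed
    also have "\<dots> = (\<Sum>k\<in>F. \<Sum>j\<in>F. integral {-pi..pi} (\<lambda>t. a k * cnj (a j) * cis (t * real_of_int (k - j))))"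
      using F by (subst integral_sum; (intro sum.cong refl integral_sum)?)
        (auto intro!: integrable_continuous_real continuous_intros continuous_on_cis_linear)
    also have "\<dots> = (\<Sum>k\<in>F. \<Sum>j\<in>F. if j = k then 2 * pi * (a k * cnj (a j)) else 0)"
      unfolding integral_mult_right integral_cis_int by (intro sum.cong refl) (simp add: mult_ac)
    also have "\<dots> = 2 * pi * Q"
      using F by (simp add: Q_def sum_distrib_left nsq)
    finally show ?thesis .
  qed
  have "0 \<le> integral {-pi..pi} (\<lambda>t. (norm (u t - s t))\<^sup>2)"
    by (intro integral_nonneg integrable_continuous_real continuous_intros u cs) auto
  also have "(\<lambda>t. (norm (u t - s t))\<^sup>2) = (\<lambda>t. (norm (u t))\<^sup>2 - 2 * Re (u t * cnj (s t)) + Re (s t * cnj (s t)))"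
    unfolding cmod_power2 by (rule ext) (simp add: power2_eq_square algebra_simps)
  also have "integral {-pi..pi} \<dots> = integral {-pi..pi} (\<lambda>t. (norm (u t))\<^sup>2) - 2 * integral {-pi..pi} (\<lambda>t. Re (u t * cnj (s t)))
      + integral {-pi..pi} (\<lambda>t. Re (s t * cnj (s t)))"
    by (subst integral_add, (intro integrable_continuous_real continuous_intros u cs)+,
        subst integral_diff, (intro integrable_continuous_real continuous_intros u cs)+) (simp only: integral_mult_right)
  also have "integral {-pi..pi} (\<lambda>t. Re (u t * cnj (s t))) = Re (integral {-pi..pi} (\<lambda>t. u t * cnj (s t)))"
    using integral_linear[OF _ bounded_linear_Re, of "\<lambda>t. u t * cnj (s t)" "{-pi..pi}"]
    by (simp add: o_def integrable_continuous_real continuous_intros u cs)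
  also have "integral {-pi..pi} (\<lambda>t. Re (s t * cnj (s t))) = Re (integral {-pi..pi} (\<lambda>t. s t * cnj (s t)))"
    using integral_linear[OF _ bounded_linear_Re, of "\<lambda>t. s t * cnj (s t)" "{-pi..pi}"]
    by (simp add: o_def integrable_continuous_real continuous_intros cs)
  finally have "2 * pi * Q \<le> integral {-pi..pi} (\<lambda>t. (norm (u t))\<^sup>2)"
    unfolding us ss by (simp add: mult_ac)
  then show ?thesis by (simp add: Q_def a_def pos_le_divide_eq mult.commute)
qed

text \<open>Integration by parts. The functions \<open>u\<close> of interest are very small at \<open>\<plusminus>\<pi>\<close>, so that the boundary
term may be estimated crudely.\<close>

lemma fourier_coeff_deriv:
  assumes u: "\<And>t. t \<in> {-pi..pi} \<Longrightarrow> (u has_vector_derivative u' t) (at t within {-pi..pi})"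
    and u': "continuous_on {-pi..pi} u'"
  shows "\<bar>real_of_int k - \<mu>\<bar> * norm (fourier_coeff \<mu> u k) \<le>
    norm (fourier_coeff \<mu> u' k) + (norm (u pi) + norm (u (-pi))) / (2 * pi)"
proof -
  define x where "x = real_of_int k - \<mu>"
  define e where "e = (\<lambda>t. cis (- t * x))"
  have cu: "continuous_on {-pi..pi} u"
    unfolding continuous_on_eq_continuous_within using u by (blast intro: has_vector_derivative_continuous)
  have ce: "continuous_on {-pi..pi} e" unfolding e_def by (rule continuous_on_cis_linear)
  have e': "(e has_vector_derivative (- \<i> * x) * e t) (at t within {-pi..pi})" for t
  proof -
    have "((\<lambda>t. exp (- \<i> * x * of_real t)) has_vector_derivative (- \<i> * x) * exp (- \<i> * x * of_real t)) (at t within {-pi..pi})"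
      by (auto intro!: derivative_eq_intros has_vector_derivative_real_field)
    then show ?thesis by (simp add: e_def cis_conv_exp mult_ac)
  qed
  have "((\<lambda>t. u t * ((- \<i> * x) * e t) + u' t * e t) has_integral u pi * e pi - u (-pi) * e (-pi)) {-pi..pi}"
    by (rule fundamental_theorem_of_calculus) (simp, rule has_vector_derivative_mult[OF u e'])
  then have "integral {-pi..pi} (\<lambda>t. (- \<i> * x) * (u t * e t) + u' t * e t) = u pi * e pi - u (-pi) * e (-pi)"
    by (simp add: mult_ac integral_unique)
  also have "integral {-pi..pi} (\<lambda>t. (- \<i> * x) * (u t * e t) + u' t * e t) =
      (- \<i> * x) * integral {-pi..pi} (\<lambda>t. u t * e t) + integral {-pi..pi} (\<lambda>t. u' t * e t)"
    by (subst integral_add) (auto intro!: integrable_continuous_real continuous_intros cu u' ce)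
  finally have ibp: "(\<i> * x) * integral {-pi..pi} (\<lambda>t. u t * e t) = integral {-pi..pi} (\<lambda>t. u' t * e t) - (u pi * e pi - u (-pi) * e (-pi))"
    by (simp add: algebra_simps)
  have et: "cis (- t * x) = e t" for t by (simp only: e_def)
  have "(\<i> * x) * fourier_coeff \<mu> u k = ((\<i> * x) * integral {-pi..pi} (\<lambda>t. u t * e t)) / (2 * pi)"
    by (simp only: fourier_coeff_def x_def[symmetric] et times_divide_eq_right)
  also have "\<dots> = fourier_coeff \<mu> u' k - (u pi * e pi - u (-pi) * e (-pi)) / (2 * pi)"
    by (simp only: ibp fourier_coeff_def x_def[symmetric] et diff_divide_distrib)
  finally have "(\<i> * x) * fourier_coeff \<mu> u k = fourier_coeff \<mu> u' k - (u pi * e pi - u (-pi) * e (-pi)) / (2 * pi)" .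
  then have "norm ((\<i> * x) * fourier_coeff \<mu> u k) \<le> norm (fourier_coeff \<mu> u' k) + norm ((u pi * e pi - u (-pi) * e (-pi)) / (2 * pi))"
    by (metis norm_triangle_ineq4)
  also have "norm ((u pi * e pi - u (-pi) * e (-pi)) / (2 * pi)) \<le> (norm (u pi) + norm (u (-pi))) / (2 * pi)"
    using norm_triangle_ineq4[of "u pi * e pi" "u (-pi) * e (-pi)"]
    by (simp add: norm_divide norm_mult e_def divide_right_mono)
  finally show ?thesis
    by (simp only: norm_mult norm_ii norm_of_real mult_1_left x_def)
qed

section \<open>The Gaussian and its discretization\<close>

text \<open>The characteristic function of the standard normal distribution, read as a Fourier inversion formula
after the substitution \<open>y = \<sigma> t\<close>.\<close>

lemma gaussian_fourier:
  fixes x \<sigma> :: real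
  assumes \<sigma>: "\<sigma> > 0"
  shows "integrable lborel (\<lambda>t. of_real (exp (- \<sigma>\<^sup>2 * t\<^sup>2 / 2)) * cis (- t * x))"
    and "(LINT t|lborel. of_real (exp (- \<sigma>\<^sup>2 * t\<^sup>2 / 2)) * cis (- t * x)) = of_real (2 * pi * normal_density 0 \<sigma> x)"
proof -
  define f where "f = (\<lambda>t. complex_of_real (exp (- \<sigma>\<^sup>2 * t\<^sup>2 / 2)) * cis (- t * x))"
  have dens: "std_normal_density (\<sigma> * t) *\<^sub>R iexp (- x / \<sigma> * (\<sigma> * t)) = of_real (1 / sqrt (2 * pi)) * f t" for t
    using \<sigma> by (simp add: f_def std_normal_density_def scaleR_conv_of_real cis_conv_exp power_mult_distrib mult_ac)
  have "integrable lborel std_normal_density" by simp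
  then have i0: "integrable lborel (\<lambda>y. std_normal_density y *\<^sub>R iexp (- x / \<sigma> * y))"
    by (rule Bochner_Integration.integrable_bound) (auto simp: normal_density_nonneg)
  from lborel_integrable_real_affine[OF i0, of \<sigma> 0] \<sigma>
  have "integrable lborel (\<lambda>t. of_real (1 / sqrt (2 * pi)) * f t)"
    by (simp only: dens add_0_left)
  then have "integrable lborel (\<lambda>t. of_real (sqrt (2 * pi)) * (of_real (1 / sqrt (2 * pi)) * f t))"
    by (rule integrable_mult_right)
  moreover have "of_real (sqrt (2 * pi)) * (of_real (1 / sqrt (2 * pi)) * f t) = f t" for t by simp
  ultimately show "integrable lborel f" by (simp only:)
  have "(LINT y|lborel. std_normal_density y *\<^sub>R iexp (- x / \<sigma> * y)) = char std_normal_distribution (- x / \<sigma>)"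
    unfolding char_def by (subst integral_density) (auto simp: normal_density_nonneg)
  also have "\<dots> = of_real (exp (- (x / \<sigma>)\<^sup>2 / 2))" by (simp add: char_std_normal_distribution)
  finally have "(LINT y|lborel. std_normal_density y *\<^sub>R iexp (- x / \<sigma> * y)) = of_real (exp (- (x / \<sigma>)\<^sup>2 / 2))" .
  also have "(LINT y|lborel. std_normal_density y *\<^sub>R iexp (- x / \<sigma> * y)) =
      \<bar>\<sigma>\<bar> *\<^sub>R (LINT t|lborel. std_normal_density (0 + \<sigma> * t) *\<^sub>R iexp (- x / \<sigma> * (0 + \<sigma> * t)))"
    using \<sigma> by (intro lborel_integral_real_affine) simp
  also have "\<dots> = of_real (\<sigma> / sqrt (2 * pi)) * (LINT t|lborel. f t)"
    using \<sigma> by (simp only: dens add_0_left integral_mult_right_zero) (simp add: scaleR_conv_of_real)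
  finally have "of_real (\<sigma> / sqrt (2 * pi)) * (LINT t|lborel. f t) = complex_of_real (exp (- (x / \<sigma>)\<^sup>2 / 2))" by simp
  then have "(LINT t|lborel. f t) = complex_of_real (exp (- (x / \<sigma>)\<^sup>2 / 2)) / of_real (\<sigma> / sqrt (2 * pi))"
    using \<sigma> by (simp add: field_simps)
  also have "\<dots> = of_real (exp (- (x / \<sigma>)\<^sup>2 / 2) / (\<sigma> / sqrt (2 * pi)))" by simp
  also have "exp (- (x / \<sigma>)\<^sup>2 / 2) / (\<sigma> / sqrt (2 * pi)) = 2 * pi * normal_density 0 \<sigma> x"
  proof -
    have nd: "normal_density 0 \<sigma> x = 1 / (sqrt (2 * pi) * \<sigma>) * exp (- (x / \<sigma>)\<^sup>2 / 2)"
      using \<sigma> by (simp add: normal_density_def real_sqrt_mult power_divide)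
    have "a / (\<sigma> / r) = r * r * (1 / (r * \<sigma>) * a)" if "r > 0" for a r
      using \<sigma> that by (simp add: field_simps)
    from this[of "sqrt (2 * pi)"] show ?thesis unfolding nd by simp
  qed
  finally show "(LINT t|lborel. f t) = of_real (2 * pi * normal_density 0 \<sigma> x)" .
qed

text \<open>Over the whole line, the integral would give the density exactly; the part outside \<open>[-\<pi>, \<pi>]\<close> is
exponentially small in \<open>\<sigma>\<^sup>2\<close>.\<close>

lemma fourier_coeff_gaussian:
  fixes \<sigma> :: real
  assumes \<sigma>: "\<sigma> \<ge> 1"
  shows "norm (fourier_coeff \<mu> (\<lambda>t. of_real (exp (- \<sigma>\<^sup>2 * t\<^sup>2 / 2))) k - of_real (normal_density \<mu> \<sigma> k)) \<le> 1 / \<sigma> ^ 4"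
proof -
  define x where "x = real_of_int k - \<mu>"
  define f where "f = (\<lambda>t. complex_of_real (exp (- \<sigma>\<^sup>2 * t\<^sup>2 / 2)) * cis (- t * x))"
  define I where "I = {-pi..pi}"
  have \<sigma>0: "\<sigma> > 0" using \<sigma> by simp
  have f_int: "integrable lborel f" and f_eq: "(LINT t|lborel. f t) = of_real (2 * pi * normal_density 0 \<sigma> x)"
    using gaussian_fourier[OF \<sigma>0, of x] by (simp_all add: f_def)
  have I_int: "set_integrable lborel I f"
    using f_int unfolding set_integrable_def by (intro integrable_mult_indicator) (auto simp: I_def)
  have "(LINT t:I|lborel. f t) = integral I f" by (rule set_borel_integral_eq_integral(2)[OF I_int])
  then have "fourier_coeff \<mu> (\<lambda>t. of_real (exp (- \<sigma>\<^sup>2 * t\<^sup>2 / 2))) k = (LINT t:I|lborel. f t) / (2 * pi)"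
    by (simp only: fourier_coeff_def f_def x_def I_def)
  moreover have "normal_density \<mu> \<sigma> k = normal_density 0 \<sigma> x" by (simp add: normal_density_def x_def)
  ultimately have "fourier_coeff \<mu> (\<lambda>t. of_real (exp (- \<sigma>\<^sup>2 * t\<^sup>2 / 2))) k - of_real (normal_density \<mu> \<sigma> k) =
      ((LINT t:I|lborel. f t) - (LINT t|lborel. f t)) / (2 * pi)"
    unfolding f_eq by (simp add: diff_divide_distrib)
  also have "(LINT t:I|lborel. f t) - (LINT t|lborel. f t) = - (LINT t|lborel. f t - indicator I t *\<^sub>R f t)"
    using f_int I_int unfolding set_lebesgue_integral_def set_integrable_def by simp
  finally have split: "norm (fourier_coeff \<mu> (\<lambda>t. of_real (exp (- \<sigma>\<^sup>2 * t\<^sup>2 / 2))) k - of_real (normal_density \<mu> \<sigma> k)) =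
      norm (LINT t|lborel. f t - indicator I t *\<^sub>R f t) / (2 * pi)" by (simp add: norm_divide)
  \<comment> \<open>Half of the exponent bounds the integrand outside \<open>I\<close> uniformly, the other half keeps it integrable.\<close>
  have "norm (LINT t|lborel. f t - indicator I t *\<^sub>R f t) \<le> (LINT t|lborel. norm (f t - indicator I t *\<^sub>R f t))"
    by (rule integral_norm_bound)
  also have "\<dots> \<le> (LINT t|lborel. exp (- \<sigma>\<^sup>2 * pi\<^sup>2 / 4) * (2 * sqrt pi / \<sigma>) * normal_density 0 (sqrt 2 / \<sigma>) t)"
  proof (rule integral_mono)
    show "integrable lborel (\<lambda>t. norm (f t - indicator I t *\<^sub>R f t))"
      using f_int I_int unfolding set_integrable_def by simp
    have s0: "sqrt 2 / \<sigma> > 0" using \<sigma>0 by simp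
    show "integrable lborel (\<lambda>t. exp (- \<sigma>\<^sup>2 * pi\<^sup>2 / 4) * (2 * sqrt pi / \<sigma>) * normal_density 0 (sqrt 2 / \<sigma>) t)"
      by (intro integrable_mult_right integrable_normal_density s0)
    fix t
    have nd: "(2 * sqrt pi / \<sigma>) * normal_density 0 (sqrt 2 / \<sigma>) t = exp (- \<sigma>\<^sup>2 * t\<^sup>2 / 4)"
    proof -
      have s2: "(sqrt 2 / \<sigma>)\<^sup>2 = 2 / \<sigma>\<^sup>2" by (simp add: power_divide)
      have root: "sqrt (2 * pi * (2 / \<sigma>\<^sup>2)) = 2 * sqrt pi / \<sigma>"
        using \<sigma>0 by (intro real_sqrt_unique) (simp_all add: power_divide power_mult_distrib)
      have "- (t - 0)\<^sup>2 / (2 * (2 / \<sigma>\<^sup>2)) = - \<sigma>\<^sup>2 * t\<^sup>2 / 4" using \<sigma>0 by simp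
      moreover have "r * (1 / r * a) = a" if "r > 0" for r a :: real using that by simp
      ultimately show ?thesis
        using \<sigma>0 unfolding normal_density_def s2 root by simp
    qed
    show "norm (f t - indicator I t *\<^sub>R f t) \<le> exp (- \<sigma>\<^sup>2 * pi\<^sup>2 / 4) * (2 * sqrt pi / \<sigma>) * normal_density 0 (sqrt 2 / \<sigma>) t"
    proof (cases "t \<in> I")
      case True
      then show ?thesis using \<sigma>0 by (simp add: normal_density_nonneg)
    next
      case False
      then have "pi \<le> \<bar>t\<bar>" by (auto simp: I_def)
      then have "pi\<^sup>2 \<le> t\<^sup>2" by (metis abs_le_square_iff abs_of_pos pi_gt_zero)
      then have "\<sigma>\<^sup>2 * pi\<^sup>2 \<le> \<sigma>\<^sup>2 * t\<^sup>2" by (intro mult_left_mono) auto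
      then have "exp (- \<sigma>\<^sup>2 * t\<^sup>2 / 2) \<le> exp (- \<sigma>\<^sup>2 * pi\<^sup>2 / 4) * exp (- \<sigma>\<^sup>2 * t\<^sup>2 / 4)"
        unfolding exp_add[symmetric] exp_le_cancel_iff by simp
      with False show ?thesis
        unfolding mult.assoc nd by (simp add: f_def norm_mult)
    qed
  qed
  also have "\<dots> = exp (- \<sigma>\<^sup>2 * pi\<^sup>2 / 4) * (2 * sqrt pi / \<sigma>)"
    using \<sigma>0 by simp
  finally have tail: "norm (LINT t|lborel. f t - indicator I t *\<^sub>R f t) / (2 * pi) \<le>
      exp (- \<sigma>\<^sup>2 * pi\<^sup>2 / 4) * (2 * sqrt pi / \<sigma>) / (2 * pi)"
    by (rule divide_right_mono) simp
  also have "\<dots> \<le> 1 / \<sigma> ^ 4"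
  proof -
    have pi2: "8 \<le> pi\<^sup>2" using power_mono[of 3 pi 2] pi_gt3 by simp
    have "exp (- \<sigma>\<^sup>2 * pi\<^sup>2 / 4) \<le> exp (- (\<sigma>\<^sup>2 + \<sigma>\<^sup>2))"
      using mult_left_mono[OF pi2, of "\<sigma>\<^sup>2"] by simp
    also have "\<dots> = inverse (exp (\<sigma>\<^sup>2)) * inverse (exp (\<sigma>\<^sup>2))" by (simp only: exp_minus exp_add inverse_mult_distrib)
    also have "\<dots> \<le> inverse (\<sigma>\<^sup>2) * inverse (\<sigma>\<^sup>2)"
    proof -
      have "\<sigma>\<^sup>2 \<le> exp (\<sigma>\<^sup>2)" using exp_ge_add_one_self[of "\<sigma>\<^sup>2"] by linarith
      then have "inverse (exp (\<sigma>\<^sup>2)) \<le> inverse (\<sigma>\<^sup>2)" using \<sigma>0 by (intro le_imp_inverse_le) auto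
      then show ?thesis by (intro mult_mono) auto
    qed
    also have "\<dots> = 1 / \<sigma> ^ 4" by (simp add: divide_inverse flip: inverse_mult_distrib power_add)
    finally have e: "exp (- \<sigma>\<^sup>2 * pi\<^sup>2 / 4) \<le> 1 / \<sigma> ^ 4" .
    have "2 * sqrt pi / \<sigma> / (2 * pi) \<le> 1"
    proof -
      have "sqrt pi \<le> sqrt (pi * pi)" using pi_gt3 by (intro real_sqrt_le_mono) simp
      also have "\<dots> = pi" by simp
      also have "pi \<le> \<sigma> * pi" using \<sigma> by simp
      finally show ?thesis using \<sigma>0 by (simp add: field_simps)
    qed
    with e have "exp (- \<sigma>\<^sup>2 * pi\<^sup>2 / 4) * (2 * sqrt pi / \<sigma> / (2 * pi)) \<le> 1 / \<sigma> ^ 4 * 1"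
      using \<sigma>0 by (intro mult_mono) auto
    then show ?thesis by simp
  qed
  finally show ?thesis unfolding split .
qed

text \<open>The density changes over the cell around \<open>k\<close> by at most the maximum of its derivative there.\<close>

lemma discretized_normal_near_density:
  fixes \<sigma> :: real
  assumes \<sigma>: "\<sigma> \<ge> 1"
  shows "\<bar>pmf (discretized_normal \<mu> (\<sigma>\<^sup>2)) k - normal_density \<mu> \<sigma> k\<bar> \<le>
    2 * gauss_const 1 / \<sigma>\<^sup>2 / (1 + ((real_of_int k - \<mu>) / \<sigma>)\<^sup>2)"
proof -
  define B where "B = 2 * gauss_const 1 / \<sigma>\<^sup>2 / (1 + ((real_of_int k - \<mu>) / \<sigma>)\<^sup>2)"
  define I where "I = {real_of_int k - 1/2..real_of_int k + 1/2}"
  have \<sigma>0: "\<sigma> > 0" using \<sigma> by simp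
  have deriv: "(normal_density \<mu> \<sigma> has_real_derivative (- (y - \<mu>) / \<sigma>\<^sup>2 * normal_density \<mu> \<sigma> y)) (at y within S)" for y S
  proof -
    define C where "C = 1 / sqrt (2 * pi * \<sigma>\<^sup>2)"
    have nd: "normal_density \<mu> \<sigma> = (\<lambda>x. C * exp (- (x - \<mu>)\<^sup>2 / (2 * \<sigma>\<^sup>2)))"
      by (rule ext) (simp only: normal_density_def C_def)
    have "((\<lambda>x. - (x - \<mu>)\<^sup>2 / (2 * \<sigma>\<^sup>2)) has_real_derivative - (y - \<mu>) / \<sigma>\<^sup>2) (at y)"
      using \<sigma>0 by (auto intro!: derivative_eq_intros simp: divide_simps) (simp add: power2_eq_square power4_eq_xxxx algebra_simps)
    then have "((\<lambda>x. C * exp (- (x - \<mu>)\<^sup>2 / (2 * \<sigma>\<^sup>2))) has_real_derivative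
        C * (exp (- (y - \<mu>)\<^sup>2 / (2 * \<sigma>\<^sup>2)) * (- (y - \<mu>) / \<sigma>\<^sup>2))) (at y)"
      by (rule DERIV_cmult[OF DERIV_fun_exp])
    moreover have "C * (exp (- (y - \<mu>)\<^sup>2 / (2 * \<sigma>\<^sup>2)) * (- (y - \<mu>) / \<sigma>\<^sup>2)) =
        - (y - \<mu>) / \<sigma>\<^sup>2 * (C * exp (- (y - \<mu>)\<^sup>2 / (2 * \<sigma>\<^sup>2)))" by (simp only: mult_ac)
    ultimately show ?thesis
      unfolding nd by (metis has_field_derivative_at_within)
  qed
  have cont: "continuous_on I (normal_density \<mu> \<sigma>)"
    by (rule DERIV_continuous_on) (rule deriv)
  have bound: "norm (- (y - \<mu>) / \<sigma>\<^sup>2 * normal_density \<mu> \<sigma> y) \<le> B" if y: "y \<in> I" for y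
  proof -
    define z where "z = (y - \<mu>) / \<sigma>"
    have nd: "normal_density \<mu> \<sigma> y \<le> 1 / \<sigma> * exp (- z\<^sup>2 / 24)"
    proof -
      have "\<sigma> \<le> sqrt (2 * pi * \<sigma>\<^sup>2)" using \<sigma>0 pi_gt3 by (intro real_le_rsqrt) simp
      then have "1 / sqrt (2 * pi * \<sigma>\<^sup>2) \<le> 1 / \<sigma>" using \<sigma>0 by (intro divide_left_mono) auto
      moreover have "exp (- (y - \<mu>)\<^sup>2 / (2 * \<sigma>\<^sup>2)) \<le> exp (- z\<^sup>2 / 24)"
      proof -
        have "- (y - \<mu>)\<^sup>2 / (2 * \<sigma>\<^sup>2) = - z\<^sup>2 / 2" by (simp add: z_def power_divide)
        then show ?thesis by (simp only: exp_le_cancel_iff) simp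
      qed
      ultimately show ?thesis unfolding normal_density_def using \<sigma>0 by (intro mult_mono) auto
    qed
    have "norm (- (y - \<mu>) / \<sigma>\<^sup>2 * normal_density \<mu> \<sigma> y) = \<bar>z\<bar> / \<sigma> * normal_density \<mu> \<sigma> y"
      using \<sigma>0 by (simp add: z_def abs_mult normal_density_nonneg power2_eq_square abs_minus_commute[of \<mu> y])
    also have "\<dots> \<le> \<bar>z\<bar> / \<sigma> * (1 / \<sigma> * exp (- z\<^sup>2 / 24))"
      using nd \<sigma>0 by (intro mult_left_mono) auto
    also have "\<dots> = \<bar>z\<bar> ^ 1 * exp (- z\<^sup>2 / 24) / \<sigma>\<^sup>2" by (simp add: power2_eq_square)
    also have "\<dots> \<le> gauss_const 1 / (1 + z\<^sup>2) / \<sigma>\<^sup>2"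
      by (intro divide_right_mono power_gauss_bound) auto
    also have "gauss_const 1 / (1 + z\<^sup>2) \<le> gauss_const 1 * (2 / (1 + ((real_of_int k - \<mu>) / \<sigma>)\<^sup>2))"
    proof -
      have "\<bar>(real_of_int k - \<mu>) - (y - \<mu>)\<bar> \<le> 1/2" using y unfolding I_def atLeastAtMost_iff by linarith
      from near_square_bound[OF this \<sigma>]
      have "1 + ((real_of_int k - \<mu>) / \<sigma>)\<^sup>2 \<le> 2 * (1 + z\<^sup>2)" by (simp only: z_def)
      moreover have "1 / a \<le> 2 / b" if "b \<le> 2 * a" "0 < a" "0 < b" for a b :: real
        using that by (simp add: field_simps)
      ultimately have "1 / (1 + z\<^sup>2) \<le> 2 / (1 + ((real_of_int k - \<mu>) / \<sigma>)\<^sup>2)"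
        by (simp add: add_pos_nonneg)
      from mult_left_mono[OF this gauss_const_nonneg[of 1]] show ?thesis by simp
    qed
    finally show ?thesis by (simp add: B_def divide_right_mono mult_ac)
  qed
  have B0: "B \<ge> 0" using gauss_const_nonneg[of 1] by (simp add: B_def add_nonneg_nonneg)
  have kI: "real_of_int k \<in> I" by (simp add: I_def)
  have near: "norm (normal_density \<mu> \<sigma> y - normal_density \<mu> \<sigma> k) \<le> B" if y: "y \<in> I" for y
  proof -
    have "norm (normal_density \<mu> \<sigma> y - normal_density \<mu> \<sigma> k) \<le> B * norm (y - real_of_int k)"
      using deriv bound y kI by (intro field_differentiable_bound[of I]) (auto simp: I_def)
    also have "norm (y - real_of_int k) \<le> 1" using y by (auto simp: I_def abs_le_iff)
    finally show ?thesis using B0 by (simp add: mult_left_mono)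
  qed
  have "set_integrable lborel I (normal_density \<mu> \<sigma>)"
    using cont unfolding I_def by (rule borel_integrable_atLeastAtMost')
  then have "(LBINT x:I. normal_density \<mu> \<sigma> x) = integral I (normal_density \<mu> \<sigma>)"
    by (rule set_borel_integral_eq_integral(2))
  moreover have "pmf (discretized_normal \<mu> (\<sigma>\<^sup>2)) k = (LBINT x:I. normal_density \<mu> \<sigma> x)"
    unfolding normal_density_def I_def using \<sigma>0 by (intro pmf_discretized_normal) simp
  moreover have "integral I (\<lambda>y. normal_density \<mu> \<sigma> y - normal_density \<mu> \<sigma> k) = integral I (normal_density \<mu> \<sigma>) - normal_density \<mu> \<sigma> k"
    using cont unfolding I_def by (subst integral_diff) (auto intro!: integrable_continuous_real)
  moreover have "norm (integral I (\<lambda>y. normal_density \<mu> \<sigma> y - normal_density \<mu> \<sigma> k)) \<le> B * (real_of_int k + 1/2 - (real_of_int k - 1/2))"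
    using near cont unfolding I_def by (intro integral_bound continuous_intros) auto
  ultimately show ?thesis by (simp add: B_def)
qed

text \<open>With the integrating factor \<open>exp(\<sigma>\<^sup>2 s\<^sup>2 / 2)\<close>, the equation bounds the derivative of \<open>G\<close>. The factor grows,
but for \<open>|s| \<le> |t|\<close> it is absorbed when \<open>G\<close> is multiplied by \<open>exp(-\<sigma>\<^sup>2 t\<^sup>2 / 2)\<close> at the end, because the
decay rate \<open>1/24\<close> of the error is smaller than \<open>1/2\<close>.\<close>

lemma gaussian_ode_stability:
  fixes \<phi> \<phi>' :: "real \<Rightarrow> complex" and \<sigma> A b :: real
  assumes der: "\<And>t. (\<phi> has_vector_derivative \<phi>' t) (at t)" and one: "\<phi> 0 = 1" and A: "0 \<le> A"
    and ode: "\<And>t. \<bar>t\<bar> \<le> b \<Longrightarrow> norm (\<phi>' t + of_real (t * \<sigma>\<^sup>2) * \<phi> t) \<le> A * \<sigma>\<^sup>2 * t\<^sup>2 * exp (- \<sigma>\<^sup>2 * t\<^sup>2 / 24)"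
    and t: "\<bar>t\<bar> \<le> b"
  shows "norm (\<phi> t - of_real (exp (- \<sigma>\<^sup>2 * t\<^sup>2 / 2))) \<le> A * \<sigma>\<^sup>2 * \<bar>t\<bar> ^ 3 * exp (- \<sigma>\<^sup>2 * t\<^sup>2 / 24)"
proof -
  define G where "G = (\<lambda>s. of_real (exp (\<sigma>\<^sup>2 * s\<^sup>2 / 2)) * \<phi> s)"
  define B where "B = A * \<sigma>\<^sup>2 * t\<^sup>2 * exp (11/24 * (\<sigma>\<^sup>2 * t\<^sup>2))"
  have der_G: "(G has_vector_derivative of_real (exp (\<sigma>\<^sup>2 * s\<^sup>2 / 2)) * (\<phi>' s + of_real (s * \<sigma>\<^sup>2) * \<phi> s)) (at s within S)" for s S
  proof -
    have "((\<lambda>s. exp (\<sigma>\<^sup>2 * s\<^sup>2 / 2)) has_real_derivative exp (\<sigma>\<^sup>2 * s\<^sup>2 / 2) * (s * \<sigma>\<^sup>2)) (at s within S)"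
      by (auto intro!: derivative_eq_intros)
    then have "((\<lambda>s. complex_of_real (exp (\<sigma>\<^sup>2 * s\<^sup>2 / 2))) has_vector_derivative of_real (exp (\<sigma>\<^sup>2 * s\<^sup>2 / 2) * (s * \<sigma>\<^sup>2))) (at s within S)"
      by (intro has_vector_derivative_of_real) (simp add: has_real_derivative_iff_has_vector_derivative)
    from has_vector_derivative_mult[OF this has_vector_derivative_at_within[OF der]]
    show ?thesis unfolding G_def by (simp add: algebra_simps)
  qed
  have bound: "norm (of_real (exp (\<sigma>\<^sup>2 * s\<^sup>2 / 2)) * (\<phi>' s + of_real (s * \<sigma>\<^sup>2) * \<phi> s)) \<le> B" if s: "\<bar>s\<bar> \<le> \<bar>t\<bar>" for s
  proof -
    have s2: "s\<^sup>2 \<le> t\<^sup>2" using s by (simp add: abs_le_square_iff)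
    have "norm (of_real (exp (\<sigma>\<^sup>2 * s\<^sup>2 / 2)) * (\<phi>' s + of_real (s * \<sigma>\<^sup>2) * \<phi> s)) \<le>
        exp (\<sigma>\<^sup>2 * s\<^sup>2 / 2) * (A * \<sigma>\<^sup>2 * s\<^sup>2 * exp (- \<sigma>\<^sup>2 * s\<^sup>2 / 24))"
      unfolding norm_mult using ode[of s] s t by (intro mult_mono) auto
    also have "\<dots> = A * \<sigma>\<^sup>2 * s\<^sup>2 * (exp (\<sigma>\<^sup>2 * s\<^sup>2 / 2) * exp (- \<sigma>\<^sup>2 * s\<^sup>2 / 24))" by (simp only: mult_ac)
    also have "exp (\<sigma>\<^sup>2 * s\<^sup>2 / 2) * exp (- \<sigma>\<^sup>2 * s\<^sup>2 / 24) = exp (11/24 * (\<sigma>\<^sup>2 * s\<^sup>2))"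
      unfolding exp_add[symmetric] by simp
    also have "A * \<sigma>\<^sup>2 * s\<^sup>2 * exp (11/24 * (\<sigma>\<^sup>2 * s\<^sup>2)) \<le> B"
      unfolding B_def using A s2 by (intro mult_mono) (auto intro!: mult_left_mono mult_nonneg_nonneg)
    finally show ?thesis .
  qed
  have "norm (G t - G 0) \<le> B * norm (t - 0)"
  proof (rule differentiable_bound[of "{-\<bar>t\<bar>..\<bar>t\<bar>}"])
    fix s assume s: "s \<in> {-\<bar>t\<bar>..\<bar>t\<bar>}"
    show "(G has_derivative (\<lambda>x. x *\<^sub>R (of_real (exp (\<sigma>\<^sup>2 * s\<^sup>2 / 2)) * (\<phi>' s + of_real (s * \<sigma>\<^sup>2) * \<phi> s)))) (at s within {-\<bar>t\<bar>..\<bar>t\<bar>})"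
      using der_G[of s] unfolding has_vector_derivative_def .
    show "onorm (\<lambda>x. x *\<^sub>R (of_real (exp (\<sigma>\<^sup>2 * s\<^sup>2 / 2)) * (\<phi>' s + of_real (s * \<sigma>\<^sup>2) * \<phi> s))) \<le> B"
    proof (rule onorm_le)
      fix x :: real
      have "\<bar>x\<bar> * norm (of_real (exp (\<sigma>\<^sup>2 * s\<^sup>2 / 2)) * (\<phi>' s + of_real (s * \<sigma>\<^sup>2) * \<phi> s)) \<le> \<bar>x\<bar> * B"
        using s by (intro mult_left_mono bound) auto
      then show "norm (x *\<^sub>R (of_real (exp (\<sigma>\<^sup>2 * s\<^sup>2 / 2)) * (\<phi>' s + of_real (s * \<sigma>\<^sup>2) * \<phi> s))) \<le> B * norm x"
        by (simp only: norm_scaleR real_norm_def mult.commute[of B])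
    qed
  qed auto
  then have G: "norm (G t - 1) \<le> B * \<bar>t\<bar>" by (simp add: G_def one)
  have "\<phi> t - of_real (exp (- \<sigma>\<^sup>2 * t\<^sup>2 / 2)) = of_real (exp (- \<sigma>\<^sup>2 * t\<^sup>2 / 2)) * (G t - 1)"
  proof -
    have "complex_of_real (exp (- \<sigma>\<^sup>2 * t\<^sup>2 / 2)) * of_real (exp (\<sigma>\<^sup>2 * t\<^sup>2 / 2)) = 1"
      unfolding of_real_mult[symmetric] exp_add[symmetric] by simp
    then show ?thesis by (simp add: G_def right_diff_distrib flip: mult.assoc)
  qed
  then have "norm (\<phi> t - of_real (exp (- \<sigma>\<^sup>2 * t\<^sup>2 / 2))) \<le> exp (- \<sigma>\<^sup>2 * t\<^sup>2 / 2) * (B * \<bar>t\<bar>)"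
    using G by (simp add: norm_mult)
  also have "\<dots> = A * \<sigma>\<^sup>2 * (t\<^sup>2 * \<bar>t\<bar>) * (exp (- \<sigma>\<^sup>2 * t\<^sup>2 / 2) * exp (11/24 * (\<sigma>\<^sup>2 * t\<^sup>2)))"
    unfolding B_def by (simp only: mult_ac)
  also have "exp (- \<sigma>\<^sup>2 * t\<^sup>2 / 2) * exp (11/24 * (\<sigma>\<^sup>2 * t\<^sup>2)) = exp (- \<sigma>\<^sup>2 * t\<^sup>2 / 24)"
    unfolding exp_add[symmetric] by simp
  also have "t\<^sup>2 * \<bar>t\<bar> = \<bar>t\<bar> ^ 3" by (simp add: power3_eq_cube power2_eq_square)
  finally show ?thesis .
qed

lemma fourier_coeff_pmf:
  fixes p :: "int pmf"
  assumes "finite (set_pmf p)"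
  shows "fourier_coeff \<mu> (\<lambda>t. \<Sum>j\<in>set_pmf p. of_real (pmf p j) * cis (t * (real_of_int j - \<mu>))) k = of_real (pmf p k)"
proof -
  have "integral {-pi..pi} (\<lambda>t. (\<Sum>j\<in>set_pmf p. of_real (pmf p j) * cis (t * (real_of_int j - \<mu>))) * cis (- t * (real_of_int k - \<mu>))) =
      integral {-pi..pi} (\<lambda>t. \<Sum>j\<in>set_pmf p. of_real (pmf p j) * cis (t * real_of_int (j - k)))"
  proof (rule integral_cong)
    fix t
    have "cis (t * (real_of_int j - \<mu>)) * cis (- t * (real_of_int k - \<mu>)) = cis (t * real_of_int (j - k))" for j
      unfolding cis_mult by (rule arg_cong[where f = cis]) (simp add: algebra_simps)
    then show "(\<Sum>j\<in>set_pmf p. of_real (pmf p j) * cis (t * (real_of_int j - \<mu>))) * cis (- t * (real_of_int k - \<mu>)) =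
        (\<Sum>j\<in>set_pmf p. of_real (pmf p j) * cis (t * real_of_int (j - k)))"
      by (simp only: sum_distrib_right mult.assoc)
  qed
  also have "\<dots> = (\<Sum>j\<in>set_pmf p. integral {-pi..pi} (\<lambda>t. of_real (pmf p j) * cis (t * real_of_int (j - k))))"
    using assms by (intro integral_sum integrable_continuous_real continuous_on_mult_left continuous_on_cis_linear)
  also have "\<dots> = (\<Sum>j\<in>set_pmf p. if j = k then 2 * pi * pmf p k else 0)"
    unfolding integral_mult_right integral_cis_int of_real_sum by (intro sum.cong refl) (simp add: mult_ac)
  also have "\<dots> = 2 * pi * pmf p k"
    using assms by (simp add: set_pmf_iff)
  finally show ?thesis unfolding fourier_coeff_def by simp
qed

section \<open>From the Stein equation to normal approximation\<close>

text \<open>Outside of \<open>F\<close> only the mass of \<open>P\<close> enters: the total variation distance is the supremum of the one-sided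
differences, which complementation exchanges.\<close>

lemma d_TV_le:
  assumes F: "finite F"
  shows "d_TV P Q \<le> (\<Sum>k\<in>F. \<bar>pmf P k - pmf Q k\<bar>) + measure_pmf.prob P (- F)"
  unfolding d_TV_def
proof (rule cSUP_least)
  fix A :: "int set"
  define \<delta> where "\<delta> = (\<Sum>k\<in>F. \<bar>pmf P k - pmf Q k\<bar>)"
  have one_sided: "measure_pmf.prob P A - measure_pmf.prob Q A \<le> \<delta> + measure_pmf.prob P (- F)" for A
  proof -
    have "measure_pmf.prob P A \<le> measure_pmf.prob P (A \<inter> F) + measure_pmf.prob P (- F)"
      by (rule order_trans[OF measure_pmf.finite_measure_mono measure_Un_le]) auto
    moreover have "measure_pmf.prob Q (A \<inter> F) \<le> measure_pmf.prob Q A"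
      by (intro measure_pmf.finite_measure_mono) auto
    moreover have "measure_pmf.prob P (A \<inter> F) - measure_pmf.prob Q (A \<inter> F) = (\<Sum>k\<in>A \<inter> F. pmf P k - pmf Q k)"
      using F by (simp add: measure_measure_pmf_finite sum_subtractf)
    moreover have "(\<Sum>k\<in>A \<inter> F. pmf P k - pmf Q k) \<le> (\<Sum>k\<in>A \<inter> F. \<bar>pmf P k - pmf Q k\<bar>)"
      by (intro sum_mono) auto
    moreover have "(\<Sum>k\<in>A \<inter> F. \<bar>pmf P k - pmf Q k\<bar>) \<le> \<delta>"
      unfolding \<delta>_def using F by (intro sum_mono2) auto
    ultimately show ?thesis by linarith
  qed
  have "measure_pmf.prob Q A - measure_pmf.prob P A = measure_pmf.prob P (- A) - measure_pmf.prob Q (- A)"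
    using measure_pmf.prob_compl[of A P] measure_pmf.prob_compl[of A Q] by (simp add: Compl_eq_Diff_UNIV)
  with one_sided[of A] one_sided[of "- A"]
  show "\<bar>measure_pmf.prob P A - measure_pmf.prob Q A\<bar> \<le> (\<Sum>k\<in>F. \<bar>pmf P k - pmf Q k\<bar>) + measure_pmf.prob P (- F)"
    unfolding \<delta>_def by linarith
qed simp

lemma d_loc_le:
  assumes "\<And>k. \<bar>pmf P k - pmf Q k\<bar> \<le> B"
  shows "d_loc P Q \<le> B"
  unfolding d_loc_def using assms by (intro cSUP_least) auto

lemma fourier_coeff_diff:
  assumes "continuous_on {-pi..pi} u" "continuous_on {-pi..pi} v"
  shows "fourier_coeff \<mu> (\<lambda>t. u t - v t) k = fourier_coeff \<mu> u k - fourier_coeff \<mu> v k"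
proof -
  have "integral {-pi..pi} (\<lambda>t. u t * cis (- t * (real_of_int k - \<mu>)) - v t * cis (- t * (real_of_int k - \<mu>))) =
    integral {-pi..pi} (\<lambda>t. u t * cis (- t * (real_of_int k - \<mu>))) - integral {-pi..pi} (\<lambda>t. v t * cis (- t * (real_of_int k - \<mu>)))"
    using assms by (intro integral_diff integrable_continuous_real continuous_on_mult continuous_on_cis_linear)
  then show ?thesis by (simp only: fourier_coeff_def left_diff_distrib diff_divide_distrib)
qed

text \<open>Chebyshev's inequality at distance \<open>\<sigma>\<^sup>2\<close>, that is \<open>\<sigma>\<close> standard deviations, from the mean.\<close>

lemma prob_far_le:
  fixes p :: "int pmf"
  assumes fin: "finite (set_pmf p)" and \<sigma>: "\<sigma> > 0"
    and var: "measure_pmf.expectation p (\<lambda>k. (real_of_int k - \<mu>)\<^sup>2) = \<sigma>\<^sup>2"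
    and F: "\<And>k. k \<notin> F \<Longrightarrow> \<sigma>\<^sup>2 \<le> \<bar>real_of_int k - \<mu>\<bar>"
  shows "measure_pmf.prob p (- F) \<le> 1 / \<sigma>\<^sup>2"
proof -
  have int: "integrable (measure_pmf p) f" for f :: "int \<Rightarrow> real"
    using fin by (rule integrable_measure_pmf_finite)
  have "measure_pmf.prob p (- F) = measure_pmf.expectation p (indicator (- F))" by simp
  also have "\<dots> \<le> measure_pmf.expectation p (\<lambda>k. (real_of_int k - \<mu>)\<^sup>2 / \<sigma> ^ 4)"
  proof (rule integral_mono[OF int int])
    fix k
    show "indicator (- F) k \<le> (real_of_int k - \<mu>)\<^sup>2 / \<sigma> ^ 4"
    proof (cases "k \<in> F")
      case False
      have "\<sigma> ^ 4 = (\<sigma>\<^sup>2)\<^sup>2" by simp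
      also have "\<dots> \<le> \<bar>real_of_int k - \<mu>\<bar>\<^sup>2" using F[OF False] by (intro power_mono) auto
      finally show ?thesis using False \<sigma> by simp
    qed simp
  qed
  also have "\<dots> = \<sigma>\<^sup>2 / \<sigma> ^ 4" by (simp add: var)
  also have "\<dots> = 1 / \<sigma>\<^sup>2" using \<sigma> by (simp add: power4_eq_xxxx power2_eq_square)
  finally show ?thesis .
qed

text \<open>With the weight \<open>z k = 1 + ((k - \<mu>)/\<sigma>)\<^sup>2\<close>, this is the inequality
\<open>2 a \<le> \<sigma>\<^sup>2 a\<^sup>2 z + 1 / (\<sigma>\<^sup>2 z)\<close>, summed over \<open>F\<close>; the factor \<open>\<sigma>\<^sup>2\<close> balances the sum \<open>M / \<sigma>\<^sup>3\<close> of the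
first terms against the sum of order \<open>\<sigma>\<close> of the reciprocal weights.\<close>

lemma weighted_l1_bound:
  fixes a :: "int \<Rightarrow> real" and \<mu> \<sigma> M :: real
  assumes \<sigma>: "\<sigma> \<ge> 1" and F: "finite F" and a: "\<And>k. 0 \<le> a k"
    and M: "(\<Sum>k\<in>F. (a k)\<^sup>2 * (1 + ((real_of_int k - \<mu>) / \<sigma>)\<^sup>2)) \<le> M / \<sigma> ^ 3"
  shows "(\<Sum>k\<in>F. a k) \<le> (M / 2 + pi) / \<sigma>"
proof -
  define z where "z = (\<lambda>k. 1 + ((real_of_int k - \<mu>) / \<sigma>)\<^sup>2)"
  have z: "z k > 0" for k by (simp add: z_def add_pos_nonneg)
  have \<sigma>0: "\<sigma> > 0" using \<sigma> by simp
  have "a k \<le> (\<sigma>\<^sup>2 * ((a k)\<^sup>2 * z k) + 1 / \<sigma>\<^sup>2 * (1 / z k)) / 2" for k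
  proof -
    define r where "r = \<sigma> * sqrt (z k)"
    have r: "r > 0" "r\<^sup>2 = \<sigma>\<^sup>2 * z k" using \<sigma>0 z[of k] by (auto simp: r_def power_mult_distrib)
    have "2 * (r * a k) * (1 / r) \<le> (r * a k)\<^sup>2 + (1 / r)\<^sup>2" by (rule sum_squares_bound)
    also have "2 * (r * a k) * (1 / r) = 2 * a k" using r(1) by simp
    also have "(r * a k)\<^sup>2 + (1 / r)\<^sup>2 = \<sigma>\<^sup>2 * ((a k)\<^sup>2 * z k) + 1 / \<sigma>\<^sup>2 * (1 / z k)"
      by (simp add: power_mult_distrib power_divide r(2))
    finally show ?thesis by simp
  qed
  then have "(\<Sum>k\<in>F. a k) \<le> (\<Sum>k\<in>F. (\<sigma>\<^sup>2 * ((a k)\<^sup>2 * z k) + 1 / \<sigma>\<^sup>2 * (1 / z k)) / 2)" by (intro sum_mono)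
  also have "\<dots> = (\<sigma>\<^sup>2 * (\<Sum>k\<in>F. (a k)\<^sup>2 * z k) + 1 / \<sigma>\<^sup>2 * (\<Sum>k\<in>F. 1 / z k)) / 2"
    by (simp only: sum_divide_distrib[symmetric] sum.distrib sum_distrib_left[symmetric])
  also have "\<dots> \<le> (\<sigma>\<^sup>2 * (M / \<sigma> ^ 3) + 1 / \<sigma>\<^sup>2 * (2 * pi * \<sigma>)) / 2"
    using M lattice_cauchy_sum[OF \<sigma> F, of \<mu>] unfolding z_def
    by (intro divide_right_mono add_mono mult_left_mono) auto
  also have "\<dots> = (M / 2 + pi) / \<sigma>"
    using \<sigma>0 by (simp add: field_simps power2_eq_square power3_eq_cube)
  finally show ?thesis .
qed

text \<open>The difference of the mass functions has three parts: \<open>a k\<close> is the Fourier coefficient of the difference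
\<open>g\<close> of the two characteristic functions on \<open>[-\<pi>, \<pi>]\<close>, \<open>1 / \<sigma> ^ 4\<close> comes from truncating the Gaussian to this
interval, and the last summand comes from the discretization. In the variable \<open>x = \<sigma> t\<close>, \<open>g\<close> is of order
\<open>|x|\<^sup>3 exp(-x\<^sup>2/24) / \<sigma>\<close> and its derivative is of order \<open>(x\<^sup>2 + x\<^sup>4) exp(-x\<^sup>2/24)\<close>. Hence Bessel's inequality
for \<open>g\<close> bounds the sum of \<open>a\<^sup>2\<close>, and for \<open>g'\<close> that of \<open>(k - \<mu>)\<^sup>2 a\<^sup>2\<close>, which are the two parts of the
weighted sum. The bound on the number of elements of \<open>F\<close> is there for the boundary terms of the
integration by parts.\<close>

lemma normal_approximation_pointwise:
  fixes p :: "int pmf" and \<mu> \<sigma> :: real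
  assumes fin: "finite (set_pmf p)" and \<sigma>: "\<sigma> \<ge> 1"
    and stein: "\<And>t. \<bar>t\<bar> \<le> pi \<Longrightarrow>
      norm (measure_pmf.expectation p (\<lambda>k. \<i> * of_real (real_of_int k - \<mu>) * cis (t * (real_of_int k - \<mu>)))
        + of_real (t * \<sigma>\<^sup>2) * measure_pmf.expectation p (\<lambda>k. cis (t * (real_of_int k - \<mu>))))
      \<le> 4 * \<sigma>\<^sup>2 * t\<^sup>2 * exp (- \<sigma>\<^sup>2 * t\<^sup>2 / 24)"
  defines "M \<equiv> 8 * gauss_const 6 + 32 * (gauss_const 4 + gauss_const 8) + 96 * (gauss_const 3)\<^sup>2"
  obtains a :: "int \<Rightarrow> real" where
    "\<And>k. \<bar>pmf p k - pmf (discretized_normal \<mu> (\<sigma>\<^sup>2)) k\<bar> \<le>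
      a k + 1 / \<sigma> ^ 4 + 2 * gauss_const 1 / \<sigma>\<^sup>2 / (1 + ((real_of_int k - \<mu>) / \<sigma>)\<^sup>2)"
    "\<And>k. 0 \<le> a k" "\<And>k. a k \<le> 2 * gauss_const 3 / \<sigma>\<^sup>2"
    "\<And>F. finite F \<Longrightarrow> card F \<le> 3 * \<sigma>\<^sup>2 \<Longrightarrow>
      (\<Sum>k\<in>F. (a k)\<^sup>2 * (1 + ((real_of_int k - \<mu>) / \<sigma>)\<^sup>2)) \<le> M / \<sigma> ^ 3"
proof -
  have \<sigma>0: "\<sigma> > 0" using \<sigma> by simp
  note K = gauss_const_nonneg
  define \<phi> where "\<phi> = (\<lambda>t. \<Sum>j\<in>set_pmf p. of_real (pmf p j) * cis (t * (real_of_int j - \<mu>)))"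
  define \<phi>' where "\<phi>' = (\<lambda>t. \<Sum>j\<in>set_pmf p. of_real (pmf p j) * (\<i> * of_real (real_of_int j - \<mu>) * cis (t * (real_of_int j - \<mu>))))"
  define \<psi> where "\<psi> = (\<lambda>t. complex_of_real (exp (- \<sigma>\<^sup>2 * t\<^sup>2 / 2)))"
  define g where "g = (\<lambda>t. \<phi> t - \<psi> t)"
  define g' where "g' = (\<lambda>t. \<phi>' t + of_real (t * \<sigma>\<^sup>2) * \<psi> t)"
  define a where "a = (\<lambda>k. norm (fourier_coeff \<mu> g k))"
  have cis_deriv: "((\<lambda>t. cis (t * x)) has_vector_derivative \<i> * of_real x * cis (t * x)) (at t within S)" for x t S
  proof -
    have "((\<lambda>t. exp (\<i> * x * of_real t)) has_vector_derivative (\<i> * x) * exp (\<i> * x * of_real t)) (at t within S)"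
      by (auto intro!: derivative_eq_intros has_vector_derivative_real_field)
    then show ?thesis by (simp add: cis_conv_exp mult_ac)
  qed
  have \<phi>_deriv: "(\<phi> has_vector_derivative \<phi>' t) (at t within S)" for t S
    unfolding \<phi>_def \<phi>'_def by (intro has_vector_derivative_sum has_vector_derivative_mult_right cis_deriv)
  have \<psi>_deriv: "(\<psi> has_vector_derivative - of_real (t * \<sigma>\<^sup>2) * \<psi> t) (at t within S)" for t S
  proof -
    have "((\<lambda>t. exp (- \<sigma>\<^sup>2 * t\<^sup>2 / 2)) has_real_derivative - (t * \<sigma>\<^sup>2) * exp (- \<sigma>\<^sup>2 * t\<^sup>2 / 2)) (at t within S)"
      by (auto intro!: derivative_eq_intros)
    then have "((\<lambda>t. complex_of_real (exp (- \<sigma>\<^sup>2 * t\<^sup>2 / 2))) has_vector_derivative of_real (- (t * \<sigma>\<^sup>2) * exp (- \<sigma>\<^sup>2 * t\<^sup>2 / 2))) (at t within S)"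
      by (intro has_vector_derivative_of_real) (simp only: has_real_derivative_iff_has_vector_derivative)
    then show ?thesis by (simp only: \<psi>_def of_real_mult of_real_minus)
  qed
  have g_deriv: "(g has_vector_derivative g' t) (at t within S)" for t S
    using has_vector_derivative_diff[OF \<phi>_deriv \<psi>_deriv, of t S] by (simp add: g_def g'_def)
  have cont_\<phi>: "continuous_on S \<phi>" and cont_\<psi>: "continuous_on S \<psi>" and cont_\<phi>': "continuous_on S \<phi>'" for S
    unfolding \<phi>_def \<psi>_def \<phi>'_def by (auto intro!: continuous_intros continuous_on_cis_linear)
  have cont_g: "continuous_on S g" and cont_g': "continuous_on S g'" for S
    unfolding g_def g'_def by (auto intro!: continuous_intros cont_\<phi> cont_\<psi> cont_\<phi>')
  have expect: "measure_pmf.expectation p f = (\<Sum>j\<in>set_pmf p. of_real (pmf p j) * f j)" for f :: "int \<Rightarrow> complex"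
    by (subst integral_measure_pmf[OF fin]) (auto simp: scaleR_conv_of_real)
  have ode: "norm (\<phi>' t + of_real (t * \<sigma>\<^sup>2) * \<phi> t) \<le> 4 * \<sigma>\<^sup>2 * t\<^sup>2 * exp (- \<sigma>\<^sup>2 * t\<^sup>2 / 24)" if "\<bar>t\<bar> \<le> pi" for t
    using stein[OF that] unfolding expect \<phi>_def \<phi>'_def .
  have \<phi>0: "\<phi> 0 = 1"
  proof -
    have "(\<Sum>j\<in>set_pmf p. pmf p j) = 1" using fin by (intro sum_pmf_eq_1) auto
    then have "complex_of_real (\<Sum>j\<in>set_pmf p. pmf p j) = 1" by simp
    then show ?thesis by (simp add: \<phi>_def)
  qed
  have sq_exp: "(exp (- x\<^sup>2 / 24))\<^sup>2 \<le> exp (- x\<^sup>2 / 24)" for x :: real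
    by (simp add: power2_eq_square mult_left_le)
  have g_bound: "norm (g t) \<le> 4 / \<sigma> * (\<bar>\<sigma> * t\<bar> ^ 3 * exp (- (\<sigma> * t)\<^sup>2 / 24))" if "\<bar>t\<bar> \<le> pi" for t
  proof -
    have "norm (g t) \<le> 4 * \<sigma>\<^sup>2 * \<bar>t\<bar> ^ 3 * exp (- \<sigma>\<^sup>2 * t\<^sup>2 / 24)"
      unfolding g_def \<psi>_def
      by (rule gaussian_ode_stability[where b = pi and \<phi>' = \<phi>', OF \<phi>_deriv \<phi>0 _ ode that]) auto
    also have "\<dots> = 4 / \<sigma> * (\<bar>\<sigma> * t\<bar> ^ 3 * exp (- (\<sigma> * t)\<^sup>2 / 24))"
    proof -
      have "- \<sigma>\<^sup>2 * t\<^sup>2 / 24 = - (\<sigma> * t)\<^sup>2 / 24" by (simp add: power_mult_distrib)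
      moreover have "4 * \<sigma>\<^sup>2 * \<bar>t\<bar> ^ 3 * e = 4 / \<sigma> * (\<bar>\<sigma> * t\<bar> ^ 3 * e)" for e
        using \<sigma>0 by (simp add: abs_mult power_mult_distrib power2_eq_square power3_eq_cube)
      ultimately show ?thesis by simp
    qed
    finally show ?thesis .
  qed
  have g_cauchy: "norm (g t) \<le> 4 * gauss_const 3 / \<sigma> / (1 + (\<sigma> * t)\<^sup>2)" if "\<bar>t\<bar> \<le> pi" for t
  proof -
    have "norm (g t) \<le> 4 / \<sigma> * (gauss_const 3 / (1 + (\<sigma> * t)\<^sup>2))"
      using \<sigma>0 by (intro order_trans[OF g_bound[OF that]] mult_left_mono power_gauss_bound) auto
    then show ?thesis by simp
  qed
  have g_sq: "(norm (g t))\<^sup>2 \<le> 16 * gauss_const 6 / \<sigma>\<^sup>2 / (1 + (\<sigma> * t)\<^sup>2)" if "\<bar>t\<bar> \<le> pi" for t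
  proof -
    have "(norm (g t))\<^sup>2 \<le> (4 / \<sigma> * (\<bar>\<sigma> * t\<bar> ^ 3 * exp (- (\<sigma> * t)\<^sup>2 / 24)))\<^sup>2"
      by (intro power_mono g_bound that) auto
    also have "\<dots> = 16 / \<sigma>\<^sup>2 * (\<bar>\<sigma> * t\<bar> ^ 6 * (exp (- (\<sigma> * t)\<^sup>2 / 24))\<^sup>2)"
      by (simp only: power_mult_distrib power_divide power_mult[symmetric]) simp
    also have "\<dots> \<le> 16 / \<sigma>\<^sup>2 * (\<bar>\<sigma> * t\<bar> ^ 6 * exp (- (\<sigma> * t)\<^sup>2 / 24))"
      by (intro mult_left_mono sq_exp) auto
    also have "\<dots> \<le> 16 / \<sigma>\<^sup>2 * (gauss_const 6 / (1 + (\<sigma> * t)\<^sup>2))"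
      by (intro mult_left_mono power_gauss_bound) auto
    finally show ?thesis by simp
  qed
  have g'_sq: "(norm (g' t))\<^sup>2 \<le> 32 * (gauss_const 4 + gauss_const 8) / (1 + (\<sigma> * t)\<^sup>2)" if t: "\<bar>t\<bar> \<le> pi" for t
  proof -
    define x where "x = \<bar>\<sigma> * t\<bar>"
    define E where "E = exp (- (\<sigma> * t)\<^sup>2 / 24)"
    have E0: "0 \<le> E" by (simp add: E_def)
    have x_eq: "\<sigma>\<^sup>2 * t\<^sup>2 = x\<^sup>2" "\<bar>t * \<sigma>\<^sup>2\<bar> = \<sigma> * x" using \<sigma>0 by (auto simp: x_def power_mult_distrib abs_mult power2_eq_square)
    have "g' t = (\<phi>' t + of_real (t * \<sigma>\<^sup>2) * \<phi> t) - of_real (t * \<sigma>\<^sup>2) * g t"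
      by (simp add: g'_def g_def algebra_simps)
    then have "norm (g' t) \<le> norm (\<phi>' t + of_real (t * \<sigma>\<^sup>2) * \<phi> t) + norm (of_real (t * \<sigma>\<^sup>2) * g t)"
      by (simp only: norm_triangle_ineq4)
    also have "\<dots> \<le> 4 * x\<^sup>2 * E + (\<sigma> * x) * (4 / \<sigma> * (x ^ 3 * E))"
    proof (rule add_mono)
      show "norm (\<phi>' t + of_real (t * \<sigma>\<^sup>2) * \<phi> t) \<le> 4 * x\<^sup>2 * E"
        using ode[OF t] by (simp add: E_def power_mult_distrib mult.assoc x_eq(1))
      show "norm (of_real (t * \<sigma>\<^sup>2) * g t) \<le> (\<sigma> * x) * (4 / \<sigma> * (x ^ 3 * E))"
        unfolding norm_mult norm_of_real x_eq(2) E_def x_def using g_bound[OF t] \<sigma>0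
        by (intro mult_left_mono) auto
    qed
    also have "\<dots> = 4 * ((x ^ 2 + x ^ 4) * E)"
      using \<sigma>0 by (simp add: algebra_simps power2_eq_square power3_eq_cube power4_eq_xxxx)
    finally have "(norm (g' t))\<^sup>2 \<le> (4 * ((x ^ 2 + x ^ 4) * E))\<^sup>2" by (intro power_mono) auto
    also have "\<dots> = 16 * ((x ^ 2 + x ^ 4)\<^sup>2 * E\<^sup>2)" by (simp add: power_mult_distrib)
    also have "\<dots> \<le> 16 * ((2 * (x ^ 4 + x ^ 8)) * E)"
    proof (intro mult_left_mono mult_mono)
      have "0 \<le> (x ^ 2 - x ^ 4)\<^sup>2" by simp
      then show "(x ^ 2 + x ^ 4)\<^sup>2 \<le> 2 * (x ^ 4 + x ^ 8)"
        by (simp add: power2_sum power2_diff flip: power_mult)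
      show "E\<^sup>2 \<le> E" unfolding E_def by (rule sq_exp)
    qed (auto simp: x_def E_def)
    also have "\<dots> = 32 * (\<bar>\<sigma> * t\<bar> ^ 4 * exp (- (\<sigma> * t)\<^sup>2 / 24) + \<bar>\<sigma> * t\<bar> ^ 8 * exp (- (\<sigma> * t)\<^sup>2 / 24))"
      by (simp only: E_def x_def) (simp add: algebra_simps)
    also have "\<dots> \<le> 32 * (gauss_const 4 / (1 + (\<sigma> * t)\<^sup>2) + gauss_const 8 / (1 + (\<sigma> * t)\<^sup>2))"
      by (intro mult_left_mono add_mono power_gauss_bound) auto
    finally show ?thesis by (simp add: add_divide_distrib)
  qed
  have sup: "a k \<le> 2 * gauss_const 3 / \<sigma>\<^sup>2" for k
  proof -
    have "a k \<le> integral {-pi..pi} (\<lambda>t. norm (g t)) / (2 * pi)"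
      unfolding a_def by (rule fourier_coeff_le) (rule cont_g)
    also have "integral {-pi..pi} (\<lambda>t. norm (g t)) \<le> (4 * gauss_const 3 / \<sigma>) * pi / \<sigma>"
      using g_cauchy K[of 3] \<sigma>0
      by (intro integral_le_of_cauchy_bound) (auto intro!: integrable_continuous_real continuous_intros cont_g)
    finally show ?thesis by (simp add: divide_right_mono power2_eq_square field_simps)
  qed
  define b where "b = (norm (g pi) + norm (g (- pi))) / (2 * pi)"
  have b: "0 \<le> b" "b \<le> 4 * gauss_const 3 / \<sigma> ^ 3"
  proof -
    have "norm (g t) \<le> 4 * gauss_const 3 / \<sigma> ^ 3" if "\<bar>t\<bar> = pi" for t
    proof -
      have "1 \<le> t\<^sup>2" using that pi_gt3 by (metis abs_le_square_iff abs_one less_eq_real_def one_power2 order_trans one_le_numeral)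
      then have "\<sigma>\<^sup>2 * 1 \<le> \<sigma>\<^sup>2 * t\<^sup>2" by (intro mult_left_mono) auto
      then have "\<sigma>\<^sup>2 \<le> 1 + (\<sigma> * t)\<^sup>2" by (simp add: power_mult_distrib)
      then have "4 * gauss_const 3 / \<sigma> / (1 + (\<sigma> * t)\<^sup>2) \<le> 4 * gauss_const 3 / \<sigma> / \<sigma>\<^sup>2"
        using \<sigma>0 K[of 3] by (intro divide_left_mono) (auto simp: add_pos_nonneg)
      with g_cauchy[of t] that show ?thesis by (simp add: power2_eq_square power3_eq_cube)
    qed
    from this[of pi] this[of "- pi"] have "b \<le> (4 * gauss_const 3 / \<sigma> ^ 3 + 4 * gauss_const 3 / \<sigma> ^ 3) / (2 * pi)"
      unfolding b_def by (intro divide_right_mono add_mono) auto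
    also have "\<dots> = (4 * gauss_const 3 / \<sigma> ^ 3) / pi" by simp
    also have "\<dots> \<le> (4 * gauss_const 3 / \<sigma> ^ 3) / 1"
      using pi_gt3 K[of 3] \<sigma>0 by (intro divide_left_mono) auto
    finally show "b \<le> 4 * gauss_const 3 / \<sigma> ^ 3" by simp
  qed (simp add: b_def)
  have weighted: "(\<Sum>k\<in>F. (a k)\<^sup>2 * (1 + ((real_of_int k - \<mu>) / \<sigma>)\<^sup>2)) \<le> M / \<sigma> ^ 3"
    if F: "finite F" and card: "card F \<le> 3 * \<sigma>\<^sup>2" for F
  proof -
    have "(a k)\<^sup>2 * (1 + ((real_of_int k - \<mu>) / \<sigma>)\<^sup>2) \<le>
        (a k)\<^sup>2 + 2 / \<sigma>\<^sup>2 * (norm (fourier_coeff \<mu> g' k))\<^sup>2 + 2 * b\<^sup>2 / \<sigma>\<^sup>2" for k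
    proof -
      have "\<bar>real_of_int k - \<mu>\<bar> * a k \<le> norm (fourier_coeff \<mu> g' k) + b"
        unfolding a_def b_def by (rule fourier_coeff_deriv) (auto intro: g_deriv cont_g')
      then have "(\<bar>real_of_int k - \<mu>\<bar> * a k)\<^sup>2 \<le> (norm (fourier_coeff \<mu> g' k) + b)\<^sup>2"
        by (intro power_mono) (auto simp: a_def)
      also have "\<dots> \<le> 2 * (norm (fourier_coeff \<mu> g' k))\<^sup>2 + 2 * b\<^sup>2"
        using sum_squares_bound[of "norm (fourier_coeff \<mu> g' k)" b] by (simp add: power2_sum)
      finally have "(\<bar>real_of_int k - \<mu>\<bar> * a k)\<^sup>2 / \<sigma>\<^sup>2 \<le> (2 * (norm (fourier_coeff \<mu> g' k))\<^sup>2 + 2 * b\<^sup>2) / \<sigma>\<^sup>2"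
        by (intro divide_right_mono) auto
      moreover have "(a k)\<^sup>2 * (1 + ((real_of_int k - \<mu>) / \<sigma>)\<^sup>2) = (a k)\<^sup>2 + (\<bar>real_of_int k - \<mu>\<bar> * a k)\<^sup>2 / \<sigma>\<^sup>2"
        by (simp add: power_mult_distrib power_divide distrib_left)
      ultimately show ?thesis by (simp add: add_divide_distrib)
    qed
    then have "(\<Sum>k\<in>F. (a k)\<^sup>2 * (1 + ((real_of_int k - \<mu>) / \<sigma>)\<^sup>2)) \<le>
        (\<Sum>k\<in>F. (a k)\<^sup>2 + 2 / \<sigma>\<^sup>2 * (norm (fourier_coeff \<mu> g' k))\<^sup>2 + 2 * b\<^sup>2 / \<sigma>\<^sup>2)"
      by (intro sum_mono)
    also have "\<dots> = (\<Sum>k\<in>F. (a k)\<^sup>2) + 2 / \<sigma>\<^sup>2 * (\<Sum>k\<in>F. (norm (fourier_coeff \<mu> g' k))\<^sup>2) + card F * (2 * b\<^sup>2 / \<sigma>\<^sup>2)"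
      by (simp only: sum.distrib sum_distrib_left[symmetric] sum_constant)
    also have "\<dots> \<le> 8 * gauss_const 6 / \<sigma> ^ 3 + 2 / \<sigma>\<^sup>2 * (16 * (gauss_const 4 + gauss_const 8) / \<sigma>) + 96 * (gauss_const 3)\<^sup>2 / \<sigma> ^ 3"
    proof (intro add_mono mult_left_mono)
      have "(\<Sum>k\<in>F. (a k)\<^sup>2) \<le> integral {-pi..pi} (\<lambda>t. (norm (g t))\<^sup>2) / (2 * pi)"
        unfolding a_def by (rule bessel_inequality[OF cont_g F])
      also have "\<dots> \<le> (16 * gauss_const 6 / \<sigma>\<^sup>2) * pi / \<sigma> / (2 * pi)"
        using g_sq K[of 6] \<sigma>0
        by (intro divide_right_mono integral_le_of_cauchy_bound) (auto intro!: integrable_continuous_real continuous_intros cont_g)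
      also have "\<dots> = 8 * gauss_const 6 / \<sigma> ^ 3" by (simp add: power2_eq_square power3_eq_cube)
      finally show "(\<Sum>k\<in>F. (a k)\<^sup>2) \<le> 8 * gauss_const 6 / \<sigma> ^ 3" .
      have "(\<Sum>k\<in>F. (norm (fourier_coeff \<mu> g' k))\<^sup>2) \<le> integral {-pi..pi} (\<lambda>t. (norm (g' t))\<^sup>2) / (2 * pi)"
        by (rule bessel_inequality[OF cont_g' F])
      also have "\<dots> \<le> (32 * (gauss_const 4 + gauss_const 8)) * pi / \<sigma> / (2 * pi)"
        using g'_sq K[of 4] K[of 8] \<sigma>0
        by (intro divide_right_mono integral_le_of_cauchy_bound) (auto intro!: integrable_continuous_real continuous_intros cont_g')
      also have "\<dots> = 16 * (gauss_const 4 + gauss_const 8) / \<sigma>"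
      proof -
        have "32 * x * pi / \<sigma> / (2 * pi) = 16 * x / \<sigma>" for x by (simp add: field_simps)
        then show ?thesis .
      qed
      finally show "(\<Sum>k\<in>F. (norm (fourier_coeff \<mu> g' k))\<^sup>2) \<le> 16 * (gauss_const 4 + gauss_const 8) / \<sigma>" .
      have "card F * (2 * b\<^sup>2 / \<sigma>\<^sup>2) \<le> (3 * \<sigma>\<^sup>2) * (2 * (4 * gauss_const 3 / \<sigma> ^ 3)\<^sup>2 / \<sigma>\<^sup>2)"
        using card b by (intro mult_mono divide_right_mono mult_left_mono power_mono) auto
      also have "\<dots> = 96 * (gauss_const 3)\<^sup>2 / \<sigma> ^ 6"
      proof -
        have "(4 * gauss_const 3 / \<sigma> ^ 3)\<^sup>2 = 16 * (gauss_const 3)\<^sup>2 / \<sigma> ^ 6"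
          by (simp add: power_divide power_mult_distrib flip: power_mult)
        moreover have "3 * \<sigma>\<^sup>2 * (2 * (16 * r / s) / \<sigma>\<^sup>2) = 96 * r / s" for r s using \<sigma>0 by simp
        ultimately show ?thesis by (simp only:)
      qed
      also have "\<dots> \<le> 96 * (gauss_const 3)\<^sup>2 / \<sigma> ^ 3"
        using \<sigma> by (intro divide_left_mono power_increasing) auto
      finally show "card F * (2 * b\<^sup>2 / \<sigma>\<^sup>2) \<le> 96 * (gauss_const 3)\<^sup>2 / \<sigma> ^ 3" .
    qed auto
    also have "\<dots> = M / \<sigma> ^ 3"
      by (simp add: M_def add_divide_distrib power2_eq_square power3_eq_cube)
    finally show ?thesis .
  qed
  have pointwise: "\<bar>pmf p k - pmf (discretized_normal \<mu> (\<sigma>\<^sup>2)) k\<bar> \<le>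
      a k + 1 / \<sigma> ^ 4 + 2 * gauss_const 1 / \<sigma>\<^sup>2 / (1 + ((real_of_int k - \<mu>) / \<sigma>)\<^sup>2)" for k
  proof -
    have "fourier_coeff \<mu> g k = of_real (pmf p k) - fourier_coeff \<mu> \<psi> k"
      unfolding g_def fourier_coeff_diff[OF cont_\<phi> cont_\<psi>] unfolding \<phi>_def fourier_coeff_pmf[OF fin] ..
    then have "of_real (pmf p k - normal_density \<mu> \<sigma> k) =
        fourier_coeff \<mu> g k + (fourier_coeff \<mu> \<psi> k - of_real (normal_density \<mu> \<sigma> k))" by simp
    then have "\<bar>pmf p k - normal_density \<mu> \<sigma> k\<bar> \<le> a k + norm (fourier_coeff \<mu> \<psi> k - of_real (normal_density \<mu> \<sigma> k))"
      unfolding a_def by (metis norm_of_real norm_triangle_ineq)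
    also have "norm (fourier_coeff \<mu> \<psi> k - of_real (normal_density \<mu> \<sigma> k)) \<le> 1 / \<sigma> ^ 4"
      unfolding \<psi>_def by (rule fourier_coeff_gaussian[OF \<sigma>])
    finally show ?thesis using discretized_normal_near_density[OF \<sigma>, of \<mu> k] by linarith
  qed
  show ?thesis
    by (rule that[of a]) (use pointwise sup weighted in \<open>auto simp: a_def\<close>)
qed

text \<open>The window \<open>F\<close> has radius \<open>\<sigma>\<^sup>2\<close>. This is wide enough for Chebyshev's inequality to leave only mass
\<open>1 / \<sigma>\<^sup>2\<close> outside, and narrow enough for the truncation errors \<open>1 / \<sigma> ^ 4\<close> of its at most \<open>3 \<sigma>\<^sup>2\<close> points to
sum to \<open>O(1/\<sigma>\<^sup>2)\<close>.\<close>

lemma normal_approximation_of_stein_bound: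
  "\<exists>C::real. \<forall>(p :: int pmf) \<mu> \<sigma>. finite (set_pmf p) \<longrightarrow> \<sigma> \<ge> 1 \<longrightarrow>
    measure_pmf.expectation p (\<lambda>k. (real_of_int k - \<mu>)\<^sup>2) = \<sigma>\<^sup>2 \<longrightarrow>
    (\<forall>t. \<bar>t\<bar> \<le> pi \<longrightarrow>
      norm (measure_pmf.expectation p (\<lambda>k. \<i> * of_real (real_of_int k - \<mu>) * cis (t * (real_of_int k - \<mu>)))
        + of_real (t * \<sigma>\<^sup>2) * measure_pmf.expectation p (\<lambda>k. cis (t * (real_of_int k - \<mu>))))
      \<le> 4 * \<sigma>\<^sup>2 * t\<^sup>2 * exp (- \<sigma>\<^sup>2 * t\<^sup>2 / 24)) \<longrightarrow>
    d_TV p (discretized_normal \<mu> (\<sigma>\<^sup>2)) \<le> C / \<sigma> \<and> d_loc p (discretized_normal \<mu> (\<sigma>\<^sup>2)) \<le> C / \<sigma>\<^sup>2"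
proof -
  define M where "M = 8 * gauss_const 6 + 32 * (gauss_const 4 + gauss_const 8) + 96 * (gauss_const 3)\<^sup>2"
  define C1 where "C1 = M / 2 + pi + 3 + 2 * gauss_const 1 * (2 * pi) + 1"
  define C2 where "C2 = 2 * gauss_const 3 + 1 + 2 * gauss_const 1"
  note K = gauss_const_nonneg
  have main: "d_TV p (discretized_normal \<mu> (\<sigma>\<^sup>2)) \<le> C1 / \<sigma> \<and> d_loc p (discretized_normal \<mu> (\<sigma>\<^sup>2)) \<le> C2 / \<sigma>\<^sup>2"
    if fin: "finite (set_pmf p)" and \<sigma>: "\<sigma> \<ge> 1"
      and var: "measure_pmf.expectation p (\<lambda>k. (real_of_int k - \<mu>)\<^sup>2) = \<sigma>\<^sup>2"
      and stein: "\<forall>t. \<bar>t\<bar> \<le> pi \<longrightarrow>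
      norm (measure_pmf.expectation p (\<lambda>k. \<i> * of_real (real_of_int k - \<mu>) * cis (t * (real_of_int k - \<mu>)))
        + of_real (t * \<sigma>\<^sup>2) * measure_pmf.expectation p (\<lambda>k. cis (t * (real_of_int k - \<mu>))))
      \<le> 4 * \<sigma>\<^sup>2 * t\<^sup>2 * exp (- \<sigma>\<^sup>2 * t\<^sup>2 / 24)" for p :: "int pmf" and \<mu> \<sigma> :: real
  proof -
    have \<sigma>0: "\<sigma> > 0" using \<sigma> by simp
    let ?Y = "discretized_normal \<mu> (\<sigma>\<^sup>2)"
    let ?z = "\<lambda>k. 1 + ((real_of_int k - \<mu>) / \<sigma>)\<^sup>2"
    obtain a where near: "\<And>k. \<bar>pmf p k - pmf ?Y k\<bar> \<le> a k + 1 / \<sigma> ^ 4 + 2 * gauss_const 1 / \<sigma>\<^sup>2 / ?z k"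
      and a0: "\<And>k. 0 \<le> a k" and sup: "\<And>k. a k \<le> 2 * gauss_const 3 / \<sigma>\<^sup>2"
      and l2: "\<And>F. finite F \<Longrightarrow> card F \<le> 3 * \<sigma>\<^sup>2 \<Longrightarrow> (\<Sum>k\<in>F. (a k)\<^sup>2 * ?z k) \<le> M / \<sigma> ^ 3"
      using normal_approximation_pointwise[OF fin \<sigma>, of \<mu>] stein unfolding M_def by blast
    define F where "F = {\<lceil>\<mu> - \<sigma>\<^sup>2\<rceil>..\<lfloor>\<mu> + \<sigma>\<^sup>2\<rfloor>}"
    have \<sigma>2: "1 \<le> \<sigma>\<^sup>2" using \<sigma> by (simp add: one_le_power)
    have F: "finite F" by (simp add: F_def)
    have card: "card F \<le> 3 * \<sigma>\<^sup>2"
    proof -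
      have "real (card F) \<le> max 0 (real_of_int (\<lfloor>\<mu> + \<sigma>\<^sup>2\<rfloor> + 1 - \<lceil>\<mu> - \<sigma>\<^sup>2\<rceil>))"
        by (simp add: F_def)
      also have "\<dots> \<le> 3 * \<sigma>\<^sup>2"
        using \<sigma>2 of_int_floor_le[of "\<mu> + \<sigma>\<^sup>2"] le_of_int_ceiling[of "\<mu> - \<sigma>\<^sup>2"] by (simp add: max_def) linarith
      finally show ?thesis .
    qed
    have far: "\<sigma>\<^sup>2 \<le> \<bar>real_of_int k - \<mu>\<bar>" if "k \<notin> F" for k
    proof -
      from that have "k < \<lceil>\<mu> - \<sigma>\<^sup>2\<rceil> \<or> \<lfloor>\<mu> + \<sigma>\<^sup>2\<rfloor> < k" by (auto simp: F_def)
      then show ?thesis by (auto simp: less_ceiling_iff floor_less_iff)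
    qed
    have "(\<Sum>k\<in>F. \<bar>pmf p k - pmf ?Y k\<bar>) \<le> (\<Sum>k\<in>F. a k + 1 / \<sigma> ^ 4 + 2 * gauss_const 1 / \<sigma>\<^sup>2 * (1 / ?z k))"
      using near by (intro sum_mono) simp
    also have "\<dots> = (\<Sum>k\<in>F. a k) + card F * (1 / \<sigma> ^ 4) + 2 * gauss_const 1 / \<sigma>\<^sup>2 * (\<Sum>k\<in>F. 1 / ?z k)"
      by (simp only: sum.distrib sum_distrib_left[symmetric] sum_constant)
    also have "\<dots> \<le> (M / 2 + pi) / \<sigma> + 3 * \<sigma>\<^sup>2 * (1 / \<sigma> ^ 4) + 2 * gauss_const 1 / \<sigma>\<^sup>2 * (2 * pi * \<sigma>)"
      using card K[of 1]
      by (intro add_mono mult_left_mono mult_right_mono weighted_l1_bound[OF \<sigma> F a0 l2] lattice_cauchy_sum \<sigma> F card) auto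
    finally have l1: "(\<Sum>k\<in>F. \<bar>pmf p k - pmf ?Y k\<bar>) \<le>
        (M / 2 + pi) / \<sigma> + 3 * \<sigma>\<^sup>2 * (1 / \<sigma> ^ 4) + 2 * gauss_const 1 / \<sigma>\<^sup>2 * (2 * pi * \<sigma>)" .
    have inv: "1 / \<sigma>\<^sup>2 \<le> 1 / \<sigma>"
      using \<sigma> by (intro divide_left_mono) (auto simp: power2_eq_square)
    have "d_TV p ?Y \<le> (\<Sum>k\<in>F. \<bar>pmf p k - pmf ?Y k\<bar>) + measure_pmf.prob p (- F)" by (rule d_TV_le[OF F])
    also have "measure_pmf.prob p (- F) \<le> 1 / \<sigma>\<^sup>2" by (rule prob_far_le[OF fin \<sigma>0 var far])
    also have "3 * \<sigma>\<^sup>2 * (1 / \<sigma> ^ 4) = 3 * (1 / \<sigma>\<^sup>2)" using \<sigma>0 by (simp add: power4_eq_xxxx power2_eq_square)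
    note l1[unfolded this]
    finally have "d_TV p ?Y \<le> (M / 2 + pi) / \<sigma> + 3 * (1 / \<sigma>\<^sup>2) + 2 * gauss_const 1 / \<sigma>\<^sup>2 * (2 * pi * \<sigma>) + 1 / \<sigma>\<^sup>2" by simp
    also have "2 * gauss_const 1 / \<sigma>\<^sup>2 * (2 * pi * \<sigma>) = 2 * gauss_const 1 * (2 * pi) / \<sigma>"
      using \<sigma>0 by (simp add: power2_eq_square)
    also have "(M / 2 + pi) / \<sigma> + 3 * (1 / \<sigma>\<^sup>2) + 2 * gauss_const 1 * (2 * pi) / \<sigma> + 1 / \<sigma>\<^sup>2 \<le>
        (M / 2 + pi) / \<sigma> + 3 * (1 / \<sigma>) + 2 * gauss_const 1 * (2 * pi) / \<sigma> + 1 / \<sigma>"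
      using inv by linarith
    also have "\<dots> = C1 / \<sigma>" by (simp add: C1_def add_divide_distrib)
    finally have TV: "d_TV p ?Y \<le> C1 / \<sigma>" .
    have "d_loc p ?Y \<le> C2 / \<sigma>\<^sup>2"
    proof (rule d_loc_le)
      fix k
      have "1 / \<sigma> ^ 4 \<le> 1 / \<sigma>\<^sup>2" using \<sigma> by (intro divide_left_mono power_increasing) auto
      moreover have "2 * gauss_const 1 / \<sigma>\<^sup>2 / ?z k \<le> 2 * gauss_const 1 / \<sigma>\<^sup>2 / 1"
        using K[of 1] by (intro divide_left_mono) (auto simp: add_pos_nonneg)
      ultimately have "\<bar>pmf p k - pmf ?Y k\<bar> \<le> 2 * gauss_const 3 / \<sigma>\<^sup>2 + 1 / \<sigma>\<^sup>2 + 2 * gauss_const 1 / \<sigma>\<^sup>2"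
        using near[of k] sup[of k] by linarith
      then show "\<bar>pmf p k - pmf ?Y k\<bar> \<le> C2 / \<sigma>\<^sup>2" by (simp add: C2_def add_divide_distrib)
    qed
    with TV show ?thesis ..
  qed
  have "C1 / \<sigma> \<le> (max C1 C2) / \<sigma>" "C2 / \<sigma>\<^sup>2 \<le> (max C1 C2) / \<sigma>\<^sup>2" if "\<sigma> \<ge> 1" for \<sigma> :: real
    using that by (auto intro!: divide_right_mono)
  with main show ?thesis by (intro exI[of _ "max C1 C2"]) (meson order_trans)
qed

section \<open>The number of monochromatic edges\<close>

lemma monochromatic_edges_expectation:
  fixes h :: "int \<Rightarrow> 'b::{banach, second_countable_topology}"
  assumes "finite V" "c > 0"
  shows "measure_pmf.expectation (monochromatic_edges_pmf V E c) h =
    average c V (\<lambda>f. h (int (mono_count E f))) (\<lambda>_. 0)"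
  unfolding monochromatic_edges_pmf_def integral_map_pmf
  by (simp add: expectation_uniform_coloring[OF assms] mono_count_def)

lemma finite_set_monochromatic_edges_pmf:
  assumes "finite E"
  shows "finite (set_pmf (monochromatic_edges_pmf V E c))"
proof (rule finite_subset)
  show "set_pmf (monochromatic_edges_pmf V E c) \<subseteq> int ` {..card E}"
    unfolding monochromatic_edges_pmf_def using assms by (auto intro!: imageI card_mono)
qed simp

lemma degree_le_max_degree:
  assumes "simple_graph V E"
  shows "degree E v \<le> max_degree V E"
proof (cases "v \<in> V")
  case True
  with assms show ?thesis by (simp add: max_degree_def simple_graph_def)
next
  case False
  then have "{e \<in> E. v \<in> e} = {}" using assms by (auto simp: simple_graph_def)
  then show ?thesis by (simp only: degree_def card.empty zero_le)
qed

lemma simple_graph_finite_edges: "simple_graph V E \<Longrightarrow> finite E"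
  unfolding simple_graph_def by (meson Pow_iff finite_Pow_iff finite_subset subsetI)

lemma monochromatic_edges_moments:
  assumes G: "simple_graph V E" and c: "c > 0"
  shows "measure_pmf.expectation (monochromatic_edges_pmf V E c) real_of_int = card E / c"
    and "measure_pmf.expectation (monochromatic_edges_pmf V E c) (\<lambda>k. (real_of_int k - card E / c)\<^sup>2) =
      card E / c * (1 - 1 / c)"
proof -
  have E: "\<forall>e\<in>E. card e = 2" "finite E" "finite V" "\<And>e. e \<in> E \<Longrightarrow> e \<subseteq> V"
    using G simple_graph_finite_edges[OF G] by (auto simp: simple_graph_def)
  show "measure_pmf.expectation (monochromatic_edges_pmf V E c) real_of_int = card E / c"
    by (simp add: monochromatic_edges_expectation[OF E(3) c] average_mono_count[OF E c])
  show "measure_pmf.expectation (monochromatic_edges_pmf V E c) (\<lambda>k. (real_of_int k - card E / c)\<^sup>2) =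
      card E / c * (1 - 1 / c)"
    by (simp add: monochromatic_edges_expectation[OF E(3) c] average_mono_count_variance[OF E c])
qed

text \<open>A bound for each single graph with \<open>d\<^sup>2 \<le> c/8\<close> and \<open>c \<le> m/2\<close>, which the asymptotic assumptions of the
theorem provide for all large \<open>n\<close>.\<close>

lemma monochromatic_edges_normal_approximation:
  "\<exists>C::real. 0 \<le> C \<and> (\<forall>V (E :: 'a set set) c. simple_graph V E \<longrightarrow> 2 \<le> c \<longrightarrow>
     8 * (real (max_degree V E))\<^sup>2 \<le> c \<longrightarrow> 2 * real c \<le> card E \<longrightarrow>
     (let W = monochromatic_edges_pmf V E c;
          Y = discretized_normal (measure_pmf.expectation W real_of_int) (measure_pmf.variance W real_of_int)
      in d_TV W Y \<le> C * sqrt (c / card E) \<and> d_loc W Y \<le> C * (c / card E)))"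
proof -
  obtain C where C: "\<And>(p :: int pmf) \<mu> \<sigma>. finite (set_pmf p) \<Longrightarrow> \<sigma> \<ge> 1 \<Longrightarrow>
    measure_pmf.expectation p (\<lambda>k. (real_of_int k - \<mu>)\<^sup>2) = \<sigma>\<^sup>2 \<Longrightarrow>
    (\<forall>t. \<bar>t\<bar> \<le> pi \<longrightarrow>
      norm (measure_pmf.expectation p (\<lambda>k. \<i> * of_real (real_of_int k - \<mu>) * cis (t * (real_of_int k - \<mu>)))
        + of_real (t * \<sigma>\<^sup>2) * measure_pmf.expectation p (\<lambda>k. cis (t * (real_of_int k - \<mu>))))
      \<le> 4 * \<sigma>\<^sup>2 * t\<^sup>2 * exp (- \<sigma>\<^sup>2 * t\<^sup>2 / 24)) \<Longrightarrow>
    d_TV p (discretized_normal \<mu> (\<sigma>\<^sup>2)) \<le> C / \<sigma> \<and> d_loc p (discretized_normal \<mu> (\<sigma>\<^sup>2)) \<le> C / \<sigma>\<^sup>2"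
    using normal_approximation_of_stein_bound by blast
  define C' where "C' = \<bar>C\<bar> * 2"
  have "let W = monochromatic_edges_pmf V E c;
          Y = discretized_normal (measure_pmf.expectation W real_of_int) (measure_pmf.variance W real_of_int)
      in d_TV W Y \<le> C' * sqrt (c / card E) \<and> d_loc W Y \<le> C' * (c / card E)"
    if G: "simple_graph V E" and c2: "2 \<le> c" and d: "8 * (real (max_degree V E))\<^sup>2 \<le> c" and m: "2 * real c \<le> card E"
    for V and E :: "'a set set" and c :: nat
  proof -
    define W where "W = monochromatic_edges_pmf V E c"
    define \<mu> where "\<mu> = card E / c"
    define \<sigma> where "\<sigma> = sqrt (card E / c * (1 - 1 / c))"
    have c0: "c > 0" using c2 by simp
    have E: "\<forall>e\<in>E. card e = 2" "finite E" "finite V" "\<And>e. e \<in> E \<Longrightarrow> e \<subseteq> V"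
      using G simple_graph_finite_edges[OF G] by (auto simp: simple_graph_def)
    have dn: "8 * (max_degree V E)\<^sup>2 \<le> c"
    proof -
      have "real (8 * (max_degree V E)\<^sup>2) \<le> real c" using d by simp
      then show ?thesis unfolding of_nat_le_iff .
    qed
    \<comment> \<open>There is an edge, hence a vertex of degree at least \<open>1\<close>.\<close>
    have c8: "8 \<le> c"
    proof -
      have "E \<noteq> {}" using m c0 by auto
      then obtain e where e: "e \<in> E" by blast
      then have "card e = 2" using E(1) by blast
      then obtain v where "v \<in> e" by fastforce
      with e have "{e \<in> E. v \<in> e} \<noteq> {}" by blast
      with E(2) have "card {e \<in> E. v \<in> e} \<noteq> 0" by simp
      then have "1 \<le> degree E v" unfolding degree_def by linarith
      also have "\<dots> \<le> max_degree V E" by (rule degree_le_max_degree[OF G])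
      finally have "1 \<le> (max_degree V E)\<^sup>2" by simp
      with dn show ?thesis by linarith
    qed
    have \<mu>: "measure_pmf.expectation W real_of_int = \<mu>"
      unfolding W_def \<mu>_def by (rule monochromatic_edges_moments(1)[OF G c0])
    have half: "1 / 2 \<le> 1 - 1 / real c" "0 \<le> 1 - 1 / real c" using c2 by (auto simp: field_simps)
    have r2: "2 \<le> card E / c" using m c0 by (simp add: field_simps)
    have s2: "\<sigma>\<^sup>2 = card E / c * (1 - 1 / c)" using half by (simp add: \<sigma>_def)
    have var: "measure_pmf.expectation W (\<lambda>k. (real_of_int k - \<mu>)\<^sup>2) = \<sigma>\<^sup>2"
      unfolding W_def \<mu>_def s2 by (rule monochromatic_edges_moments(2)[OF G c0])
    have lower: "card E / c / 2 \<le> \<sigma>\<^sup>2"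
      using mult_left_mono[OF half(1), of "card E / c"] by (simp add: s2)
    have "1 \<le> card E / c / 2" using r2 by simp
    then have "1\<^sup>2 \<le> \<sigma>\<^sup>2" using lower by simp
    then have \<sigma>1: "1 \<le> \<sigma>"
      by (rule power2_le_imp_le) (use half in \<open>simp add: \<sigma>_def\<close>)
    have inv: "1 / \<sigma>\<^sup>2 \<le> 2 * (c / card E)"
    proof -
      have "1 / \<sigma>\<^sup>2 \<le> 1 / (card E / c / 2)" by (rule frac_le[OF _ _ _ lower]) (use r2 in simp_all)
      then show ?thesis by (simp add: mult.commute)
    qed
    have "norm (measure_pmf.expectation W (\<lambda>k. \<i> * of_real (real_of_int k - \<mu>) * cis (t * (real_of_int k - \<mu>)))
        + of_real (t * \<sigma>\<^sup>2) * measure_pmf.expectation W (\<lambda>k. cis (t * (real_of_int k - \<mu>))))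
      \<le> 4 * \<sigma>\<^sup>2 * t\<^sup>2 * exp (- \<sigma>\<^sup>2 * t\<^sup>2 / 24)" if "\<bar>t\<bar> \<le> pi" for t
      using monochromatic_edges_stein[OF E(1,2) degree_le_max_degree[OF G] dn c8 E(3,4) that, of "\<lambda>_. 0"]
      unfolding W_def \<mu>_def s2 monochromatic_edges_expectation[OF E(3) c0]
      by (simp only: of_real_mult of_int_of_nat_eq)
    with C[OF _ \<sigma>1 var] have "d_TV W (discretized_normal \<mu> (\<sigma>\<^sup>2)) \<le> C / \<sigma>" "d_loc W (discretized_normal \<mu> (\<sigma>\<^sup>2)) \<le> C / \<sigma>\<^sup>2"
      using finite_set_monochromatic_edges_pmf[OF E(2)] unfolding W_def by blast+
    moreover have "C / \<sigma> \<le> C' * sqrt (c / card E)"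
    proof -
      have "2 * (c / card E) \<le> 4 * (c / card E)" by (intro mult_right_mono) auto
      with inv have "1 / \<sigma>\<^sup>2 \<le> 4 * (c / card E)" by (rule order_trans)
      then have "sqrt (1 / \<sigma>\<^sup>2) \<le> sqrt (4 * (c / card E))" by (rule real_sqrt_le_mono)
      then have "1 / \<sigma> \<le> 2 * sqrt (c / card E)"
        using \<sigma>1 by (simp only: real_sqrt_divide real_sqrt_mult real_sqrt_one real_sqrt_abs real_sqrt_four abs_of_nonneg order_trans[OF zero_le_one])
      then have "\<bar>C\<bar> * (1 / \<sigma>) \<le> \<bar>C\<bar> * (2 * sqrt (c / card E))" by (rule mult_left_mono) simp
      moreover have "C / \<sigma> \<le> \<bar>C\<bar> * (1 / \<sigma>)" using \<sigma>1 by (simp add: divide_right_mono)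
      ultimately show ?thesis by (simp add: C'_def)
    qed
    moreover have "C / \<sigma>\<^sup>2 \<le> C' * (c / card E)"
    proof -
      have "\<bar>C\<bar> * (1 / \<sigma>\<^sup>2) \<le> \<bar>C\<bar> * (2 * (c / card E))" using inv by (rule mult_left_mono) simp
      moreover have "C / \<sigma>\<^sup>2 \<le> \<bar>C\<bar> * (1 / \<sigma>\<^sup>2)" by (simp add: divide_right_mono)
      ultimately show ?thesis by (simp only: C'_def mult.assoc)
    qed
    ultimately show ?thesis
      unfolding Let_def W_def[symmetric] \<mu> var by linarith
  qed
  moreover have "0 \<le> C'" by (simp add: C'_def)
  ultimately show ?thesis by blast
qed

theorem theorem3p6:
  shows "\<exists>C::real. \<forall>(E :: nat \<Rightarrow> nat set set) (c :: nat \<Rightarrow> nat).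
    let m = (\<lambda>n. card (E n));
        d = (\<lambda>n. max_degree {1..n} (E n));
        W = (\<lambda>n. monochromatic_edges_pmf {1..n} (E n) (c n));
        Y = (\<lambda>n. discretized_normal (measure_pmf.expectation (W n) real_of_int)
                                   (measure_pmf.variance (W n) real_of_int))
    in (\<forall>n\<ge>1. simple_graph {1..n} (E n)) \<longrightarrow> (\<forall>n\<ge>1. c n \<ge> 2) \<longrightarrow>
       (\<lambda>n. (real (d n))\<^sup>2) \<lless> (\<lambda>n. real (c n)) \<longrightarrow>
       (\<lambda>n. real (c n)) \<lless> (\<lambda>n. real (m n)) \<longrightarrow>
       (\<forall>\<^sub>F n in sequentially.
          d_TV (W n) (Y n) \<le> C * (sqrt (c n / m n) + d n ^ 4 / c n ^ 3) \<and>
          d_loc (W n) (Y n) \<le> C * (sqrt (c n / m n) + d n ^ 4 / c n ^ 3) powr (1/2)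
                              * sqrt (c n / m n + d n / sqrt (c n)))"
proof -
  obtain C :: real where C0: "0 \<le> C" and C: "\<And>V (E :: nat set set) c. simple_graph V E \<Longrightarrow> 2 \<le> c \<Longrightarrow>
     8 * (real (max_degree V E))\<^sup>2 \<le> c \<Longrightarrow> 2 * real c \<le> card E \<Longrightarrow>
     (let W = monochromatic_edges_pmf V E c;
          Y = discretized_normal (measure_pmf.expectation W real_of_int) (measure_pmf.variance W real_of_int)
      in d_TV W Y \<le> C * sqrt (c / card E) \<and> d_loc W Y \<le> C * (c / card E))"
    using monochromatic_edges_normal_approximation[where 'a = nat] by blast
  have eventually_le: "\<forall>\<^sub>F n in sequentially. K * a n \<le> b n"
    if "a \<lless> b" "\<And>n. 0 \<le> b n" "K > 0" for a b :: "nat \<Rightarrow> real" and K :: real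
  proof -
    from that have nz: "\<forall>\<^sub>F n in sequentially. b n \<noteq> 0" and lim: "(\<lambda>n. a n / b n) \<longlonglongrightarrow> 0"
      by (simp_all add: much_less_def)
    have "\<forall>\<^sub>F n in sequentially. a n / b n < 1 / K"
      using lim by (rule order_tendstoD(2)) (use that in simp)
    with nz show ?thesis
    proof eventually_elim
      case (elim n)
      with that(2)[of n] have "0 < b n" by simp
      with elim that(3) show ?case by (simp add: field_simps)
    qed
  qed
  have bounds: "d_TV W Y \<le> C * (sqrt (c / m) + d ^ 4 / c ^ 3) \<and>
      d_loc W Y \<le> C * (sqrt (c / m) + d ^ 4 / c ^ 3) powr (1/2) * sqrt (c / m + d / sqrt c)"
    if TV: "d_TV W Y \<le> C * sqrt (c / m)" and loc: "d_loc W Y \<le> C * (c / m)" and m: "2 * real c \<le> real m" and c: "c > 0"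
    for W Y and c m d :: nat
  proof
    define x where "x = real c / real m"
    have x: "0 < x" "x \<le> 1" using m c by (auto simp: x_def)
    have pos: "0 \<le> real d ^ 4 / real c ^ 3" by simp
    have "C * sqrt x \<le> C * (sqrt x + d ^ 4 / c ^ 3)" using C0 pos by (intro mult_left_mono) auto
    with TV show "d_TV W Y \<le> C * (sqrt (c / m) + d ^ 4 / c ^ 3)" by (simp add: x_def)
    \<comment> \<open>As \<open>x \<le> 1\<close>, the bound \<open>x\<close> on the local distance is at most \<open>x powr (3/4)\<close>.\<close>
    have "x \<le> sqrt (sqrt x) * sqrt x"
    proof -
      have "x \<le> sqrt x" using x by (intro real_le_rsqrt) (simp add: power2_eq_square mult_left_le)
      moreover from this x have "sqrt x \<le> sqrt (sqrt x)" by (intro real_sqrt_le_mono)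
      ultimately have "sqrt x * sqrt x \<le> sqrt (sqrt x) * sqrt x" using x by (intro mult_right_mono) auto
      then show ?thesis using x by simp
    qed
    also have "\<dots> \<le> (sqrt x + d ^ 4 / c ^ 3) powr (1/2) * sqrt (x + d / sqrt c)"
      using x by (subst powr_half_sqrt) (auto intro!: mult_mono)
    finally have "C * x \<le> C * ((sqrt x + d ^ 4 / c ^ 3) powr (1/2) * sqrt (x + d / sqrt c))"
      using C0 by (rule mult_left_mono)
    with loc show "d_loc W Y \<le> C * (sqrt (c / m) + d ^ 4 / c ^ 3) powr (1/2) * sqrt (c / m + d / sqrt c)"
      by (simp add: x_def mult.assoc)
  qed
  show ?thesis
    unfolding Let_def
  proof (intro exI[of _ C] allI impI)
    fix E :: "nat \<Rightarrow> nat set set" and c :: "nat \<Rightarrow> nat"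
    assume G: "\<forall>n\<ge>1. simple_graph {1..n} (E n)" and c2: "\<forall>n\<ge>1. c n \<ge> 2"
      and dc: "(\<lambda>n. (real (max_degree {1..n} (E n)))\<^sup>2) \<lless> (\<lambda>n. real (c n))"
      and cm: "(\<lambda>n. real (c n)) \<lless> (\<lambda>n. real (card (E n)))"
    let ?W = "\<lambda>n. monochromatic_edges_pmf {1..n} (E n) (c n)"
    let ?Y = "\<lambda>n. discretized_normal (measure_pmf.expectation (?W n) real_of_int) (measure_pmf.variance (?W n) real_of_int)"
    have "\<forall>\<^sub>F n in sequentially. 8 * (real (max_degree {1..n} (E n)))\<^sup>2 \<le> real (c n)"
      by (rule eventually_le[OF dc]) auto
    moreover have "\<forall>\<^sub>F n in sequentially. 2 * real (c n) \<le> real (card (E n))"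
      by (rule eventually_le[OF cm]) auto
    moreover have "\<forall>\<^sub>F n in sequentially. n \<ge> (1::nat)" by (rule eventually_ge_at_top)
    ultimately show "\<forall>\<^sub>F n in sequentially.
        d_TV (?W n) (?Y n) \<le> C * (sqrt (c n / card (E n)) + max_degree {1..n} (E n) ^ 4 / c n ^ 3) \<and>
        d_loc (?W n) (?Y n) \<le> C * (sqrt (c n / card (E n)) + max_degree {1..n} (E n) ^ 4 / c n ^ 3) powr (1/2)
          * sqrt (c n / card (E n) + max_degree {1..n} (E n) / sqrt (c n))"
    proof eventually_elim
      case (elim n)
      then have "simple_graph {1..n} (E n)" "2 \<le> c n" using G c2 by auto
      from C[OF this elim(1,2)] have "d_TV (?W n) (?Y n) \<le> C * sqrt (c n / card (E n))"
        "d_loc (?W n) (?Y n) \<le> C * (c n / card (E n))" unfolding Let_def by auto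
      moreover from \<open>2 \<le> c n\<close> have "c n > 0" by simp
      ultimately show ?case using elim(2) by (intro bounds)
    qed
  qed
qed

end
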